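(* Let $G$ be a finite abelian group with identity $1$ and let $S$ be an inverse-closed subset of $G \setminus \{1\}$ which generates $G$ and for which there exists $s \in S$ such that $\langle S \setminus \{s, s^{-1}\} \rangle \neq G$. Then the Cayley graph $\mathrm{Cay}(G;S)$ is distance-regular if and only if it is isomorphic to one of the following graphs: (i) the complete bipartite graph $K_{3,3}$; (ii) the complete tripartite graph $K_{2,2,2}$; (iii) the complete bipartite graph minus a perfect matching, $K_{6,6} - 6K_2$; (iv) the cycle $C_n$ for some $n \geq 3$; (v) the Hamming graph $H(d,n)$, where $d \geq 1$ and $n \in \{2,3,4\}$; (vi) the Doob graph $D(n,m)$ where $n,m \geq 1$; (vii) the antipodal quotient of the Hamming graph $H(d,2)$, where $d \geq 2$.
   Context: Graphs are finite, undirected, without loops or multiple edges. For a group $G$ and an inverse-closed $S \subseteq G\setminus\{1\}$, the Cayley graph $\mathrm{Cay}(G;S)$ has vertex set $G$, with $g$ adjacent to $h$ iff $h = gs'$ for some $s' \in S$. A connected graph $\Gamma$ of diameter $d$ with path-length distance $\partial$ is distance-regular if for each $0\le i\le d$ the numbers $c_i(x,y)=|N_{i-1}(x)\cap N(y)|$, $a_i(x,y)=|N_i(x)\cap N(y)|$, $b_i(x,y)=|N_{i+1}(x)\cap N(y)|$ depend only on $i=\partial(x,y)$ (here $N_j(x)$ is the set of vertices at distance $j$ from $x$ and $N(y)=N_1(y)$). The Cartesian product $\Gamma_1 \square \Gamma_2$ has vertex set $V(\Gamma_1)\times V(\Gamma_2)$, with $(u_1,v_1)\sim(u_2,v_2)$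 iff ($u_1=u_2$ and $v_1\sim v_2$) or ($u_1\sim u_2$ and $v_1=v_2$). The Hamming graph $H(d,q)$ is the Cartesian product of $d$ copies of $K_q$. In $H(d,2)$ each vertex has a unique vertex at distance $d$ (its antipode); the antipodal quotient of $H(d,2)$ has as vertices the antipodal pairs, two pairs adjacent iff there is an edge of $H(d,2)$ between them. The Shrikhande graph is $\mathrm{Cay}(\mathbb{Z}_4\times\mathbb{Z}_4;\{\pm(1,0),\pm(1,1),\pm(0,1)\})$. For $n\ge 0$, $m\ge1$, the Doob graph $D(n,m)$ is the Cartesian product of $H(n,4)$ with $m$ copies of the Shrikhande graph. *)

theory Defs
  imports
    "HOL-Algebra.Generated_Groups"
    "HOL-Algebra.Elementary_Groups"
    "Graph_Theory.Digraph_Isomorphism"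
begin

text \<open>
  Finite simple graphs are represented by the library's \<open>'a pair_pre_digraph\<close> (an undirected
  edge is a pair of opposite arcs) subject to the library's locale predicate \<open>pair_graph\<close>:
  finite, symmetric, loop-free. Isomorphism is the library's \<open>digraph_iso\<close>;
  the lemma \<open>graph_iso_iff\<close> spells it out for this representation.
\<close>

abbreviation graph_iso :: "'a pair_pre_digraph \<Rightarrow> 'b pair_pre_digraph \<Rightarrow> bool" (infix \<open>\<cong>\<^sub>g\<close> 50) where
  "\<Gamma> \<cong>\<^sub>g \<Delta> \<equiv> digraph_iso (with_proj \<Gamma>) (with_proj \<Delta>)"

lemma graph_iso_iff:
  assumes "pair_wf_digraph \<Gamma>" and "pair_wf_digraph \<Delta>"
  shows "\<Gamma> \<cong>\<^sub>g \<Delta> \<longleftrightarrow>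
    (\<exists>f. bij_betw f (pverts \<Gamma>) (pverts \<Delta>) \<and>
      (\<forall>x\<in>pverts \<Gamma>. \<forall>y\<in>pverts \<Gamma>. (x, y) \<in> parcs \<Gamma> \<longleftrightarrow> (f x, f y) \<in> parcs \<Delta>))"
    (is "?L \<longleftrightarrow> ?R")
proof
  interpret G: pair_wf_digraph \<Gamma> by fact
  assume ?L
  then obtain h where h: "pre_digraph.digraph_isomorphism (with_proj \<Gamma>) h"
    and H: "with_proj \<Delta> = app_iso h (with_proj \<Gamma>)"
    unfolding digraph_iso_def by blast
  have V: "pverts \<Delta> = iso_verts h ` pverts \<Gamma>"
    using arg_cong[OF H, of verts] by simp
  have inj: "inj_on (iso_verts h) (pverts \<Gamma>)"
    using h by (simp add: pre_digraph.digraph_isomorphism_def)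
  have "arcs_ends (app_iso h (with_proj \<Gamma>))
      = (\<lambda>(u, v). (iso_verts h u, iso_verts h v)) ` arcs_ends (with_proj \<Gamma>)"
    using assms(1) h by (intro wf_digraph.arcs_ends_app_iso_eq) (simp_all add: wf_digraph_wp_iff)
  then have A: "parcs \<Delta> = (\<lambda>(u, v). (iso_verts h u, iso_verts h v)) ` parcs \<Gamma>"
    unfolding H[symmetric] by simp
  have "(x, y) \<in> parcs \<Gamma> \<longleftrightarrow> (iso_verts h x, iso_verts h y) \<in> parcs \<Delta>"
    if "x \<in> pverts \<Gamma>" "y \<in> pverts \<Gamma>" for x y
  proof
    assume "(iso_verts h x, iso_verts h y) \<in> parcs \<Delta>"
    then obtain a b where ab: "(a, b) \<in> parcs \<Gamma>" "iso_verts h x = iso_verts h a" "iso_verts h y = iso_verts h b"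
      unfolding A by auto
    moreover have "a \<in> pverts \<Gamma>" "b \<in> pverts \<Gamma>" using ab(1) G.in_arcsD1 G.in_arcsD2 by auto
    ultimately have "x = a" "y = b" using inj that by (simp_all add: inj_on_eq_iff)
    then show "(x, y) \<in> parcs \<Gamma>" using ab(1) by simp
  qed (auto simp: A)
  then show ?R using V inj by (auto simp: bij_betw_def)
next
  interpret G: pair_wf_digraph \<Gamma> by fact
  interpret D: pair_wf_digraph \<Delta> by fact
  assume ?R
  then obtain f where inj: "inj_on f (pverts \<Gamma>)" and V: "pverts \<Delta> = f ` pverts \<Gamma>"
    and adj: "\<And>x y. x \<in> pverts \<Gamma> \<Longrightarrow> y \<in> pverts \<Gamma> \<Longrightarrow> (x, y) \<in> parcs \<Gamma> \<longleftrightarrow> (f x, f y) \<in> parcs \<Delta>"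
    by (auto simp: bij_betw_def)
  have A: "parcs \<Delta> = map_prod f f ` parcs \<Gamma>"
  proof
    show "parcs \<Delta> \<subseteq> map_prod f f ` parcs \<Gamma>"
    proof
      fix e assume e: "e \<in> parcs \<Delta>"
      then obtain x y where xy: "x \<in> pverts \<Gamma>" "y \<in> pverts \<Gamma>" "e = (f x, f y)"
        using D.arc_fst_in_verts[OF e] D.arc_snd_in_verts[OF e] V by (cases e) auto
      then have "(x, y) \<in> parcs \<Gamma>" using e adj by simp
      then show "e \<in> map_prod f f ` parcs \<Gamma>" using xy(3) by (auto intro: rev_image_eqI)
    qed
    show "map_prod f f ` parcs \<Gamma> \<subseteq> parcs \<Delta>"
      using adj by (auto dest: G.in_arcsD1 G.in_arcsD2)
  qed
  have injA: "inj_on (map_prod f f) (parcs \<Gamma>)"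
    by (rule inj_on_subset[OF map_prod_inj_on[OF inj inj]]) (auto dest: G.in_arcsD1 G.in_arcsD2)
  define h where "h = \<lparr>iso_verts = f, iso_arcs = map_prod f f, iso_head = snd, iso_tail = fst\<rparr>"
  have "pre_digraph.digraph_isomorphism (with_proj \<Gamma>) h"
    using inj injA assms(1)
    by (simp add: pre_digraph.digraph_isomorphism_def h_def wf_digraph_wp_iff)
  moreover have "with_proj \<Delta> = app_iso h (with_proj \<Gamma>)"
    by (simp add: app_iso_def with_proj_def h_def V A)
  ultimately show ?L unfolding digraph_iso_def by blast
qed


section \<open>Distance-regular graphs\<close>

text \<open>Only meaningful when some walk joins \<open>x\<close> to \<open>y\<close>.\<close>

definition gdist :: "'a pair_pre_digraph \<Rightarrow> 'a \<Rightarrow> 'a \<Rightarrow> nat" where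
  "gdist \<Gamma> x y = (LEAST n. \<exists>p. pre_digraph.awalk (with_proj \<Gamma>) x p y \<and> length p = n)"

definition diameter :: "'a pair_pre_digraph \<Rightarrow> nat" where
  "diameter \<Gamma> = Max {gdist \<Gamma> x y | x y. x \<in> pverts \<Gamma> \<and> y \<in> pverts \<Gamma>}"

text \<open>The index is an integer so that \<open>N\<^sub>j(x)\<close> is empty for \<open>j = -1\<close>.\<close>

definition sphere :: "'a pair_pre_digraph \<Rightarrow> int \<Rightarrow> 'a \<Rightarrow> 'a set" where
  "sphere \<Gamma> j x = {z \<in> pverts \<Gamma>. int (gdist \<Gamma> x z) = j}"

definition distance_regular :: "'a pair_pre_digraph \<Rightarrow> bool" where
  "distance_regular \<Gamma> \<longleftrightarrow>
    pair_graph \<Gamma> \<and> connected (with_proj \<Gamma>) \<and>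
    (\<forall>i \<le> diameter \<Gamma>. \<exists>c a b. \<forall>x \<in> pverts \<Gamma>. \<forall>y \<in> pverts \<Gamma>. gdist \<Gamma> x y = i \<longrightarrow>
      card (sphere \<Gamma> (int i - 1) x \<inter> sphere \<Gamma> 1 y) = c \<and>
      card (sphere \<Gamma> (int i) x \<inter> sphere \<Gamma> 1 y) = a \<and>
      card (sphere \<Gamma> (int i + 1) x \<inter> sphere \<Gamma> 1 y) = b)"


section \<open>Cayley graphs\<close>

definition cayley_graph :: "('a, 'b) monoid_scheme \<Rightarrow> 'a set \<Rightarrow> 'a pair_pre_digraph" where
  "cayley_graph G S =
    \<lparr>pverts = carrier G,
     parcs = {(g, h). g \<in> carrier G \<and> h \<in> carrier G \<and> (\<exists>s\<in>S. h = g \<otimes>\<^bsub>G\<^esub> s)}\<rparr>"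

lemma pair_graph_cayley_graph:
  assumes "group G" "finite (carrier G)" "S \<subseteq> carrier G - {\<one>\<^bsub>G\<^esub>}" "\<And>s. s \<in> S \<Longrightarrow> inv\<^bsub>G\<^esub> s \<in> S"
  shows "pair_graph (cayley_graph G S)"
proof -
  interpret group G by fact
  have sym: "(h, g) \<in> parcs (cayley_graph G S)" if "(g, h) \<in> parcs (cayley_graph G S)" for g h
  proof -
    from that obtain s where s: "g \<in> carrier G" "h \<in> carrier G" "s \<in> S" "h = g \<otimes>\<^bsub>G\<^esub> s"
      by (auto simp: cayley_graph_def)
    moreover have "s \<in> carrier G" using s(3) assms(3) by blast
    ultimately have "g = h \<otimes>\<^bsub>G\<^esub> inv\<^bsub>G\<^esub> s" by (simp add: m_assoc)
    then show ?thesis using s assms(4) by (auto simp: cayley_graph_def)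
  qed
  have loop: "fst e \<noteq> snd e" if e: "e \<in> parcs (cayley_graph G S)" for e
  proof
    assume "fst e = snd e"
    moreover obtain g h where "e = (g, h)" by (cases e)
    ultimately obtain s where s: "g \<in> carrier G" "s \<in> S" "g \<otimes>\<^bsub>G\<^esub> s = g"
      using e unfolding cayley_graph_def by fastforce
    then have "s \<in> carrier G" "s \<noteq> \<one>\<^bsub>G\<^esub>" using assms(3) by auto
    with s show False by simp
  qed
  have "parcs (cayley_graph G S) \<subseteq> carrier G \<times> carrier G" by (auto simp: cayley_graph_def)
  then have fin: "finite (parcs (cayley_graph G S))" using assms(2) finite_subset by blast
  show ?thesis
  proof
    show "symmetric (with_proj (cayley_graph G S))"
      unfolding symmetric_def with_proj_simps by (rule symI) (rule sym)
    show "finite (pverts (cayley_graph G S))" using assms(2) by (simp add: cayley_graph_def)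
  qed (use fin loop in \<open>auto simp: cayley_graph_def\<close>)
qed


section \<open>The graphs in the classification\<close>

definition complete_graph :: "nat \<Rightarrow> nat pair_pre_digraph" where
  "complete_graph q =
    \<lparr>pverts = {..<q}, parcs = {(i, j). i < q \<and> j < q \<and> i \<noteq> j}\<rparr>"

text \<open>
  The argument lists the sizes of the parts; the vertex \<open>(i, j)\<close> is the \<open>j\<close>-th vertex
  of part \<open>i\<close>.
\<close>

definition complete_multipartite :: "nat list \<Rightarrow> (nat \<times> nat) pair_pre_digraph" where
  "complete_multipartite ns =
    (let V = {(i, j). i < length ns \<and> j < ns ! i}
     in \<lparr>pverts = V, parcs = {(u, v). u \<in> V \<and> v \<in> V \<and> fst u \<noteq> fst v}\<rparr>)"

text \<open>\<open>K\<^bsub>n,n\<^esub>\<close> minus the perfect matching that joins vertices with equal second component.\<close>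

definition complete_bipartite_minus_matching :: "nat \<Rightarrow> (nat \<times> nat) pair_pre_digraph" where
  "complete_bipartite_minus_matching n =
    \<lparr>pverts = pverts (complete_multipartite [n, n]),
     parcs = parcs (complete_multipartite [n, n]) - {(u, v). snd u = snd v}\<rparr>"

definition cycle_graph :: "nat \<Rightarrow> nat pair_pre_digraph" where
  "cycle_graph n =
    \<lparr>pverts = {..<n},
     parcs = {(i, j). i < n \<and> j < n \<and> (j = (i + 1) mod n \<or> i = (j + 1) mod n)}\<rparr>"

definition cart_prod ::
    "'a pair_pre_digraph \<Rightarrow> 'b pair_pre_digraph \<Rightarrow> ('a \<times> 'b) pair_pre_digraph" (infixr \<open>\<box>\<close> 70) where
  "\<Gamma>1 \<box> \<Gamma>2 =
    \<lparr>pverts = pverts \<Gamma>1 \<times> pverts \<Gamma>2,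
     parcs = {((u1, v1), (u2, v2)).
        u1 \<in> pverts \<Gamma>1 \<and> u2 \<in> pverts \<Gamma>1 \<and> v1 \<in> pverts \<Gamma>2 \<and> v2 \<in> pverts \<Gamma>2 \<and>
        (u1 = u2 \<and> (v1, v2) \<in> parcs \<Gamma>2 \<or> (u1, u2) \<in> parcs \<Gamma>1 \<and> v1 = v2)}\<rparr>"

text \<open>
  The product of \<open>k\<close> copies of a graph. Iterating \<open>\<box>\<close> would change the vertex type at every
  step, so the pair \<open>(x, xs)\<close> is renamed to the list \<open>x # xs\<close>; the empty product is the
  one-vertex graph.
\<close>

primrec cart_power :: "'a pair_pre_digraph \<Rightarrow> nat \<Rightarrow> 'a list pair_pre_digraph" where
  "cart_power \<Gamma> 0 = \<lparr>pverts = {[]}, parcs = {}\<rparr>"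
| "cart_power \<Gamma> (Suc k) =
    (let P = \<Gamma> \<box> cart_power \<Gamma> k; f = (\<lambda>(x, xs). x # xs)
     in \<lparr>pverts = f ` pverts P, parcs = map_prod f f ` parcs P\<rparr>)"

definition hamming_graph :: "nat \<Rightarrow> nat \<Rightarrow> nat list pair_pre_digraph" where
  "hamming_graph d q = cart_power (complete_graph q) d"

definition shrikhande_graph :: "(int \<times> int) pair_pre_digraph" where
  "shrikhande_graph =
    (let Z = integer_mod_group 4 \<times>\<times> integer_mod_group 4; T = {(1, 0), (1, 1), (0, 1)}
     in cayley_graph Z (T \<union> m_inv Z ` T))"

definition doob_graph :: "nat \<Rightarrow> nat \<Rightarrow> (nat list \<times> (int \<times> int) list) pair_pre_digraph" where
  "doob_graph n m = hamming_graph n 4 \<box> cart_power shrikhande_graph m"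

definition antipodal_quotient_hypercube :: "nat \<Rightarrow> nat list set pair_pre_digraph" where
  "antipodal_quotient_hypercube d =
    (let H = hamming_graph d 2;
         V = {{x, y} | x y. x \<in> pverts H \<and> y \<in> pverts H \<and> gdist H x y = d}
     in \<lparr>pverts = V,
         parcs = {(P, Q). P \<in> V \<and> Q \<in> V \<and> P \<noteq> Q \<and> (\<exists>x\<in>P. \<exists>y\<in>Q. (x, y) \<in> parcs H)}\<rparr>)"

end

theory Submission imports Defs "HOL-Algebra.Multiplicative_Group" begin

text \<open>
  Write the group additively, and let \<open>T = S - {s, - s}\<close>, \<open>H = \<langle>T\<rangle>\<close> and \<open>r = s + s\<close>. Distance-regularity
  makes the numbers \<open>c\<^sub>i\<close> and \<open>a\<^sub>i\<close> at a vertex depend on its word length only. Counting the solutions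
  of \<open>x = u + v\<close> in \<open>S\<close> for \<open>x = r\<close>, \<open>x = s\<close> and \<open>x = s + t\<close> leaves, besides cycles and three small
  graphs, these cases. If \<open>\<langle>s\<rangle>\<close> is a direct factor of order at most 4, then comparing the vertices \<open>h\<close> and
  \<open>h + s\<close> for \<open>h\<close> in \<open>H\<close> gives \<open>c\<^sub>i = i\<close> and \<open>a\<^sub>i = (q - 2) i\<close> with \<open>q = 2\<close> or \<open>q = 3\<close>. Otherwise \<open>r\<close> is an
  involution in \<open>H\<close>, and with \<open>f\<close> the word length over \<open>T\<close> the vertices \<open>h\<close> and \<open>h + s\<close> have lengths
  \<open>min (f h) (f (h + r) + 2)\<close> and \<open>min (f h) (f (h + r)) + 1\<close>. If \<open>r\<close> is in \<open>T\<close>, this gives the same formulas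
  with \<open>q = 4\<close>; if not, then \<open>T\<close> generates a hypercube on which \<open>h \<mapsto> h + r\<close> is the antipodal map, so
  that \<open>S\<close> generates a folded cube.

  A set \<open>S\<close> with \<open>c\<^sub>i = i\<close> and \<open>a\<^sub>i = (q - 2) i\<close> generates exactly \<open>q\<^sup>d\<close> elements, where \<open>\<bar>S\<bar> = (q - 1) d\<close>. Local
  considerations partition \<open>S\<close> into pieces that generate quotients of \<open>K\<^sub>q\<close>, \<open>K\<^sub>2 \<box> K\<^sub>2\<close> or the Shrikhande
  graph, and the count of elements makes the product of the pieces direct.
\<close>

section \<open>Distance-regularity and isomorphism\<close>

text \<open>Since \<open>c\<close> and \<open>a\<close> depend on word length alone, vertices of
  equal length in different cosets of \<open>H\<close> must have equal counts; applied to
  \<open>h\<close>, \<open>h + s\<close> and \<open>h + r\<close> this yields recursions for the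
  array. In the case of an involution \<open>r\<close> they break down where \<open>h\<close> and
  \<open>h + r\<close> have equal length. If \<open>r\<close> is in \<open>T\<close>, such ties are
  contradictory; if not, they occur only at the middle level of a cube of even dimension, and there
  they determine its size. The small exceptions arise from an additional representation of a vertex
  \<open>s + t\<close>, which raises c_2 to 3 or 4. As c_2 is a single number, one coincidence
  forces many others and leaves at most three elements in \<open>T\<close>. The array does not
  separate Hamming from Doob graphs, because the Shrikhande graph has the array of H(2,4).
  Recognition therefore relies on group orders: the pieces bound the order from above, the array
  attains the bound. A direct factor of order 4 belongs to q = 2, its graph being the 4-cycle
  H(2,2). For q = 4 the elements \<open>s\<close>, \<open>r\<close>, \<open>- s\<close> form a K_4
  piece; splitting it off at the start excludes pure powers of the Shrikhande graph.\<close>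

lemma pair_graph_iff:
  "pair_graph \<Gamma> \<longleftrightarrow> finite (pverts \<Gamma>) \<and> parcs \<Gamma> \<subseteq> pverts \<Gamma> \<times> pverts \<Gamma> \<and>
    sym (parcs \<Gamma>) \<and> irrefl (parcs \<Gamma>)" (is "?L \<longleftrightarrow> ?R")
proof
  assume ?L
  then interpret pair_graph \<Gamma> .
  have "sym (parcs \<Gamma>)" by (rule symI) (rule arcs_symmetric)
  moreover have "irrefl (parcs \<Gamma>)" unfolding irrefl_def using no_loops'[of x x for x] by blast
  moreover have "parcs \<Gamma> \<subseteq> pverts \<Gamma> \<times> pverts \<Gamma>" using in_arcsD1 in_arcsD2 by (intro subrelI) simp
  ultimately show ?R using pair_finite_verts by simp
next
  assume R: ?R
  then have "finite (parcs \<Gamma>)" by (meson finite_SigmaI finite_subset)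
  moreover have "fst e \<in> pverts \<Gamma>" "snd e \<in> pverts \<Gamma>" "fst e \<noteq> snd e" if "e \<in> parcs \<Gamma>" for e
    using R that by (cases e; force simp: irrefl_def)+
  ultimately show ?L using R by unfold_locales (simp_all add: symmetric_def)
qed

lemma pair_graph_imp_wf: "pair_graph \<Gamma> \<Longrightarrow> pair_wf_digraph \<Gamma>"
  using pair_digraph.pair_wf_digraph pair_graph.axioms(1) by blast

text \<open>Local axioms that determine path length, so that a formula for the distance can be
  certified without handling walks.\<close>

definition is_distance :: "'a pair_pre_digraph \<Rightarrow> ('a \<Rightarrow> 'a \<Rightarrow> nat) \<Rightarrow> bool" where
  "is_distance \<Gamma> D \<longleftrightarrow> (\<forall>x\<in>pverts \<Gamma>. \<forall>y\<in>pverts \<Gamma>.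
     (D x y = 0 \<longleftrightarrow> x = y) \<and>
     (\<forall>z. (y, z) \<in> parcs \<Gamma> \<longrightarrow> D x z \<le> Suc (D x y)) \<and>
     (\<forall>n. D x y = Suc n \<longrightarrow> (\<exists>z. (z, y) \<in> parcs \<Gamma> \<and> D x z = n)))"

text \<open>Stated for an arbitrary \<open>D\<close>. \<open>Suc\<close> stands on the smaller side,
  so that level 0 has no descents and truncated subtraction is avoided.\<close>

definition has_intersection_array ::
    "'a pair_pre_digraph \<Rightarrow> ('a \<Rightarrow> 'a \<Rightarrow> nat) \<Rightarrow> (nat \<Rightarrow> nat) \<Rightarrow> (nat \<Rightarrow> nat) \<Rightarrow> (nat \<Rightarrow> nat) \<Rightarrow> bool" where
  "has_intersection_array \<Gamma> D c a b \<longleftrightarrow> (\<forall>x\<in>pverts \<Gamma>. \<forall>y\<in>pverts \<Gamma>.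
     card {z. (y, z) \<in> parcs \<Gamma> \<and> Suc (D x z) = D x y} = c (D x y) \<and>
     card {z. (y, z) \<in> parcs \<Gamma> \<and> D x z = D x y} = a (D x y) \<and>
     card {z. (y, z) \<in> parcs \<Gamma> \<and> D x z = Suc (D x y)} = b (D x y))"

lemma
  assumes "is_distance \<Gamma> D" "x \<in> pverts \<Gamma>" "y \<in> pverts \<Gamma>"
  shows is_distance_eq_0_iff: "D x y = 0 \<longleftrightarrow> x = y"
    and is_distance_step: "(y, z) \<in> parcs \<Gamma> \<Longrightarrow> D x z \<le> Suc (D x y)"
    and is_distance_pred: "D x y = Suc n \<Longrightarrow> \<exists>z. (z, y) \<in> parcs \<Gamma> \<and> D x z = n"
  using assms unfolding is_distance_def by simp_all

lemma gdist_le_diameter: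
  assumes "finite (pverts \<Gamma>)" "x \<in> pverts \<Gamma>" "y \<in> pverts \<Gamma>"
  shows "gdist \<Gamma> x y \<le> diameter \<Gamma>"
proof -
  have "finite {gdist \<Gamma> x y |x y. x \<in> pverts \<Gamma> \<and> y \<in> pverts \<Gamma>}"
    by (rule finite_image_set2) (simp_all add: assms(1))
  then show ?thesis unfolding diameter_def using assms(2,3) by (intro Max_ge) blast+
qed

context pair_graph
begin

lemma distance_le_awalk:
  assumes D: "is_distance G D" and "x \<in> pverts G" "awalk u p y"
  shows "D x y \<le> D x u + length p"
  using assms(3)
proof (induction p arbitrary: u)
  case Nil
  then show ?case by (simp add: awalk_Nil_iff)
next
  case (Cons e p)
  then have e: "e \<in> parcs G" "fst e = u" "awalk (snd e) p y" by (auto simp: awalk_Cons_iff)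
  then have uv: "(u, snd e) \<in> parcs G" by (metis prod.collapse)
  then have "D x (snd e) \<le> Suc (D x u)"
    using is_distance_step[OF D assms(2)] in_arcsD1 by blast
  then show ?case using Cons.IH[OF e(3)] by simp
qed

lemma awalk_of_distance:
  assumes D: "is_distance G D" and "x \<in> pverts G" "y \<in> pverts G"
  shows "\<exists>p. awalk x p y \<and> length p = D x y"
  using assms(3)
proof (induction "D x y" arbitrary: y)
  case 0
  then have "x = y" using is_distance_eq_0_iff[OF D assms(2) 0(2)] 0(1) by simp
  then show ?case using 0 by (intro exI[of _ "[]"]) (simp add: awalk_Nil_iff)
next
  case (Suc n)
  then obtain z where z: "(z, y) \<in> parcs G" "D x z = n"
    using is_distance_pred[OF D assms(2) Suc.prems] by metis
  then obtain p where p: "awalk x p z" "length p = n" using Suc in_arcsD1 by metis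
  have "awalk z [(z, y)] y" using z Suc.prems in_arcsD1 by (simp add: awalk_Cons_iff awalk_Nil_iff)
  then have "awalk x (p @ [(z, y)]) y" using p by (rule_tac awalk_appendI)
  then show ?case using p Suc.hyps(2) by (intro exI[of _ "p @ [(z, y)]"]) simp
qed

text \<open>A walk gains at most one level per arc, and following predecessors yields a walk of
  length \<open>D x y\<close>; the axioms thus leave only one function.\<close>

lemma gdist_eqI:
  assumes "is_distance G D" "x \<in> pverts G" "y \<in> pverts G"
  shows "gdist G x y = D x y"
  unfolding gdist_def
proof (rule Least_equality)
  show "\<exists>p. awalk x p y \<and> length p = D x y" using awalk_of_distance assms .
next
  fix n assume "\<exists>p. awalk x p y \<and> length p = n"
  moreover have "D x x = 0" using is_distance_eq_0_iff[OF assms(1,2,2)] by simp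
  ultimately show "D x y \<le> n" using distance_le_awalk[OF assms(1,2)] by fastforce
qed

lemma connected_iff_awalk:
  "connected G \<longleftrightarrow> pverts G \<noteq> {} \<and> (\<forall>x\<in>pverts G. \<forall>y\<in>pverts G. \<exists>p. awalk x p y)"
  unfolding connected_def strongly_connected_def
  using reachable_mk_symmetric_eq[OF sym_arcs] by (simp add: reachable_awalk)

lemma is_distance_gdist:
  assumes "connected G"
  shows "is_distance G (gdist G)"
  unfolding is_distance_def
proof (intro ballI conjI allI impI)
  fix x y assume xy: "x \<in> pverts G" "y \<in> pverts G"
  have short: "\<exists>p. awalk x p y \<and> length p = gdist G x y" if "y \<in> pverts G" for y
  proof -
    have "\<exists>n p. awalk x p y \<and> length p = n"
      using assms xy that by (simp add: connected_iff_awalk)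
    then show ?thesis unfolding gdist_def by (rule LeastI_ex)
  qed
  have le: "gdist G x y \<le> length p" if "awalk x p y" for p y
    unfolding gdist_def using that by (intro Least_le) blast
  show "gdist G x y = 0 \<longleftrightarrow> x = y"
  proof
    assume "gdist G x y = 0"
    then show "x = y" using short[OF xy(2)] by (auto simp: awalk_Nil_iff)
  next
    assume "x = y"
    then show "gdist G x y = 0" using le[of "[]" x] xy by (simp add: awalk_Nil_iff)
  qed
  {
    fix z assume z: "(y, z) \<in> parcs G"
    obtain p where p: "awalk x p y" "length p = gdist G x y" using short[OF xy(2)] by blast
    have "awalk y [(y, z)] z" using z in_arcsD1 in_arcsD2 by (simp add: awalk_Cons_iff awalk_Nil_iff)
    then have "awalk x (p @ [(y, z)]) z" using p by (rule_tac awalk_appendI)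
    from le[OF this] p(2) show "gdist G x z \<le> Suc (gdist G x y)" by simp
  }
  {
    fix n assume n: "gdist G x y = Suc n"
    obtain p where p: "awalk x p y" "length p = Suc n" using short[OF xy(2)] n by auto
    then obtain q e where q: "p = q @ [e]" by (metis length_Suc_conv_rev)
    define z where "z = awlast x q"
    have w: "awalk x q z" "awalk z [e] y" using p(1) unfolding q awalk_append_iff z_def by auto
    have e: "(z, y) \<in> parcs G" using w(2) by (cases e) (auto simp: awalk_Cons_iff awalk_Nil_iff)
    have "gdist G x z \<le> n" using le[OF w(1)] q p(2) by simp
    \<comment> \<open>A shortest walk to \<open>z\<close>, prolonged by the last arc
      \<open>e\<close>, cannot be shorter than the distance to \<open>y\<close>.\<close>
    moreover have "Suc n \<le> Suc (gdist G x z)"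
    proof -
      obtain p' where p': "awalk x p' z" "length p' = gdist G x z"
        using short[of z] in_arcsD1[OF e] by blast
      have "awalk x (p' @ [e]) y" using p' w(2) by (rule_tac awalk_appendI)
      from le[OF this] p'(2) n show ?thesis by simp
    qed
    ultimately show "\<exists>z. (z, y) \<in> parcs G \<and> gdist G x z = n" using e by fastforce
  }
qed

lemma connectedI_distance:
  assumes "is_distance G D" "pverts G \<noteq> {}"
  shows "connected G"
  unfolding connected_iff_awalk using awalk_of_distance[OF assms(1)] assms(2) by blast

text \<open>In a connected loop-free graph the sphere of radius 1 about \<open>y\<close> is its
  neighbourhood; this turns the spheres of the definition into counts of arcs.\<close>

lemma sphere_Int_nbrs:
  assumes "connected G" "y \<in> pverts G"
  shows "sphere G j x \<inter> sphere G 1 y = {z. (y, z) \<in> parcs G \<and> int (gdist G x z) = j}"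
proof -
  have "gdist G y z = 1 \<longleftrightarrow> (y, z) \<in> parcs G" if z: "z \<in> pverts G" for z
  proof
    assume "gdist G y z = 1"
    then obtain w where "(w, z) \<in> parcs G" "gdist G y w = 0"
      using is_distance_pred[OF is_distance_gdist[OF assms(1)] assms(2) z, of 0] by auto
    moreover from this have "w = y"
      using is_distance_eq_0_iff[OF is_distance_gdist[OF assms(1)] assms(2)] in_arcsD1 by metis
    ultimately show "(y, z) \<in> parcs G" by simp
  next
    assume yz: "(y, z) \<in> parcs G"
    have "gdist G y z \<le> Suc (gdist G y y)" "gdist G y y = 0" "gdist G y z \<noteq> 0"
      using is_distance_step[OF is_distance_gdist[OF assms(1)] assms(2,2) yz]
        is_distance_eq_0_iff[OF is_distance_gdist[OF assms(1)] assms(2)] assms(2) z no_loops'[OF yz]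
      by auto
    then show "gdist G y z = 1" by simp
  qed
  then show ?thesis using in_arcsD2 by (auto simp: sphere_def)
qed

end

text \<open>The axioms pin \<open>D\<close> down to path length, so any certificate
  \<open>D\<close>, \<open>c\<close>, \<open>a\<close>, \<open>b\<close> is as good as the distance
  itself. All later verifications and uses of distance-regularity go through this form.\<close>

theorem distance_regular_iff:
  assumes "pair_graph \<Gamma>"
  shows "distance_regular \<Gamma> \<longleftrightarrow> pverts \<Gamma> \<noteq> {} \<and>
    (\<exists>D c a b. is_distance \<Gamma> D \<and> has_intersection_array \<Gamma> D c a b)" (is "?L \<longleftrightarrow> ?R")
proof -
  interpret pair_graph \<Gamma> by fact
  \<comment> \<open>For the first equation at \<open>n = 0\<close> both sides are empty: the integer
    index is -1, and no successor equals 0.\<close>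
  have eq: "{z. (y, z) \<in> parcs \<Gamma> \<and> int (gdist \<Gamma> x z) = int n - 1}
      = {z. (y, z) \<in> parcs \<Gamma> \<and> Suc (gdist \<Gamma> x z) = n}"
    "{z. (y, z) \<in> parcs \<Gamma> \<and> int (gdist \<Gamma> x z) = int n + 1}
      = {z. (y, z) \<in> parcs \<Gamma> \<and> gdist \<Gamma> x z = Suc n}" for x y n by auto
  show ?thesis
  proof
    assume L: ?L
    then have con: "connected \<Gamma>" by (simp add: distance_regular_def)
    obtain c a b where cab: "\<forall>i \<le> diameter \<Gamma>. \<forall>x \<in> pverts \<Gamma>. \<forall>y \<in> pverts \<Gamma>. gdist \<Gamma> x y = i \<longrightarrow>
      card (sphere \<Gamma> (int i - 1) x \<inter> sphere \<Gamma> 1 y) = c i \<and>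
      card (sphere \<Gamma> (int i) x \<inter> sphere \<Gamma> 1 y) = a i \<and>
      card (sphere \<Gamma> (int i + 1) x \<inter> sphere \<Gamma> 1 y) = b i"
      using L unfolding distance_regular_def by metis
    have "has_intersection_array \<Gamma> (gdist \<Gamma>) c a b"
      unfolding has_intersection_array_def
    proof (intro ballI)
      fix x y assume xy: "x \<in> pverts \<Gamma>" "y \<in> pverts \<Gamma>"
      show "card {z. (y, z) \<in> parcs \<Gamma> \<and> Suc (gdist \<Gamma> x z) = gdist \<Gamma> x y} = c (gdist \<Gamma> x y) \<and>
        card {z. (y, z) \<in> parcs \<Gamma> \<and> gdist \<Gamma> x z = gdist \<Gamma> x y} = a (gdist \<Gamma> x y) \<and>
        card {z. (y, z) \<in> parcs \<Gamma> \<and> gdist \<Gamma> x z = Suc (gdist \<Gamma> x y)} = b (gdist \<Gamma> x y)"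
        using cab[rule_format, OF gdist_le_diameter[OF pair_finite_verts xy] xy refl]
        unfolding sphere_Int_nbrs[OF con xy(2)] eq by simp
    qed
    then show ?R using is_distance_gdist[OF con] con connected_iff_awalk by blast
  next
    assume R: ?R
    then obtain D c a b where D: "is_distance \<Gamma> D" "has_intersection_array \<Gamma> D c a b" by blast
    have con: "connected \<Gamma>" using connectedI_distance D(1) R by blast
    have g: "gdist \<Gamma> x y = D x y" if "x \<in> pverts \<Gamma>" "y \<in> pverts \<Gamma>" for x y
      using gdist_eqI D(1) that .
    have set_eq: "{z. (y, z) \<in> parcs \<Gamma> \<and> P (gdist \<Gamma> x z)} = {z. (y, z) \<in> parcs \<Gamma> \<and> P (D x z)}"
      if "x \<in> pverts \<Gamma>" for x y P
      using g[OF that] in_arcsD2 by auto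
    show ?L unfolding distance_regular_def
    proof (intro conjI allI impI assms con)
      fix i assume "i \<le> diameter \<Gamma>"
      show "\<exists>c a b. \<forall>x \<in> pverts \<Gamma>. \<forall>y \<in> pverts \<Gamma>. gdist \<Gamma> x y = i \<longrightarrow>
        card (sphere \<Gamma> (int i - 1) x \<inter> sphere \<Gamma> 1 y) = c \<and>
        card (sphere \<Gamma> (int i) x \<inter> sphere \<Gamma> 1 y) = a \<and>
        card (sphere \<Gamma> (int i + 1) x \<inter> sphere \<Gamma> 1 y) = b"
      proof (rule exI[of _ "c i"], rule exI[of _ "a i"], rule exI[of _ "b i"], intro ballI impI)
        fix x y assume xy: "x \<in> pverts \<Gamma>" "y \<in> pverts \<Gamma>" "gdist \<Gamma> x y = i"
        then have "D x y = i" using g by simp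
        then show "card (sphere \<Gamma> (int i - 1) x \<inter> sphere \<Gamma> 1 y) = c i \<and>
          card (sphere \<Gamma> (int i) x \<inter> sphere \<Gamma> 1 y) = a i \<and>
          card (sphere \<Gamma> (int i + 1) x \<inter> sphere \<Gamma> 1 y) = b i"
          using D(2)[unfolded has_intersection_array_def, rule_format, OF xy(1,2)]
          unfolding sphere_Int_nbrs[OF con xy(2)] eq of_nat_eq_iff
            set_eq[OF xy(1), of y "\<lambda>d. Suc d = i"] set_eq[OF xy(1), of y "\<lambda>d. d = i"]
            set_eq[OF xy(1), of y "\<lambda>d. d = Suc i"] by simp
      qed
    qed
  qed
qed

text \<open>The right-hand side of \<open>graph_iso_iff\<close> as a relation of its own, which
  composes without any well-formedness conditions.\<close>

definition is_isomorphic :: "'a pair_pre_digraph \<Rightarrow> 'b pair_pre_digraph \<Rightarrow> bool" where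
  "is_isomorphic \<Gamma> \<Delta> \<longleftrightarrow> (\<exists>f. bij_betw f (pverts \<Gamma>) (pverts \<Delta>) \<and>
      (\<forall>x\<in>pverts \<Gamma>. \<forall>y\<in>pverts \<Gamma>. (x, y) \<in> parcs \<Gamma> \<longleftrightarrow> (f x, f y) \<in> parcs \<Delta>))"

lemma is_isomorphic_refl: "is_isomorphic \<Gamma> \<Gamma>"
  unfolding is_isomorphic_def by (intro exI[of _ id]) auto

lemma is_isomorphic_sym: "is_isomorphic \<Gamma> \<Delta> \<Longrightarrow> is_isomorphic \<Delta> \<Gamma>"
proof -
  assume "is_isomorphic \<Gamma> \<Delta>"
  then obtain f where f: "bij_betw f (pverts \<Gamma>) (pverts \<Delta>)"
    "\<forall>x\<in>pverts \<Gamma>. \<forall>y\<in>pverts \<Gamma>. (x, y) \<in> parcs \<Gamma> \<longleftrightarrow> (f x, f y) \<in> parcs \<Delta>"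
    unfolding is_isomorphic_def by blast
  define g where "g = inv_into (pverts \<Gamma>) f"
  have g: "bij_betw g (pverts \<Delta>) (pverts \<Gamma>)" unfolding g_def by (rule bij_betw_inv_into[OF f(1)])
  have "f (g y) = y" if "y \<in> pverts \<Delta>" for y
    unfolding g_def using bij_betw_inv_into_right[OF f(1) that] .
  moreover have "g y \<in> pverts \<Gamma>" if "y \<in> pverts \<Delta>" for y using g that by (auto simp: bij_betw_def)
  ultimately show ?thesis unfolding is_isomorphic_def using g f(2) by (intro exI[of _ g]) auto
qed

lemma is_isomorphic_trans [trans]:
  assumes "is_isomorphic \<Gamma> \<Delta>" "is_isomorphic \<Delta> \<Theta>"
  shows "is_isomorphic \<Gamma> \<Theta>"
proof -
  obtain f where f: "bij_betw f (pverts \<Gamma>) (pverts \<Delta>)"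
    "\<forall>x\<in>pverts \<Gamma>. \<forall>y\<in>pverts \<Gamma>. (x, y) \<in> parcs \<Gamma> \<longleftrightarrow> (f x, f y) \<in> parcs \<Delta>"
    using assms(1) unfolding is_isomorphic_def by blast
  obtain g where g: "bij_betw g (pverts \<Delta>) (pverts \<Theta>)"
    "\<forall>x\<in>pverts \<Delta>. \<forall>y\<in>pverts \<Delta>. (x, y) \<in> parcs \<Delta> \<longleftrightarrow> (g x, g y) \<in> parcs \<Theta>"
    using assms(2) unfolding is_isomorphic_def by blast
  have "f x \<in> pverts \<Delta>" if "x \<in> pverts \<Gamma>" for x using f(1) that by (auto simp: bij_betw_def)
  then show ?thesis unfolding is_isomorphic_def
    using bij_betw_trans[OF f(1) g(1)] f(2) g(2) by (intro exI[of _ "g \<circ> f"]) auto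
qed

text \<open>Besides invariance, this serves to carry Hamming distance to a Cayley graph, where
  uniqueness of distances identifies it with word length.\<close>

lemma is_distance_pullback:
  assumes f: "bij_betw f (pverts \<Gamma>) (pverts \<Delta>)"
    "\<forall>x\<in>pverts \<Gamma>. \<forall>y\<in>pverts \<Gamma>. (x, y) \<in> parcs \<Gamma> \<longleftrightarrow> (f x, f y) \<in> parcs \<Delta>"
    and pg: "pair_graph \<Gamma>" "pair_graph \<Delta>" and D: "is_distance \<Delta> D"
  shows "is_distance \<Gamma> (\<lambda>x y. D (f x) (f y))"
proof -
  have fV: "f ` pverts \<Gamma> = pverts \<Delta>" and inj: "inj_on f (pverts \<Gamma>)" using f(1) by (auto simp: bij_betw_def)
  have sub: "parcs \<Gamma> \<subseteq> pverts \<Gamma> \<times> pverts \<Gamma>" "parcs \<Delta> \<subseteq> pverts \<Delta> \<times> pverts \<Delta>"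
    using pg by (auto simp: pair_graph_iff)
  show ?thesis
    unfolding is_distance_def
  proof (intro ballI conjI allI impI)
    fix x y assume xy: "x \<in> pverts \<Gamma>" "y \<in> pverts \<Gamma>"
    then have fxy: "f x \<in> pverts \<Delta>" "f y \<in> pverts \<Delta>" using fV by auto
    show "D (f x) (f y) = 0 \<longleftrightarrow> x = y"
      using is_distance_eq_0_iff[OF D fxy] xy inj by (auto simp: inj_on_def)
    show "D (f x) (f z) \<le> Suc (D (f x) (f y))" if "(y, z) \<in> parcs \<Gamma>" for z
    proof -
      have "z \<in> pverts \<Gamma>" using that sub by auto
      then have "(f y, f z) \<in> parcs \<Delta>" using f(2) that xy by blast
      then show ?thesis using is_distance_step[OF D fxy] by blast
    qed
    show "\<exists>z. (z, y) \<in> parcs \<Gamma> \<and> D (f x) (f z) = n" if Dn: "D (f x) (f y) = Suc n" for n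
    proof -
      obtain w where w: "(w, f y) \<in> parcs \<Delta>" "D (f x) w = n"
        using is_distance_pred[OF D fxy Dn] by blast
      then obtain z where "z \<in> pverts \<Gamma>" "w = f z" using sub fV by blast
      then show ?thesis using w f(2) xy by blast
    qed
  qed
qed

lemma distance_regular_isomorphic:
  assumes "pair_graph \<Gamma>" "is_isomorphic \<Gamma> \<Delta>" "distance_regular \<Delta>"
  shows "distance_regular \<Gamma>"
proof -
  have pg: "pair_graph \<Delta>" using assms(3) by (simp add: distance_regular_def)
  obtain f where f: "bij_betw f (pverts \<Gamma>) (pverts \<Delta>)"
    "\<forall>x\<in>pverts \<Gamma>. \<forall>y\<in>pverts \<Gamma>. (x, y) \<in> parcs \<Gamma> \<longleftrightarrow> (f x, f y) \<in> parcs \<Delta>"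
    using assms(2) unfolding is_isomorphic_def by blast
  obtain D c a b where D: "is_distance \<Delta> D" "has_intersection_array \<Delta> D c a b" "pverts \<Delta> \<noteq> {}"
    using distance_regular_iff[OF pg] assms(3) by blast
  have fV: "f ` pverts \<Gamma> = pverts \<Delta>" and inj: "inj_on f (pverts \<Gamma>)" using f(1) by (auto simp: bij_betw_def)
  have sub: "parcs \<Gamma> \<subseteq> pverts \<Gamma> \<times> pverts \<Gamma>" "parcs \<Delta> \<subseteq> pverts \<Delta> \<times> pverts \<Delta>"
    using assms(1) pg by (auto simp: pair_graph_iff)
  have "is_distance \<Gamma> (\<lambda>x y. D (f x) (f y))" by (rule is_distance_pullback[OF f assms(1) pg D(1)])
  moreover have "has_intersection_array \<Gamma> (\<lambda>x y. D (f x) (f y)) c a b"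
  proof -
    have "card {z. (y, z) \<in> parcs \<Gamma> \<and> P (f z)} = card {z. (f y, z) \<in> parcs \<Delta> \<and> P z}"
      if "y \<in> pverts \<Gamma>" for y P
    proof -
      have "{z. (f y, z) \<in> parcs \<Delta> \<and> P z} = f ` {z. (y, z) \<in> parcs \<Gamma> \<and> P (f z)}"
      proof (intro equalityI subsetI)
        fix w assume w: "w \<in> {z. (f y, z) \<in> parcs \<Delta> \<and> P z}"
        then have "w \<in> f ` pverts \<Gamma>" using sub fV by blast
        then obtain z where "z \<in> pverts \<Gamma>" "w = f z" by blast
        then show "w \<in> f ` {z. (y, z) \<in> parcs \<Gamma> \<and> P (f z)}" using f(2) that w by auto
      next
        fix w assume "w \<in> f ` {z. (y, z) \<in> parcs \<Gamma> \<and> P (f z)}"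
        then show "w \<in> {z. (f y, z) \<in> parcs \<Delta> \<and> P z}" using f(2) that sub by auto
      qed
      moreover have "inj_on f {z. (y, z) \<in> parcs \<Gamma> \<and> P (f z)}"
        using inj sub by (auto intro: inj_on_subset)
      ultimately show ?thesis by (simp add: card_image)
    qed
    note eq = this
    show ?thesis unfolding has_intersection_array_def
    proof (intro ballI)
      fix x y assume xy: "x \<in> pverts \<Gamma>" "y \<in> pverts \<Gamma>"
      then have "f x \<in> pverts \<Delta>" "f y \<in> pverts \<Delta>" using fV by auto
      then show "card {z. (y, z) \<in> parcs \<Gamma> \<and> Suc (D (f x) (f z)) = D (f x) (f y)} = c (D (f x) (f y)) \<and>
        card {z. (y, z) \<in> parcs \<Gamma> \<and> D (f x) (f z) = D (f x) (f y)} = a (D (f x) (f y)) \<and>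
        card {z. (y, z) \<in> parcs \<Gamma> \<and> D (f x) (f z) = Suc (D (f x) (f y))} = b (D (f x) (f y))"
        using D(2) unfolding has_intersection_array_def
          eq[OF xy(2), of "\<lambda>w. Suc (D (f x) w) = D (f x) (f y)"]
          eq[OF xy(2), of "\<lambda>w. D (f x) w = D (f x) (f y)"]
          eq[OF xy(2), of "\<lambda>w. D (f x) w = Suc (D (f x) (f y))"] by blast
    qed
  qed
  ultimately show ?thesis using distance_regular_iff[OF assms(1)] D(3) fV by blast
qed

section \<open>Products with a linear intersection array\<close>

text \<open>The arrays with \<open>c\<^sub>i = i\<close> and \<open>a\<^sub>i = (q - 2) i\<close> are those of the Hamming and Doob graphs.\<close>

definition linear_array :: "nat \<Rightarrow> nat \<Rightarrow> 'a pair_pre_digraph \<Rightarrow> ('a \<Rightarrow> 'a \<Rightarrow> nat) \<Rightarrow> bool" where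
  "linear_array q k \<Gamma> D \<longleftrightarrow> pair_graph \<Gamma> \<and> pverts \<Gamma> \<noteq> {} \<and> is_distance \<Gamma> D \<and>
     (\<forall>x\<in>pverts \<Gamma>. \<forall>y\<in>pverts \<Gamma>.
       card {z. (y, z) \<in> parcs \<Gamma>} = k \<and>
       card {z. (y, z) \<in> parcs \<Gamma> \<and> Suc (D x z) = D x y} = D x y \<and>
       card {z. (y, z) \<in> parcs \<Gamma> \<and> D x z = D x y} = (q - 2) * D x y)"

lemma pair_graph_finite_nbrs: "pair_graph \<Gamma> \<Longrightarrow> finite {z. (y, z) \<in> parcs \<Gamma> \<and> P z}"
  by (rule finite_subset[of _ "pverts \<Gamma>"]) (auto simp: pair_graph_iff)

text \<open>Arcs can be reversed, so a neighbour of \<open>y\<close> lies on one of three adjacent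
  levels, and the third count follows from the degree and the other two.\<close>

lemma card_nbrs_above:
  assumes "pair_graph \<Gamma>" "is_distance \<Gamma> D" "x \<in> pverts \<Gamma>" "y \<in> pverts \<Gamma>"
  shows "card {z. (y, z) \<in> parcs \<Gamma> \<and> D x z = Suc (D x y)} =
    card {z. (y, z) \<in> parcs \<Gamma>} - card {z. (y, z) \<in> parcs \<Gamma> \<and> Suc (D x z) = D x y}
      - card {z. (y, z) \<in> parcs \<Gamma> \<and> D x z = D x y}"
proof -
  have "D x z = Suc (D x y) \<or> Suc (D x z) = D x y \<or> D x z = D x y" if "(y, z) \<in> parcs \<Gamma>" for z
  proof -
    have "z \<in> pverts \<Gamma>" "(z, y) \<in> parcs \<Gamma>" using assms(1) that by (auto simp: pair_graph_iff sym_def)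
    then show ?thesis
      using is_distance_step[OF assms(2,3,4) that] is_distance_step[OF assms(2,3), of z y] by linarith
  qed
  then have eq: "{z. (y, z) \<in> parcs \<Gamma>} = {z. (y, z) \<in> parcs \<Gamma> \<and> D x z = Suc (D x y)} \<union>
    ({z. (y, z) \<in> parcs \<Gamma> \<and> Suc (D x z) = D x y} \<union> {z. (y, z) \<in> parcs \<Gamma> \<and> D x z = D x y})"
    (is "_ = ?A \<union> (?B \<union> ?C)") by blast
  have "card (?A \<union> (?B \<union> ?C)) = card ?A + card (?B \<union> ?C)"
    by (rule card_Un_disjoint) (use pair_graph_finite_nbrs[OF assms(1)] in \<open>simp, simp, fastforce\<close>)
  moreover have "card (?B \<union> ?C) = card ?B + card ?C"
    by (rule card_Un_disjoint) (use pair_graph_finite_nbrs[OF assms(1)] in \<open>simp, simp, fastforce\<close>)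
  ultimately show ?thesis unfolding eq by simp
qed

lemma linear_array_distance_regular:
  assumes "linear_array q k \<Gamma> D"
  shows "distance_regular \<Gamma>"
proof -
  have pg: "pair_graph \<Gamma>" "is_distance \<Gamma> D" "pverts \<Gamma> \<noteq> {}" using assms by (auto simp: linear_array_def)
  have "has_intersection_array \<Gamma> D (\<lambda>i. i) (\<lambda>i. (q - 2) * i) (\<lambda>i. k - i - (q - 2) * i)"
    unfolding has_intersection_array_def
  proof (intro ballI)
    fix x y assume xy: "x \<in> pverts \<Gamma>" "y \<in> pverts \<Gamma>"
    then show "card {z. (y, z) \<in> parcs \<Gamma> \<and> Suc (D x z) = D x y} = D x y \<and>
      card {z. (y, z) \<in> parcs \<Gamma> \<and> D x z = D x y} = (q - 2) * D x y \<and>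
      card {z. (y, z) \<in> parcs \<Gamma> \<and> D x z = Suc (D x y)} = k - D x y - (q - 2) * D x y"
      using assms unfolding linear_array_def card_nbrs_above[OF pg(1,2) xy] by simp
  qed
  then show ?thesis using pg distance_regular_iff[OF pg(1)] by blast
qed

section \<open>Cartesian products and the linear array\<close>

lemma pair_graph_cart_prod:
  assumes "pair_graph \<Gamma>" "pair_graph \<Delta>"
  shows "pair_graph (\<Gamma> \<box> \<Delta>)"
  using assms unfolding pair_graph_iff cart_prod_def sym_def irrefl_def by auto

lemma cart_prod_nbrs:
  assumes "pair_graph \<Gamma>" "pair_graph \<Delta>" "u \<in> pverts \<Gamma>" "v \<in> pverts \<Delta>"
  shows "{z. ((u, v), z) \<in> parcs (\<Gamma> \<box> \<Delta>) \<and> P z} =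
    (\<lambda>a. (a, v)) ` {a. (u, a) \<in> parcs \<Gamma> \<and> P (a, v)} \<union> (\<lambda>b. (u, b)) ` {b. (v, b) \<in> parcs \<Delta> \<and> P (u, b)}"
  using assms by (auto simp: cart_prod_def pair_graph_iff)

lemma card_cart_prod_nbrs:
  assumes "pair_graph \<Gamma>" "pair_graph \<Delta>" "u \<in> pverts \<Gamma>" "v \<in> pverts \<Delta>"
  shows "card {z. ((u, v), z) \<in> parcs (\<Gamma> \<box> \<Delta>) \<and> P z} =
    card {a. (u, a) \<in> parcs \<Gamma> \<and> P (a, v)} + card {b. (v, b) \<in> parcs \<Delta> \<and> P (u, b)}"
proof -
  have "(\<lambda>a. (a, v)) ` {a. (u, a) \<in> parcs \<Gamma> \<and> P (a, v)} \<inter> (\<lambda>b. (u, b)) ` {b. (v, b) \<in> parcs \<Delta> \<and> P (u, b)} = {}"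
    using assms by (auto simp: pair_graph_iff irrefl_def)
  then show ?thesis unfolding cart_prod_nbrs[OF assms]
    by (subst card_Un_disjoint) (auto simp: pair_graph_finite_nbrs assms card_image inj_on_def)
qed

lemma is_distance_cart_prod:
  assumes "pair_graph \<Gamma>" "pair_graph \<Delta>" "is_distance \<Gamma> D" "is_distance \<Delta> E"
  shows "is_distance (\<Gamma> \<box> \<Delta>) (\<lambda>x y. D (fst x) (fst y) + E (snd x) (snd y))"
  unfolding is_distance_def
proof (intro ballI conjI allI impI)
  fix x y assume "x \<in> pverts (\<Gamma> \<box> \<Delta>)" "y \<in> pverts (\<Gamma> \<box> \<Delta>)"
  then obtain u v u' v' where xy: "x = (u, v)" "y = (u', v')"
    and V: "u \<in> pverts \<Gamma>" "u' \<in> pverts \<Gamma>" "v \<in> pverts \<Delta>" "v' \<in> pverts \<Delta>"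
    by (cases x; cases y) (simp add: cart_prod_def)
  show "D (fst x) (fst y) + E (snd x) (snd y) = 0 \<longleftrightarrow> x = y"
    using is_distance_eq_0_iff[OF assms(3) V(1,2)] is_distance_eq_0_iff[OF assms(4) V(3,4)]
    by (auto simp: xy)
  show "D (fst x) (fst z) + E (snd x) (snd z) \<le> Suc (D (fst x) (fst y) + E (snd x) (snd y))"
    if "(y, z) \<in> parcs (\<Gamma> \<box> \<Delta>)" for z
    using that is_distance_step[OF assms(3) V(1,2), of "fst z"] is_distance_step[OF assms(4) V(3,4), of "snd z"]
    by (auto simp: xy cart_prod_def)
  show "\<exists>z. (z, y) \<in> parcs (\<Gamma> \<box> \<Delta>) \<and> D (fst x) (fst z) + E (snd x) (snd z) = n"
    if n: "D (fst x) (fst y) + E (snd x) (snd y) = Suc n" for n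
  proof (cases "D u u'")
    case 0
    then obtain w where "(w, v') \<in> parcs \<Delta>" "E v w = n"
      using is_distance_pred[OF assms(4) V(3,4)] n xy by auto
    then show ?thesis using assms(2) 0 V by (intro exI[of _ "(u', w)"]) (auto simp: xy cart_prod_def pair_graph_iff)
  next
    case (Suc m)
    then obtain w where "(w, u') \<in> parcs \<Gamma>" "D u w = m"
      using is_distance_pred[OF assms(3) V(1,2)] by auto
    then show ?thesis using assms(1) n Suc V by (intro exI[of _ "(w, v')"]) (auto simp: xy cart_prod_def pair_graph_iff)
  qed
qed

text \<open>Distances, degrees and counts of neighbours all add over the factors, and the prescribed
  values are linear in the distance; hence they add as well.\<close>

lemma linear_array_cart_prod:
  assumes "linear_array q k \<Gamma> D" "linear_array q l \<Delta> E"
  shows "linear_array q (k + l) (\<Gamma> \<box> \<Delta>) (\<lambda>x y. D (fst x) (fst y) + E (snd x) (snd y))"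
proof -
  have A: "pair_graph \<Gamma>" "is_distance \<Gamma> D" "pverts \<Gamma> \<noteq> {}" "pair_graph \<Delta>" "is_distance \<Delta> E" "pverts \<Delta> \<noteq> {}"
    using assms by (auto simp: linear_array_def)
  have "pverts (\<Gamma> \<box> \<Delta>) \<noteq> {}" using A by (simp add: cart_prod_def)
  moreover have "card {z. (y, z) \<in> parcs (\<Gamma> \<box> \<Delta>)} = k + l \<and>
     card {z. (y, z) \<in> parcs (\<Gamma> \<box> \<Delta>) \<and> Suc (D (fst x) (fst z) + E (snd x) (snd z)) = D (fst x) (fst y) + E (snd x) (snd y)}
       = D (fst x) (fst y) + E (snd x) (snd y) \<and>
     card {z. (y, z) \<in> parcs (\<Gamma> \<box> \<Delta>) \<and> D (fst x) (fst z) + E (snd x) (snd z) = D (fst x) (fst y) + E (snd x) (snd y)}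
       = (q - 2) * (D (fst x) (fst y) + E (snd x) (snd y))"
    if xy': "x \<in> pverts (\<Gamma> \<box> \<Delta>)" "y \<in> pverts (\<Gamma> \<box> \<Delta>)" for x y
  proof -
    obtain u v u' v' where xy: "x = (u, v)" "y = (u', v')"
      and V: "u \<in> pverts \<Gamma>" "u' \<in> pverts \<Gamma>" "v \<in> pverts \<Delta>" "v' \<in> pverts \<Delta>"
      using xy' by (cases x; cases y) (auto simp: cart_prod_def)
    have 1: "card {z. (u', z) \<in> parcs \<Gamma>} = k" "card {z. (u', z) \<in> parcs \<Gamma> \<and> Suc (D u z) = D u u'} = D u u'"
      "card {z. (u', z) \<in> parcs \<Gamma> \<and> D u z = D u u'} = (q - 2) * D u u'"
      using assms(1) V by (auto simp: linear_array_def)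
    have 2: "card {z. (v', z) \<in> parcs \<Delta>} = l" "card {z. (v', z) \<in> parcs \<Delta> \<and> Suc (E v z) = E v v'} = E v v'"
      "card {z. (v', z) \<in> parcs \<Delta> \<and> E v z = E v v'} = (q - 2) * E v v'"
      using assms(2) V by (auto simp: linear_array_def)
    show ?thesis unfolding xy
      using card_cart_prod_nbrs[OF A(1,4) V(2,4), of "\<lambda>_. True"] 1 2
      by (simp add: card_cart_prod_nbrs[OF A(1,4) V(2,4)] add_Suc[symmetric] add_Suc_right[symmetric]
            distrib_left del: add_Suc add_Suc_right)
  qed
  ultimately show ?thesis unfolding linear_array_def
    using pair_graph_cart_prod[OF A(1,4)] is_distance_cart_prod[OF A(1,4,2,5)] by simp
qed

section \<open>Isomorphisms between products and powers\<close>

lemma is_isomorphicI: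
  assumes "bij_betw f (pverts \<Gamma>) (pverts \<Delta>)"
    and "\<And>x y. x \<in> pverts \<Gamma> \<Longrightarrow> y \<in> pverts \<Gamma> \<Longrightarrow> (x, y) \<in> parcs \<Gamma> \<longleftrightarrow> (f x, f y) \<in> parcs \<Delta>"
  shows "is_isomorphic \<Gamma> \<Delta>"
  using assms unfolding is_isomorphic_def by blast

lemma cart_prod_cong:
  assumes "is_isomorphic \<Gamma> \<Gamma>'" "is_isomorphic \<Delta> \<Delta>'"
  shows "is_isomorphic (\<Gamma> \<box> \<Delta>) (\<Gamma>' \<box> \<Delta>')"
proof -
  obtain f where f: "bij_betw f (pverts \<Gamma>) (pverts \<Gamma>')"
    "\<And>x y. x \<in> pverts \<Gamma> \<Longrightarrow> y \<in> pverts \<Gamma> \<Longrightarrow> (x, y) \<in> parcs \<Gamma> \<longleftrightarrow> (f x, f y) \<in> parcs \<Gamma>'"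
    using assms(1) unfolding is_isomorphic_def by blast
  obtain g where g: "bij_betw g (pverts \<Delta>) (pverts \<Delta>')"
    "\<And>x y. x \<in> pverts \<Delta> \<Longrightarrow> y \<in> pverts \<Delta> \<Longrightarrow> (x, y) \<in> parcs \<Delta> \<longleftrightarrow> (g x, g y) \<in> parcs \<Delta>'"
    using assms(2) unfolding is_isomorphic_def by blast
  show ?thesis
  proof (rule is_isomorphicI[of "map_prod f g"])
    show "bij_betw (map_prod f g) (pverts (\<Gamma> \<box> \<Delta>)) (pverts (\<Gamma>' \<box> \<Delta>'))"
      using bij_betw_map_prod[OF f(1) g(1)] by (simp add: cart_prod_def map_prod_def)
    show "(x, y) \<in> parcs (\<Gamma> \<box> \<Delta>) \<longleftrightarrow> (map_prod f g x, map_prod f g y) \<in> parcs (\<Gamma>' \<box> \<Delta>')"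
      if "x \<in> pverts (\<Gamma> \<box> \<Delta>)" "y \<in> pverts (\<Gamma> \<box> \<Delta>)" for x y
    proof -
      obtain u v u' v' where xy: "x = (u, v)" "y = (u', v')"
        and V: "u \<in> pverts \<Gamma>" "u' \<in> pverts \<Gamma>" "v \<in> pverts \<Delta>" "v' \<in> pverts \<Delta>"
        using \<open>x \<in> _\<close> \<open>y \<in> _\<close> by (cases x; cases y) (auto simp: cart_prod_def)
      have "f u \<in> pverts \<Gamma>'" "f u' \<in> pverts \<Gamma>'" "g v \<in> pverts \<Delta>'" "g v' \<in> pverts \<Delta>'"
        "f u = f u' \<longleftrightarrow> u = u'" "g v = g v' \<longleftrightarrow> v = v'"
        using V f(1) g(1) by (auto simp: bij_betw_def inj_on_eq_iff)
      then show ?thesis using V f(2)[OF V(1,2)] g(2)[OF V(3,4)] by (auto simp: xy cart_prod_def)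
    qed
  qed
qed

lemma cart_prod_assoc: "is_isomorphic ((\<Gamma> \<box> \<Delta>) \<box> \<Theta>) (\<Gamma> \<box> (\<Delta> \<box> \<Theta>))"
  by (rule is_isomorphicI[of "\<lambda>((a, b), c). (a, (b, c))"])
    (auto simp: cart_prod_def bij_betw_def inj_on_def image_iff)

lemma cart_prod_commute: "is_isomorphic (\<Gamma> \<box> \<Delta>) (\<Delta> \<box> \<Gamma>)"
  by (rule is_isomorphicI[of "\<lambda>(a, b). (b, a)"])
    (auto simp: cart_prod_def bij_betw_def inj_on_def image_iff)

lemma cart_power_0_cart_prod: "is_isomorphic (cart_power \<Delta> 0 \<box> \<Gamma>) \<Gamma>"
  by (rule is_isomorphicI[of snd])
    (auto simp: cart_prod_def bij_betw_def inj_on_def image_iff)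

lemma mem_map_prod_image_iff: "inj f \<Longrightarrow> (f x, f y) \<in> map_prod f f ` A \<longleftrightarrow> (x, y) \<in> A"
  using inj_image_mem_iff[OF prod.inj_map, of f f "(x, y)" A] by simp

lemma is_isomorphic_image:
  assumes "inj f"
  shows "is_isomorphic \<Gamma> \<lparr>pverts = f ` pverts \<Gamma>, parcs = map_prod f f ` parcs \<Gamma>\<rparr>"
  by (rule is_isomorphicI[of f]) (use assms in \<open>auto simp: mem_map_prod_image_iff bij_betw_def inj_on_def inj_def\<close>)

lemma inj_case_prod_Cons: "inj (\<lambda>(x, xs). x # xs)"
  by (auto simp: inj_def)

lemma cart_power_Suc_iso: "is_isomorphic (\<Gamma> \<box> cart_power \<Gamma> k) (cart_power \<Gamma> (Suc k))"
  using is_isomorphic_image[OF inj_case_prod_Cons] by (simp add: Let_def)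

lemma cart_power_1_iso: "is_isomorphic \<Gamma> (cart_power \<Gamma> 1)"
proof -
  have "is_isomorphic \<Gamma> (cart_power \<Gamma> 0 \<box> \<Gamma>)" by (rule is_isomorphic_sym[OF cart_power_0_cart_prod])
  also have "is_isomorphic \<dots> (\<Gamma> \<box> cart_power \<Gamma> 0)" by (rule cart_prod_commute)
  also have "is_isomorphic \<dots> (cart_power \<Gamma> (Suc 0))" by (rule cart_power_Suc_iso)
  finally show ?thesis by simp
qed

lemma cart_power_add_iso: "is_isomorphic (cart_power \<Gamma> m \<box> cart_power \<Gamma> n) (cart_power \<Gamma> (m + n))"
proof (induction m)
  case 0
  then show ?case using cart_power_0_cart_prod by simp
next
  case (Suc m)
  have "is_isomorphic (cart_power \<Gamma> (Suc m) \<box> cart_power \<Gamma> n) ((\<Gamma> \<box> cart_power \<Gamma> m) \<box> cart_power \<Gamma> n)"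
    by (intro cart_prod_cong is_isomorphic_refl is_isomorphic_sym[OF cart_power_Suc_iso])
  also have "is_isomorphic \<dots> (\<Gamma> \<box> (cart_power \<Gamma> m \<box> cart_power \<Gamma> n))" by (rule cart_prod_assoc)
  also have "is_isomorphic \<dots> (\<Gamma> \<box> cart_power \<Gamma> (m + n))"
    by (intro cart_prod_cong is_isomorphic_refl Suc.IH)
  also have "is_isomorphic \<dots> (cart_power \<Gamma> (Suc (m + n)))" by (rule cart_power_Suc_iso)
  finally show ?case by simp
qed

lemma pverts_cart_power: "pverts (cart_power \<Gamma> n) = {xs. length xs = n \<and> set xs \<subseteq> pverts \<Gamma>}"
proof (induction n)
  case (Suc n)
  have "xs \<in> pverts (cart_power \<Gamma> (Suc n)) \<longleftrightarrow> length xs = Suc n \<and> set xs \<subseteq> pverts \<Gamma>" for xs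
    using Suc by (cases xs) (auto simp: Let_def cart_prod_def)
  then show ?case by blast
qed auto

lemma pair_graph_isomorphic:
  assumes "pair_graph \<Gamma>" "is_isomorphic \<Gamma> \<Delta>" "parcs \<Delta> \<subseteq> pverts \<Delta> \<times> pverts \<Delta>"
  shows "pair_graph \<Delta>"
proof -
  obtain f where f: "bij_betw f (pverts \<Delta>) (pverts \<Gamma>)"
    "\<And>x y. x \<in> pverts \<Delta> \<Longrightarrow> y \<in> pverts \<Delta> \<Longrightarrow> (x, y) \<in> parcs \<Delta> \<longleftrightarrow> (f x, f y) \<in> parcs \<Gamma>"
    using is_isomorphic_sym[OF assms(2)] unfolding is_isomorphic_def by blast
  have "finite (pverts \<Delta>)" using assms(1) bij_betw_finite[OF f(1)] by (simp add: pair_graph_iff)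
  moreover have "sym (parcs \<Delta>)"
  proof (rule symI)
    fix x y assume "(x, y) \<in> parcs \<Delta>"
    then show "(y, x) \<in> parcs \<Delta>" using f(2)[of x y] f(2)[of y x] assms(1,3)
      by (auto simp: pair_graph_iff sym_def)
  qed
  moreover have "irrefl (parcs \<Delta>)"
    using f(2)[of x x for x] assms(1,3) by (fastforce simp: pair_graph_iff irrefl_def)
  ultimately show ?thesis using assms(3) by (simp add: pair_graph_iff)
qed

text \<open>Made for the renaming of pairs to lists in \<open>cart_power\<close>: the distance on
  the new vertices is given by a closed formula \<open>E\<close>, to be compared with
  \<open>D\<close> on the original vertices only.\<close>

lemma linear_array_image:
  assumes P: "linear_array q k \<Gamma> D" and f: "inj f"
    and E: "\<And>x y. x \<in> pverts \<Gamma> \<Longrightarrow> y \<in> pverts \<Gamma> \<Longrightarrow> E (f x) (f y) = D x y"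
  shows "linear_array q k \<lparr>pverts = f ` pverts \<Gamma>, parcs = map_prod f f ` parcs \<Gamma>\<rparr> E"
proof -
  let ?Q = "\<lparr>pverts = f ` pverts \<Gamma>, parcs = map_prod f f ` parcs \<Gamma>\<rparr>"
  have pg: "pair_graph \<Gamma>" and iP: "is_distance \<Gamma> D" using P by (simp_all add: linear_array_def)
  then have sub: "parcs \<Gamma> \<subseteq> pverts \<Gamma> \<times> pverts \<Gamma>" by (simp add: pair_graph_iff)
  have "pair_graph ?Q"
    by (rule pair_graph_isomorphic[OF pg is_isomorphic_image[OF f]]) (use sub in auto)
  have nb: "{z. (f y, z) \<in> parcs ?Q \<and> R z} = f ` {z. (y, z) \<in> parcs \<Gamma> \<and> R (f z)}" for y R
    using f by (auto simp: inj_def)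
  have cnb: "card {z. (f y, z) \<in> parcs ?Q \<and> R z} = card {z. (y, z) \<in> parcs \<Gamma> \<and> R (f z)}" for y R
    unfolding nb by (rule card_image) (rule inj_on_subset[OF f subset_UNIV])
  have E': "{z. (y, z) \<in> parcs \<Gamma> \<and> R (E (f x) (f z))} = {z. (y, z) \<in> parcs \<Gamma> \<and> R (D x z)}"
    if "x \<in> pverts \<Gamma>" for x y R using E[OF that] sub by auto
  have "is_distance ?Q E"
  proof -
    have "(E (f x) (f y) = 0 \<longleftrightarrow> f x = f y) \<and> (\<forall>z. (f y, z) \<in> parcs ?Q \<longrightarrow> E (f x) z \<le> Suc (E (f x) (f y)))
      \<and> (\<forall>m. E (f x) (f y) = Suc m \<longrightarrow> (\<exists>z. (z, f y) \<in> parcs ?Q \<and> E (f x) z = m))"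
      if xy: "x \<in> pverts \<Gamma>" "y \<in> pverts \<Gamma>" for x y
    proof (intro conjI allI impI)
      show "E (f x) (f y) = 0 \<longleftrightarrow> f x = f y"
        using is_distance_eq_0_iff[OF iP xy] E xy f by (auto simp: inj_def)
      show "E (f x) z \<le> Suc (E (f x) (f y))" if yz: "(f y, z) \<in> parcs ?Q" for z
      proof -
        obtain w where w: "(y, w) \<in> parcs \<Gamma>" "z = f w"
          using nb[of y "\<lambda>_. True"] yz by blast
        then show ?thesis using is_distance_step[OF iP xy w(1)] E xy sub by auto
      qed
      show "\<exists>z. (z, f y) \<in> parcs ?Q \<and> E (f x) z = m" if m: "E (f x) (f y) = Suc m" for m
      proof -
        have "D x y = Suc m" using m E xy by simp
        then obtain w where w: "(w, y) \<in> parcs \<Gamma>" "D x w = m"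
          using is_distance_pred[OF iP xy] by blast
        then have "(f w, f y) \<in> parcs ?Q" "E (f x) (f w) = m" using E xy sub by auto
        then show ?thesis by blast
      qed
    qed
    then show ?thesis unfolding is_distance_def by simp
  qed
  moreover have "card {z. (f y, z) \<in> parcs ?Q} = k \<and>
       card {z. (f y, z) \<in> parcs ?Q \<and> Suc (E (f x) z) = E (f x) (f y)} = E (f x) (f y) \<and>
       card {z. (f y, z) \<in> parcs ?Q \<and> E (f x) z = E (f x) (f y)} = (q - 2) * E (f x) (f y)"
    if xy: "x \<in> pverts \<Gamma>" "y \<in> pverts \<Gamma>" for x y
  proof -
    have "card {z. (f y, z) \<in> parcs ?Q} = card {z. (y, z) \<in> parcs \<Gamma>}"
      using cnb[of y "\<lambda>_. True"] by simp
    moreover have "card {z. (f y, z) \<in> parcs ?Q \<and> Suc (E (f x) z) = E (f x) (f y)}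
      = card {z. (y, z) \<in> parcs \<Gamma> \<and> Suc (D x z) = D x y}"
      using cnb[of y "\<lambda>w. Suc (E (f x) w) = E (f x) (f y)"] E'[OF xy(1), of y "\<lambda>d. Suc d = D x y"] E[OF xy] by simp
    moreover have "card {z. (f y, z) \<in> parcs ?Q \<and> E (f x) z = E (f x) (f y)}
      = card {z. (y, z) \<in> parcs \<Gamma> \<and> D x z = D x y}"
      using cnb[of y "\<lambda>w. E (f x) w = E (f x) (f y)"] E'[OF xy(1), of y "\<lambda>d. d = D x y"] E[OF xy] by simp
    ultimately show ?thesis using P xy E[OF xy] by (simp add: linear_array_def)
  qed
  ultimately show ?thesis unfolding linear_array_def using \<open>pair_graph ?Q\<close> P[unfolded linear_array_def]
    by simp
qed

lemma linear_array_cart_power: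
  assumes "linear_array q k \<Gamma> D"
  shows "linear_array q (n * k) (cart_power \<Gamma> n) (\<lambda>xs ys. sum_list (map2 D xs ys))"
proof (induction n)
  case 0
  then show ?case by (auto simp: linear_array_def pair_graph_iff is_distance_def sym_def irrefl_def)
next
  case (Suc n)
  have "linear_array q (k + n * k) (cart_power \<Gamma> (Suc n)) (\<lambda>xs ys. sum_list (map2 D xs ys))"
    unfolding cart_power.simps Let_def
    by (rule linear_array_image[OF linear_array_cart_prod[OF assms Suc.IH] inj_case_prod_Cons]) (clarsimp split: prod.splits)
  then show ?case by simp
qed

text \<open>Seen from a vertex at distance 1, one neighbour is the base point and the remaining
  \<open>q - 2\<close> stay at distance 1.\<close>

lemma linear_array_complete:
  assumes "q \<ge> 2"
  shows "linear_array q (q - 1) (complete_graph q) (\<lambda>x y. if x = y then 0 else 1)"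
proof -
  have c: "card {z. y < q \<and> z < q \<and> y \<noteq> z} = q - 1" if "y < q" for y
  proof -
    have "{z. y < q \<and> z < q \<and> y \<noteq> z} = {..<q} - {y}" using that by auto
    then show ?thesis using that by simp
  qed
  have c2: "card {z. (y < q \<and> z < q \<and> y \<noteq> z) \<and> (if x = z then 0 else 1 :: nat) = 1} = q - 2"
    if "y < q" "x < q" "x \<noteq> y" for x y
  proof -
    have "{z. (y < q \<and> z < q \<and> y \<noteq> z) \<and> (if x = z then 0 else 1 :: nat) = 1} = {..<q} - {y, x}"
      using that by auto
    moreover have "card ({..<q} - {y, x}) = q - 2" using that by (subst card_Diff_subset) auto
    ultimately show ?thesis by simp
  qed
  have c3: "{z. (y < q \<and> z < q \<and> y \<noteq> z) \<and> Suc (if x = z then 0 else 1 :: nat) = 1} = {x}"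
    if "y < q" "x < q" "x \<noteq> y" for x y using that by auto
  have "card {z. (y, z) \<in> parcs (complete_graph q)} = q - 1 \<and>
    card {z. (y, z) \<in> parcs (complete_graph q) \<and> Suc (if x = z then 0 else 1) = (if x = y then 0 else 1)} =
      (if x = y then 0 else 1) \<and>
    card {z. (y, z) \<in> parcs (complete_graph q) \<and> (if x = z then 0 else 1 :: nat) = (if x = y then 0 else 1)} =
      (q - 2) * (if x = y then 0 else 1)" if "x < q" "y < q" for x y
  proof (cases "x = y")
    case True
    then show ?thesis using c that by (simp add: complete_graph_def)
  next
    case False
    then show ?thesis using c c2 c3 that by (simp add: complete_graph_def)
  qed
  moreover have "pair_graph (complete_graph q)"
    by (auto simp: pair_graph_iff complete_graph_def sym_def irrefl_def)
  moreover have "is_distance (complete_graph q) (\<lambda>x y. if x = y then 0 else 1)"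
    by (auto simp: is_distance_def complete_graph_def)
  moreover have "pverts (complete_graph q) = {..<q}" by (simp add: complete_graph_def)
  ultimately show ?thesis using assms by (auto simp: linear_array_def lessThan_empty_iff)
qed

lemma linear_array_hamming:
  assumes "q \<ge> 2"
  shows "linear_array q (d * (q - 1)) (hamming_graph d q)
    (\<lambda>xs ys. sum_list (map2 (\<lambda>x y. if x = y then 0 else 1) xs ys))"
  unfolding hamming_graph_def by (rule linear_array_cart_power[OF linear_array_complete[OF assms]])

lemma linear_array_isomorphic_distance_regular:
  assumes "linear_array q k \<Delta> D" "pair_graph \<Gamma>" "is_isomorphic \<Gamma> \<Delta>"
  shows "distance_regular \<Gamma>"
  using distance_regular_isomorphic[OF assms(2,3)] linear_array_distance_regular[OF assms(1)] .

section \<open>Distance-regularity of the listed graphs\<close>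

text \<open>An executable certificate: all quantifiers range over lists, so that
  \<open>code_simp\<close> decides it for the sporadic graphs and the Shrikhande graph.\<close>

definition checks_array ::
    "'a list \<Rightarrow> ('a \<Rightarrow> 'a list) \<Rightarrow> ('a \<Rightarrow> 'a \<Rightarrow> nat) \<Rightarrow> (nat \<Rightarrow> nat) \<Rightarrow> (nat \<Rightarrow> nat) \<Rightarrow> (nat \<Rightarrow> nat) \<Rightarrow> bool" where
  "checks_array vs nb D c a b \<longleftrightarrow> vs \<noteq> [] \<and>
     (\<forall>y\<in>set vs. distinct (nb y) \<and> (\<forall>z\<in>set (nb y). z \<noteq> y \<and> z \<in> set vs \<and> y \<in> set (nb z))) \<and>
     (\<forall>x\<in>set vs. \<forall>y\<in>set vs. (D x y = 0 \<longleftrightarrow> x = y) \<and> (\<forall>z\<in>set (nb y). D x z \<le> Suc (D x y)) \<and>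
       (D x y = 0 \<or> (\<exists>z\<in>set (nb y). Suc (D x z) = D x y)) \<and>
       length (filter (\<lambda>z. Suc (D x z) = D x y) (nb y)) = c (D x y) \<and>
       length (filter (\<lambda>z. D x z = D x y) (nb y)) = a (D x y) \<and>
       length (filter (\<lambda>z. D x z = Suc (D x y)) (nb y)) = b (D x y))"

lemma checks_array_sound:
  assumes "checks_array vs nb D c a b" "pverts \<Gamma> = set vs"
    and "parcs \<Gamma> = {(x, y). x \<in> set vs \<and> y \<in> set (nb x)}"
  shows "pair_graph \<Gamma>" "pverts \<Gamma> \<noteq> {}" "is_distance \<Gamma> D" "has_intersection_array \<Gamma> D c a b"
proof -
  note C = assms(1)[unfolded checks_array_def]
  note C3 = C[THEN conjunct2, THEN conjunct2, rule_format]
  have nb: "distinct (nb y)" "\<And>z. z \<in> set (nb y) \<Longrightarrow> z \<noteq> y \<and> z \<in> set vs \<and> y \<in> set (nb z)"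
    if "y \<in> set vs" for y using C that by blast+
  show "pverts \<Gamma> \<noteq> {}" using C assms(2) by simp
  show "pair_graph \<Gamma>" unfolding pair_graph_iff assms(2,3)
  proof (intro conjI subrelI symI finite_set)
    show "irrefl {(x, y). x \<in> set vs \<and> y \<in> set (nb x)}" using nb(2)[of x x for x] by (simp add: irrefl_def) blast
  next
    fix x y assume "(x, y) \<in> {(x, y). x \<in> set vs \<and> y \<in> set (nb x)}"
    then have "x \<in> set vs" "y \<in> set (nb x)" by simp_all
    then show "(x, y) \<in> set vs \<times> set vs" "(y, x) \<in> {(x, y). x \<in> set vs \<and> y \<in> set (nb x)}"
      using nb(2)[of x y] by simp_all
  qed
  show "is_distance \<Gamma> D" unfolding is_distance_def assms(2,3)
  proof (intro ballI conjI allI impI)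
    fix x y assume xy: "x \<in> set vs" "y \<in> set vs"
    then have *: "(D x y = 0 \<longleftrightarrow> x = y) \<and> (\<forall>z\<in>set (nb y). D x z \<le> Suc (D x y)) \<and>
       (D x y = 0 \<or> (\<exists>z\<in>set (nb y). Suc (D x z) = D x y))" using C3[OF xy] by (elim conjE; intro conjI)
    show "D x y = 0 \<longleftrightarrow> x = y" using * by simp
    show "D x z \<le> Suc (D x y)" if "(y, z) \<in> {(x, y). x \<in> set vs \<and> y \<in> set (nb x)}" for z
      using * that by simp
    show "\<exists>z. (z, y) \<in> {(x, y). x \<in> set vs \<and> y \<in> set (nb x)} \<and> D x z = n" if n: "D x y = Suc n" for n
    proof -
      obtain z where "z \<in> set (nb y)" "Suc (D x z) = D x y" using * n by auto
      moreover from this have "z \<in> set vs \<and> y \<in> set (nb z)" using nb(2)[OF xy(2)] by blast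
      ultimately show ?thesis using n by (intro exI[of _ z]) simp
    qed
  qed
  show "has_intersection_array \<Gamma> D c a b" unfolding has_intersection_array_def assms(2)
  proof (intro ballI)
    fix x y assume xy: "x \<in> set vs" "y \<in> set vs"
    have "card {z. (y, z) \<in> parcs \<Gamma> \<and> P z} = length (filter P (nb y))" for P
    proof -
      have eq: "{z. (y, z) \<in> parcs \<Gamma> \<and> P z} = set (filter P (nb y))" using xy(2) by (auto simp: assms(3))
      show ?thesis unfolding eq using nb(1)[OF xy(2)] by (intro distinct_card distinct_filter)
    qed
    then show "card {z. (y, z) \<in> parcs \<Gamma> \<and> Suc (D x z) = D x y} = c (D x y) \<and>
      card {z. (y, z) \<in> parcs \<Gamma> \<and> D x z = D x y} = a (D x y) \<and>
      card {z. (y, z) \<in> parcs \<Gamma> \<and> D x z = Suc (D x y)} = b (D x y)"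
      using C3[OF xy] by simp
  qed
qed

lemma distance_regular_checks_array:
  assumes "checks_array vs nb D c a b" "pverts \<Gamma> = set vs"
    and "parcs \<Gamma> = {(x, y). x \<in> set vs \<and> y \<in> set (nb x)}"
  shows "distance_regular \<Gamma>"
  using checks_array_sound[OF assms] distance_regular_iff by blast

lemma linear_array_checks_array:
  assumes "checks_array vs nb D (\<lambda>i. i) (\<lambda>i. (q - 2) * i) b" "pverts \<Gamma> = set vs"
    and "parcs \<Gamma> = {(x, y). x \<in> set vs \<and> y \<in> set (nb x)}" and "\<And>y. length (nb y) = k"
  shows "linear_array q k \<Gamma> D"
proof -
  have "card {z. (y, z) \<in> parcs \<Gamma>} = k" if "y \<in> pverts \<Gamma>" for y
  proof -
    have y: "y \<in> set vs" using that assms(2) by simp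
    then have eq: "{z. (y, z) \<in> parcs \<Gamma>} = set (nb y)" by (simp add: assms(3))
    have "distinct (nb y)"
      using assms(1)[unfolded checks_array_def, THEN conjunct2, THEN conjunct1, rule_format, OF y] by simp
    then show ?thesis unfolding eq using assms(4) by (simp add: distinct_card)
  qed
  then show ?thesis using checks_array_sound[OF assms(1-3)]
    by (simp add: linear_array_def has_intersection_array_def)
qed

section \<open>The three sporadic graphs, by evaluation\<close>

definition part_vertices :: "nat list \<Rightarrow> (nat \<times> nat) list" where
  "part_vertices ns = concat (map (\<lambda>i. map (Pair i) [0..<ns ! i]) [0..<length ns])"

lemma complete_multipartite_eq:
  "pverts (complete_multipartite ns) = set (part_vertices ns)"
  "parcs (complete_multipartite ns) =
    {(x, y). x \<in> set (part_vertices ns) \<and> y \<in> set (filter (\<lambda>z. fst x \<noteq> fst z) (part_vertices ns))}"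
proof -
  have V: "{(i, j). i < length ns \<and> j < ns ! i} = set (part_vertices ns)"
    by (auto simp: part_vertices_def)
  show "pverts (complete_multipartite ns) = set (part_vertices ns)"
    unfolding complete_multipartite_def Let_def V by simp
  show "parcs (complete_multipartite ns) =
    {(x, y). x \<in> set (part_vertices ns) \<and> y \<in> set (filter (\<lambda>z. fst x \<noteq> fst z) (part_vertices ns))}"
    unfolding complete_multipartite_def Let_def V by auto
qed

lemma distance_regular_K33: "distance_regular (complete_multipartite [3, 3])"
proof (rule distance_regular_checks_array[OF _ complete_multipartite_eq])
  show "checks_array (part_vertices [3, 3]) (\<lambda>y. filter (\<lambda>z. fst y \<noteq> fst z) (part_vertices [3, 3]))
    (\<lambda>x y. if x = y then 0 else if fst x = fst y then 2 else 1)
    (\<lambda>i. if i = 0 then 0 else if i = 1 then 1 else 3) (\<lambda>i. 0) (\<lambda>i. if i = 0 then 3 else if i = 1 then 2 else 0)"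
    by code_simp
qed

lemma distance_regular_K222: "distance_regular (complete_multipartite [2, 2, 2])"
proof (rule distance_regular_checks_array[OF _ complete_multipartite_eq])
  show "checks_array (part_vertices [2, 2, 2]) (\<lambda>y. filter (\<lambda>z. fst y \<noteq> fst z) (part_vertices [2, 2, 2]))
    (\<lambda>x y. if x = y then 0 else if fst x = fst y then 2 else 1)
    (\<lambda>i. if i = 0 then 0 else if i = 1 then 1 else 4) (\<lambda>i. if i = 1 then 2 else 0) (\<lambda>i. if i = 0 then 4 else if i = 1 then 1 else 0)"
    by code_simp
qed

text \<open>Distance 3 occurs exactly between partners in the removed matching, and the array is
  {5,4,1; 1,4,5}.\<close>

lemma distance_regular_K66_minus: "distance_regular (complete_bipartite_minus_matching 6)"
proof (rule distance_regular_checks_array)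
  let ?vs = "part_vertices [6, 6]"
  show "checks_array ?vs (\<lambda>y. filter (\<lambda>z. fst y \<noteq> fst z \<and> snd y \<noteq> snd z) ?vs)
    (\<lambda>x y. if x = y then 0 else if fst x = fst y then 2 else if snd x = snd y then 3 else 1)
    (\<lambda>i. if i = 0 then 0 else if i = 1 then 1 else if i = 2 then 4 else 5) (\<lambda>i. 0)
    (\<lambda>i. if i = 0 then 5 else if i = 1 then 4 else if i = 2 then 1 else 0)"
    by code_simp
  show "pverts (complete_bipartite_minus_matching 6) = set ?vs"
    by (simp add: complete_bipartite_minus_matching_def complete_multipartite_eq)
  show "parcs (complete_bipartite_minus_matching 6) =
      {(x, y). x \<in> set ?vs \<and> y \<in> set (filter (\<lambda>z. fst x \<noteq> fst z \<and> snd x \<noteq> snd z) ?vs)}"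
    by (auto simp add: complete_bipartite_minus_matching_def complete_multipartite_eq)
qed

section \<open>The Shrikhande graph\<close>

lemma inv_integer_mod_group_4:
  assumes "a \<in> {0..<4 :: int}"
  shows "inv\<^bsub>integer_mod_group 4\<^esub> a = (4 - a) mod 4"
proof -
  have g: "group (integer_mod_group 4)" by simp
  show ?thesis
    by (rule group.inv_equality[OF g])
      (use assms in \<open>auto simp: mult_integer_mod_group carrier_integer_mod_group mod_simps\<close>)
qed

text \<open>Inverses are reduced modulo 4, with 3 in place of -1, so that neighbourhoods become
  explicit lists.\<close>

lemma shrikhande_graph_eq:
  "pverts shrikhande_graph = {0..<4} \<times> {0..<4}"
  "parcs shrikhande_graph = {(x, y). x \<in> {0..<4} \<times> {0..<4} \<and>
     y \<in> set (map (\<lambda>(a, b). ((fst x + a) mod 4, (snd x + b) mod 4)) [(1, 0), (1, 1), (0, 1), (3, 0), (3, 3), (0, 3)])}"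
proof -
  let ?Z = "integer_mod_group 4 \<times>\<times> integer_mod_group 4"
  have c: "carrier ?Z = {0..<4} \<times> {0..<4}" by (simp add: DirProd_def carrier_integer_mod_group)
  have "inv\<^bsub>?Z\<^esub> (a, b) = ((4 - a) mod 4, (4 - b) mod 4)" if "a \<in> {0..<4}" "b \<in> {0..<4}" for a b
    using inv_DirProd[of "integer_mod_group 4" "integer_mod_group 4" a b] that
    by (simp add: inv_integer_mod_group_4 carrier_integer_mod_group)
  then have S: "{(1, 0), (1, 1), (0, 1)} \<union> m_inv ?Z ` {(1, 0), (1, 1), (0, 1)}
      = {(1, 0), (1, 1), (0, 1), (3, 0), (3, 3), (0, 3)}" by (simp add: insert_commute)
  show "pverts shrikhande_graph = {0..<4} \<times> {0..<4}"
    unfolding shrikhande_graph_def cayley_graph_def Let_def using c by simp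
  have m: "x \<otimes>\<^bsub>?Z\<^esub> y = ((fst x + fst y) mod 4, (snd x + snd y) mod 4)" for x y
    by (cases x; cases y) (simp add: mult_integer_mod_group)
  show "parcs shrikhande_graph = {(x, y). x \<in> {0..<4} \<times> {0..<4} \<and>
     y \<in> set (map (\<lambda>(a, b). ((fst x + a) mod 4, (snd x + b) mod 4)) [(1, 0), (1, 1), (0, 1), (3, 0), (3, 3), (0, 3)])}"
    unfolding shrikhande_graph_def cayley_graph_def Let_def S c m pair_pre_digraph.simps by auto
qed

text \<open>Diameter 2 with c = 0, 1, 2 and a = 0, 2, 4: the array of H(2,4).\<close>

lemma linear_array_shrikhande: "\<exists>D. linear_array 4 6 shrikhande_graph D"
proof -
  let ?vs = "List.product [0, 1, 2, 3] [0, 1, 2, 3] :: (int \<times> int) list"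
  let ?nb = "\<lambda>x. map (\<lambda>(a, b). ((fst x + a) mod 4, (snd x + b) mod 4)) [(1, 0), (1, 1), (0, 1), (3, 0), (3, 3), (0, 3)]
    :: (int \<times> int) list"
  let ?D = "\<lambda>x y. if x = y then 0 else if y \<in> set (?nb x) then 1 else 2 :: nat"
  have C: "checks_array ?vs ?nb ?D (\<lambda>i. i) (\<lambda>i. (4 - 2) * i) (\<lambda>i. 6 - 3 * i)"
    by code_simp
  have "{0..<4} = set [0, 1, 2, 3 :: int]" by (simp add: set_eq_iff) presburger
  then have V: "{0..<4} \<times> {0..<4} = set ?vs" by (simp only: set_product)
  have P: "pverts shrikhande_graph = set ?vs" "parcs shrikhande_graph = {(x, y). x \<in> set ?vs \<and> y \<in> set (?nb x)}"
    unfolding shrikhande_graph_eq V by (rule refl)+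
  have "linear_array 4 6 shrikhande_graph ?D"
    by (rule linear_array_checks_array[OF C P]) simp
  then show ?thesis by blast
qed

text \<open>All distances are expressed through the clockwise offset from \<open>x\<close> to
  \<open>y\<close>, so that one case distinction on the offset covers all pairs.\<close>

lemma distance_regular_cycle:
  assumes "n \<ge> 3"
  shows "distance_regular (cycle_graph n)"
proof -
  define s where "s = (\<lambda>y. if y + 1 = n then 0 else y + 1)"
  define p where "p = (\<lambda>y. if y = 0 then n - 1 else y - 1)"
  \<comment> \<open>\<open>Z x y\<close> counts successor steps from \<open>x\<close> to
    \<open>y\<close>, and \<open>W\<close> replaces this offset by the shorter way round.\<close>
  define Z where "Z = (\<lambda>x y. if x \<le> y then y - x else y + n - x)"
  define W where "W = (\<lambda>z. if 2 * z \<le> n then z else n - z)"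
  define D where "D = (\<lambda>x y. W (Z x y))"
  have arc: "(x, y) \<in> parcs (cycle_graph n) \<longleftrightarrow> x < n \<and> (y = s x \<or> y = p x)" for x y
  proof -
    have m: "(z + 1) mod n = s z" if "z < n" for z using that by (auto simp: s_def)
    have "x = s y \<longleftrightarrow> y = p x" if "x < n" "y < n" using that by (auto simp: s_def p_def)
    moreover have "s x < n" "p x < n" if "x < n" using that by (auto simp: s_def p_def)
    ultimately show ?thesis using m by (auto simp: cycle_graph_def)
  qed
  have sp: "s y \<noteq> p y" if "y < n" for y using assms that by (auto simp: s_def p_def)
  have nb: "card {z. (y, z) \<in> parcs (cycle_graph n) \<and> P z} = of_bool (P (s y)) + of_bool (P (p y))"
    if "y < n" for y P
  proof -
    have "{z. (y, z) \<in> parcs (cycle_graph n) \<and> P z} =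
        (if P (s y) then {s y} else {}) \<union> (if P (p y) then {p y} else {})"
      using that by (auto simp: arc)
    then show ?thesis using sp[OF that] by (auto simp: card_insert_if)
  qed
  have lt: "s y < n" "p y < n" if "y < n" for y using that by (auto simp: s_def p_def)
  have arcsym: "p (s y) = y" "s (p y) = y" if "y < n" for y using that by (auto simp: s_def p_def)
  have sub: "parcs (cycle_graph n) \<subseteq> {..<n} \<times> {..<n}" using lt by (auto simp: arc)
  have pg: "pair_graph (cycle_graph n)"
    unfolding pair_graph_iff
  proof (intro conjI)
    show "irrefl (parcs (cycle_graph n))" using assms by (auto simp: irrefl_def arc s_def p_def split: if_splits)
    show "sym (parcs (cycle_graph n))" using arcsym lt by (auto simp: sym_def arc)
  qed (use sub in \<open>simp_all add: cycle_graph_def\<close>)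
  have Z: "Z x y < n" "Z x (s y) = s (Z x y)" "Z x (p y) = p (Z x y)" "Z x y = 0 \<longleftrightarrow> x = y"
    if "x < n" "y < n" for x y
    using that by (simp_all add: Z_def s_def p_def) linarith+
  have W0: "W z = 0 \<longleftrightarrow> z = 0" if "z < n" for z using that by (auto simp: W_def)
  have Ws: "W (s z) = (if 2 * z + 1 = n then W z else if 2 * z < n then Suc (W z) else W z - 1)"
    and Wp: "W (p z) = (if z = 0 then Suc (W z) else if 2 * z = n + 1 then W z else if 2 * z \<le> n then W z - 1 else Suc (W z))"
    if "z < n" for z
    using that assms unfolding W_def s_def p_def by (simp_all; linarith)+
  have "is_distance (cycle_graph n) D"
    unfolding is_distance_def
  proof (intro ballI conjI allI impI)
    fix x y assume "x \<in> pverts (cycle_graph n)" "y \<in> pverts (cycle_graph n)"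
    then have xy: "x < n" "y < n" by (auto simp: cycle_graph_def)
    note Zxy = Z[OF xy]
    show "D x y = 0 \<longleftrightarrow> x = y" unfolding D_def using W0[OF Zxy(1)] Zxy(4) by simp
    show "D x z \<le> Suc (D x y)" if yz: "(y, z) \<in> parcs (cycle_graph n)" for z
    proof -
      have "z = s y \<or> z = p y" using yz arc by blast
      then show ?thesis unfolding D_def using Zxy Ws[OF Zxy(1)] Wp[OF Zxy(1)] by auto
    qed
    show "\<exists>z. (z, y) \<in> parcs (cycle_graph n) \<and> D x z = m" if m: "D x y = Suc m" for m
    proof -
      have "Z x y \<noteq> 0" using m W0[OF Zxy(1)] by (simp add: D_def)
      then have "D x (s y) = m \<or> D x (p y) = m"
        using m unfolding D_def Zxy(2,3) Ws[OF Zxy(1)] Wp[OF Zxy(1)] by auto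
      moreover have "(s y, y) \<in> parcs (cycle_graph n)" "(p y, y) \<in> parcs (cycle_graph n)"
        using xy lt arcsym by (auto simp: arc)
      ultimately show ?thesis by blast
    qed
  qed
  moreover have "has_intersection_array (cycle_graph n) D
      (\<lambda>i. if i = 0 then 0 else if 2 * i = n then 2 else 1) (\<lambda>i. if 2 * i + 1 = n then 1 else 0)
      (\<lambda>i. if i = 0 then 2 else if 2 * i + 1 \<ge> n then 0 else 1)"
    unfolding has_intersection_array_def
  proof (intro ballI)
    fix x y assume "x \<in> pverts (cycle_graph n)" "y \<in> pverts (cycle_graph n)"
    then have xy: "x < n" "y < n" by (auto simp: cycle_graph_def)
    note Zxy = Z[OF xy]
    define z where "z = Z x y"
    have z: "z < n" using Zxy by (simp add: z_def)
    have D: "D x (s y) = W (s z)" "D x (p y) = W (p z)" "D x y = W z" using Zxy by (simp_all add: D_def z_def)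
    have W: "2 * z \<le> n \<Longrightarrow> W z = z" "\<not> 2 * z \<le> n \<Longrightarrow> W z = n - z" by (simp_all add: W_def)
    \<comment> \<open>The special offsets are 0, half of \<open>n\<close> for even \<open>n\<close>,
      and the two middle offsets for odd \<open>n\<close>.\<close>
    consider "z = 0" | "z \<noteq> 0" "2 * z + 1 < n" | "z \<noteq> 0" "2 * z + 1 = n" | "z \<noteq> 0" "2 * z = n"
      | "2 * z = n + 1" | "n + 1 < 2 * z" by linarith
    then have "W z = 0 \<and> W (s z) = 1 \<and> W (p z) = 1 \<or>
      W z > 0 \<and> 2 * W z + 1 < n \<and> {Suc (W (s z)), Suc (W (p z))} = {W z, Suc (Suc (W z))} \<or>
      W z > 0 \<and> 2 * W z + 1 = n \<and> {Suc (W (s z)), Suc (W (p z))} = {W z, Suc (W z)} \<or>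
      W z > 0 \<and> 2 * W z = n \<and> Suc (W (s z)) = W z \<and> Suc (W (p z)) = W z"
    proof cases
      case 1
      then show ?thesis using Ws[OF z] Wp[OF z] W(1) assms by simp
    next
      case 2
      then show ?thesis using Ws[OF z] Wp[OF z] W(1) assms by (simp add: insert_commute)
    next
      case 3
      then show ?thesis using Ws[OF z] Wp[OF z] W(1) assms by (simp add: insert_commute)
    next
      case 4
      then show ?thesis using Ws[OF z] Wp[OF z] W(1) assms by simp
    next
      case 5
      then have "Suc (W (s z)) = W z" "W (p z) = W z" "W z > 0" "2 * W z + 1 = n"
        using Ws[OF z] Wp[OF z] W(2) assms z by auto
      then show ?thesis by simp
    next
      case 6
      then have "Suc (W (s z)) = W z" "W (p z) = Suc (W z)" "W z > 0" "2 * W z + 1 < n"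
        using Ws[OF z] Wp[OF z] W(2) assms z by auto
      then show ?thesis by simp
    qed
    then show "card {z. (y, z) \<in> parcs (cycle_graph n) \<and> Suc (D x z) = D x y} =
         (if D x y = 0 then 0 else if 2 * D x y = n then 2 else 1) \<and>
       card {z. (y, z) \<in> parcs (cycle_graph n) \<and> D x z = D x y} = (if 2 * D x y + 1 = n then 1 else 0) \<and>
       card {z. (y, z) \<in> parcs (cycle_graph n) \<and> D x z = Suc (D x y)} =
         (if D x y = 0 then 2 else if 2 * D x y + 1 \<ge> n then 0 else 1)"
      unfolding nb[OF xy(2)] D using assms by (elim disjE) (auto simp: doubleton_eq_iff)
  qed
  moreover have "0 \<in> pverts (cycle_graph n)" using assms by (simp add: cycle_graph_def)
  ultimately show ?thesis unfolding distance_regular_iff[OF pg] by blast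
qed

lemma distance_regular_hamming: "q \<ge> 2 \<Longrightarrow> distance_regular (hamming_graph d q)"
  using linear_array_hamming linear_array_distance_regular by blast

lemma distance_regular_doob: "distance_regular (doob_graph n m)"
proof -
  obtain D where "linear_array 4 6 shrikhande_graph D" using linear_array_shrikhande by blast
  then have "linear_array 4 (m * 6) (cart_power shrikhande_graph m) (\<lambda>xs ys. sum_list (map2 D xs ys))"
    by (rule linear_array_cart_power)
  from linear_array_cart_prod[OF linear_array_hamming[of 4 n] this]
  show ?thesis unfolding doob_graph_def using linear_array_distance_regular by force
qed

lemma complete_graph_iso:
  assumes "finite (pverts \<Gamma>)" "parcs \<Gamma> = {(x, y). x \<in> pverts \<Gamma> \<and> y \<in> pverts \<Gamma> \<and> x \<noteq> y}"
  shows "is_isomorphic \<Gamma> (complete_graph (card (pverts \<Gamma>)))"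
proof -
  obtain f where f: "bij_betw f (pverts \<Gamma>) {0..<card (pverts \<Gamma>)}"
    using ex_bij_betw_finite_nat[OF assms(1)] by blast
  show ?thesis
    by (rule is_isomorphicI[of f]) (use f assms(2) in \<open>auto simp: complete_graph_def bij_betw_def inj_on_eq_iff\<close>)
qed

section \<open>Hypercubes and their antipodal quotients\<close>

definition hdist :: "'a list \<Rightarrow> 'a list \<Rightarrow> nat" where
  "hdist xs ys = sum_list (map2 (\<lambda>x y. if x = y then 0 else 1) xs ys)"

definition antipode :: "nat list \<Rightarrow> nat list" where
  "antipode = map (\<lambda>x. 1 - x)"

lemma pverts_cube: "pverts (hamming_graph d 2) = {xs. length xs = d \<and> set xs \<subseteq> {0, 1}}"
  unfolding hamming_graph_def pverts_cart_power by (auto simp: complete_graph_def)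

lemma linear_array_cube: "linear_array 2 d (hamming_graph d 2) hdist"
  using linear_array_hamming[of 2 d] unfolding hdist_def[abs_def] by simp

lemmas cube_facts = linear_array_cube[unfolded linear_array_def]

lemma pair_graph_cube: "pair_graph (hamming_graph d 2)"
  using cube_facts by blast

lemma is_distance_cube: "is_distance (hamming_graph d 2) hdist"
  using cube_facts by blast

lemma gdist_cube:
  "x \<in> pverts (hamming_graph d 2) \<Longrightarrow> y \<in> pverts (hamming_graph d 2) \<Longrightarrow> gdist (hamming_graph d 2) x y = hdist x y"
  using pair_graph.gdist_eqI[OF pair_graph_cube is_distance_cube] .

lemma hdist_commute: "hdist x y = hdist y x"
  unfolding hdist_def by (induction x y rule: list_induct2') auto

lemma antipode_cube: "x \<in> pverts (hamming_graph d 2) \<Longrightarrow> antipode x \<in> pverts (hamming_graph d 2)"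
  by (auto simp: pverts_cube antipode_def)

lemma antipode_antipode: "x \<in> pverts (hamming_graph d 2) \<Longrightarrow> antipode (antipode x) = x"
  by (auto simp: pverts_cube antipode_def intro!: map_idI)

text \<open>Over 0 and 1, each coordinate of \<open>x\<close> agrees with exactly one of the
  coordinates of \<open>y\<close> and \<open>antipode y\<close>.\<close>

lemma hdist_antipode:
  assumes "x \<in> pverts (hamming_graph d 2)" "y \<in> pverts (hamming_graph d 2)"
  shows "hdist x y + hdist x (antipode y) = d"
proof -
  have "length x = length y" "set x \<subseteq> {0, 1}" "set y \<subseteq> {0, 1}" "length y = d"
    using assms by (auto simp: pverts_cube)
  then show ?thesis
  proof (induction x y arbitrary: d rule: list_induct2)
    case (Cons a as b bs)
    have "hdist as bs + hdist as (antipode bs) = length bs" using Cons by simp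
    moreover have "a = 0 \<or> a = 1" "b = 0 \<or> b = 1" using Cons.prems by auto
    ultimately show ?case using Cons.prems by (auto simp: hdist_def antipode_def)
  qed (simp add: hdist_def antipode_def)
qed

lemma hdist_eq_0_iff:
  "x \<in> pverts (hamming_graph d 2) \<Longrightarrow> y \<in> pverts (hamming_graph d 2) \<Longrightarrow> hdist x y = 0 \<longleftrightarrow> x = y"
  using is_distance_eq_0_iff[OF is_distance_cube] .

lemma hdist_eq_dim_iff:
  assumes "x \<in> pverts (hamming_graph d 2)" "y \<in> pverts (hamming_graph d 2)"
  shows "hdist x y = d \<longleftrightarrow> y = antipode x"
proof -
  have "hdist x y = d \<longleftrightarrow> hdist x (antipode y) = 0" using hdist_antipode[OF assms] by auto
  also have "\<dots> \<longleftrightarrow> x = antipode y" using hdist_eq_0_iff[OF assms(1) antipode_cube[OF assms(2)]] .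
  also have "\<dots> \<longleftrightarrow> y = antipode x" using antipode_antipode assms by metis
  finally show ?thesis .
qed

lemma parcs_cube_iff:
  assumes "x \<in> pverts (hamming_graph d 2)" "y \<in> pverts (hamming_graph d 2)"
  shows "(x, y) \<in> parcs (hamming_graph d 2) \<longleftrightarrow> hdist x y = 1"
proof
  assume a: "(x, y) \<in> parcs (hamming_graph d 2)"
  then have "x \<noteq> y" using pair_graph_cube by (auto simp: pair_graph_iff irrefl_def)
  then show "hdist x y = 1"
    using is_distance_step[OF is_distance_cube assms(1,1) a] hdist_eq_0_iff[OF assms] hdist_eq_0_iff[OF assms(1,1)]
    by simp
next
  assume "hdist x y = 1"
  then obtain z where z: "(z, y) \<in> parcs (hamming_graph d 2)" "hdist x z = 0"
    using is_distance_pred[OF is_distance_cube assms, of 0] by auto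
  then have "z \<in> pverts (hamming_graph d 2)" using pair_graph_cube by (auto simp: pair_graph_iff)
  then show "(x, y) \<in> parcs (hamming_graph d 2)" using z hdist_eq_0_iff[OF assms(1)] by auto
qed

definition antipodal_class :: "nat list \<Rightarrow> nat list set" where
  "antipodal_class x = {x, antipode x}"

text \<open>Distance \<open>d\<close> means being antipodal, so the vertices of the quotient are the
  values of a class map defined on the whole cube.\<close>

lemma antipodal_quotient_eq:
  "pverts (antipodal_quotient_hypercube d) = antipodal_class ` pverts (hamming_graph d 2)"
  "parcs (antipodal_quotient_hypercube d) =
    {(P, Q). P \<in> pverts (antipodal_quotient_hypercube d) \<and> Q \<in> pverts (antipodal_quotient_hypercube d) \<and>
      P \<noteq> Q \<and> (\<exists>x\<in>P. \<exists>y\<in>Q. (x, y) \<in> parcs (hamming_graph d 2))}"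
proof -
  let ?V = "pverts (hamming_graph d 2)"
  have "{{x, y} |x y. x \<in> ?V \<and> y \<in> ?V \<and> gdist (hamming_graph d 2) x y = d} = antipodal_class ` ?V" (is "?L = ?R")
  proof (intro equalityI subsetI)
    fix P assume "P \<in> ?L"
    then obtain x y where "P = {x, y}" "x \<in> ?V" "y \<in> ?V" "gdist (hamming_graph d 2) x y = d" by auto
    then show "P \<in> ?R" using gdist_cube hdist_eq_dim_iff by (auto simp: antipodal_class_def)
  next
    fix P assume "P \<in> ?R"
    then obtain x where "P = {x, antipode x}" "x \<in> ?V" by (auto simp: antipodal_class_def)
    moreover from this have "antipode x \<in> ?V" "gdist (hamming_graph d 2) x (antipode x) = d"
      using antipode_cube gdist_cube hdist_eq_dim_iff by auto
    ultimately show "P \<in> ?L" by blast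
  qed
  note eq = this
  show "pverts (antipodal_quotient_hypercube d) = antipodal_class ` ?V"
    "parcs (antipodal_quotient_hypercube d) =
    {(P, Q). P \<in> pverts (antipodal_quotient_hypercube d) \<and> Q \<in> pverts (antipodal_quotient_hypercube d) \<and>
      P \<noteq> Q \<and> (\<exists>x\<in>P. \<exists>y\<in>Q. (x, y) \<in> parcs (hamming_graph d 2))}"
    unfolding antipodal_quotient_hypercube_def Let_def eq by simp_all
qed

lemma antipodal_class_eq_iff:
  assumes "x \<in> pverts (hamming_graph d 2)" "y \<in> pverts (hamming_graph d 2)"
  shows "antipodal_class x = antipodal_class y \<longleftrightarrow> y = x \<or> y = antipode x"
  using antipode_antipode assms unfolding antipodal_class_def by (auto simp: doubleton_eq_iff)

lemma hdist_antipode_both: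
  assumes "x \<in> pverts (hamming_graph d 2)" "y \<in> pverts (hamming_graph d 2)"
  shows "hdist (antipode x) (antipode y) = hdist x y" "hdist (antipode x) y = hdist x (antipode y)"
  using hdist_antipode[OF assms] hdist_antipode[OF antipode_cube[OF assms(1)] assms(2)]
    hdist_antipode[OF assms(2,1)]
  by (simp_all add: hdist_commute)

text \<open>Taking antipodes of both ends preserves Hamming distance; of the four possible edges
  between two classes only two need to be inspected.\<close>

lemma antipodal_quotient_arc_iff:
  assumes "x \<in> pverts (hamming_graph d 2)" "y \<in> pverts (hamming_graph d 2)"
  shows "(antipodal_class x, antipodal_class y) \<in> parcs (antipodal_quotient_hypercube d) \<longleftrightarrow>
    antipodal_class x \<noteq> antipodal_class y \<and> (hdist x y = 1 \<or> hdist x (antipode y) = 1)"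
proof -
  have "(\<exists>u\<in>antipodal_class x. \<exists>v\<in>antipodal_class y. (u, v) \<in> parcs (hamming_graph d 2)) \<longleftrightarrow>
      hdist x y = 1 \<or> hdist x (antipode y) = 1"
    using parcs_cube_iff assms antipode_cube hdist_antipode_both[OF assms] by (auto simp: antipodal_class_def)
  then show ?thesis unfolding antipodal_quotient_eq(2) using assms by (auto simp: antipodal_quotient_eq(1))
qed

lemma pair_graph_antipodal_quotient: "pair_graph (antipodal_quotient_hypercube d)"
proof -
  have "finite (pverts (antipodal_quotient_hypercube d))"
    using pair_graph_cube[of d] by (simp add: antipodal_quotient_eq(1) pair_graph_iff)
  moreover have "sym (parcs (antipodal_quotient_hypercube d))"
  proof (rule symI)
    fix P Q assume "(P, Q) \<in> parcs (antipodal_quotient_hypercube d)"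
    then show "(Q, P) \<in> parcs (antipodal_quotient_hypercube d)"
      unfolding antipodal_quotient_eq(2) using pair_graph_cube[of d, unfolded pair_graph_iff]
      by (clarsimp simp only: mem_Collect_eq prod.case) (metis symD)
  qed
  moreover have "irrefl (parcs (antipodal_quotient_hypercube d))"
    unfolding antipodal_quotient_eq(2) by (auto simp: irrefl_def)
  moreover have "parcs (antipodal_quotient_hypercube d) \<subseteq>
      pverts (antipodal_quotient_hypercube d) \<times> pverts (antipodal_quotient_hypercube d)"
    by (subst antipodal_quotient_eq(2)) auto
  ultimately show ?thesis by (simp add: pair_graph_iff)
qed

text \<open>The two neighbours of a vertex of the square are antipodal, so the projection is not
  injective on neighbourhoods. The quotient is handled directly, as a complete graph.\<close>

lemma distance_regular_antipodal_quotient_2: "distance_regular (antipodal_quotient_hypercube 2)"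
proof -
  let ?A = "antipodal_quotient_hypercube 2" and ?V = "pverts (hamming_graph 2 2)"
  have fin: "finite (pverts ?A)" using pair_graph_antipodal_quotient by (simp add: pair_graph_iff)
  have "(antipodal_class x, antipodal_class y) \<in> parcs ?A \<longleftrightarrow> antipodal_class x \<noteq> antipodal_class y"
    if V: "x \<in> ?V" "y \<in> ?V" for x y
  proof -
    have "hdist x y = 1" if "antipodal_class x \<noteq> antipodal_class y"
    proof -
      have "y \<noteq> x" "y \<noteq> antipode x" using that antipodal_class_eq_iff[OF V] by auto
      then have "hdist x y \<noteq> 0" "hdist x y \<noteq> 2"
        using hdist_eq_0_iff[OF V] hdist_eq_dim_iff[OF V] by auto
      moreover have "hdist x y \<le> 2" using hdist_antipode[OF V] by simp
      ultimately show ?thesis by simp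
    qed
    then show ?thesis using antipodal_quotient_arc_iff[OF V] by blast
  qed
  note arc = this
  have "(P, Q) \<in> parcs ?A \<longleftrightarrow> P \<in> pverts ?A \<and> Q \<in> pverts ?A \<and> P \<noteq> Q" for P Q
  proof (cases "P \<in> pverts ?A \<and> Q \<in> pverts ?A")
    case True
    then obtain x y where "x \<in> ?V" "P = antipodal_class x" "y \<in> ?V" "Q = antipodal_class y"
      unfolding antipodal_quotient_eq(1) by blast
    then show ?thesis using True arc by simp
  next
    case False
    then show ?thesis using pair_graph_antipodal_quotient[of 2] unfolding pair_graph_iff by blast
  qed
  then have "parcs ?A = {(P, Q). P \<in> pverts ?A \<and> Q \<in> pverts ?A \<and> P \<noteq> Q}"
    by (simp add: set_eq_iff split_paired_all)
  from complete_graph_iso[OF fin this] have iso: "is_isomorphic ?A (complete_graph (card (pverts ?A)))" .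
  have "[0, 0] \<in> ?V" "[0, 1] \<in> ?V" by (auto simp: pverts_cube)
  then have "{antipodal_class [0, 0], antipodal_class [0, 1]} \<subseteq> pverts ?A"
    by (auto simp: antipodal_quotient_eq(1))
  moreover have "antipodal_class [0, 0] \<noteq> antipodal_class [0, 1]"
    by (simp add: antipodal_class_def antipode_def doubleton_eq_iff)
  ultimately have "2 \<le> card (pverts ?A)"
    using card_mono[OF fin, of "{antipodal_class [0, 0], antipodal_class [0, 1]}"] by simp
  from linear_array_isomorphic_distance_regular[OF linear_array_complete[OF this] pair_graph_antipodal_quotient iso]
  show ?thesis .
qed

text \<open>Two neighbours of one vertex are at distance at most 2 < d, hence never antipodal: the
  projection is bijective on neighbourhoods. Counts in the quotient are counts in the cube, with the
  levels folded at half of \<open>d\<close>.\<close>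

lemma distance_regular_antipodal_quotient_ge3:
  assumes "d \<ge> 3"
  shows "distance_regular (antipodal_quotient_hypercube d)"
proof -
  let ?A = "antipodal_quotient_hypercube d" and ?H = "hamming_graph d 2"
  let ?V = "pverts ?H"
  define m where "m x y = min (hdist x y) (d - hdist x y)" for x y :: "nat list"
  \<comment> \<open>The arbitrary choice of representatives does no harm, since \<open>m\<close> is
    invariant under \<open>antipode\<close> in either argument.\<close>
  define D where "D P Q = m (SOME x. x \<in> P) (SOME y. y \<in> Q)" for P Q
  have m_anti: "m x (antipode y) = m x y" "m (antipode x) y = m x y" if "x \<in> ?V" "y \<in> ?V" for x y
    using hdist_antipode[OF that] hdist_antipode_both[OF that] by (auto simp: m_def)
  have some: "(SOME y. y \<in> antipodal_class x) = x \<or> (SOME y. y \<in> antipodal_class x) = antipode x" for x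
  proof -
    have "x \<in> antipodal_class x" by (simp add: antipodal_class_def)
    then have "(SOME y. y \<in> antipodal_class x) \<in> antipodal_class x" by (rule someI)
    then show ?thesis by (simp add: antipodal_class_def)
  qed
  have D: "D (antipodal_class x) (antipodal_class y) = m x y" if "x \<in> ?V" "y \<in> ?V" for x y
    using some[of x] some[of y] m_anti that antipode_cube[OF that(1)] antipode_cube[OF that(2)]
    unfolding D_def by (elim disjE) simp_all
  have cube_sub: "parcs ?H \<subseteq> ?V \<times> ?V" using pair_graph_cube by (simp add: pair_graph_iff)
  have cl_arc: "(antipodal_class y, antipodal_class z) \<in> parcs ?A" if "(y, z) \<in> parcs ?H" for y z
  proof -
    have V: "y \<in> ?V" "z \<in> ?V" using that cube_sub by auto
    have 1: "hdist y z = 1" using parcs_cube_iff[OF V] that by simp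
    then have "z \<noteq> y" "z \<noteq> antipode y"
      using hdist_eq_0_iff[OF V] hdist_eq_dim_iff[OF V] assms by auto
    then show ?thesis using antipodal_quotient_arc_iff[OF V] antipodal_class_eq_iff[OF V] 1 by simp
  qed
  have nbrs: "{Z. (antipodal_class y, Z) \<in> parcs ?A \<and> R Z} = antipodal_class ` {z. (y, z) \<in> parcs ?H \<and> R (antipodal_class z)}"
    if y: "y \<in> ?V" for y R
  proof (intro equalityI subsetI)
    fix Z assume Z: "Z \<in> {Z. (antipodal_class y, Z) \<in> parcs ?A \<and> R Z}"
    then obtain z where z: "z \<in> ?V" "Z = antipodal_class z"
      using pair_graph_antipodal_quotient[of d] by (auto simp: pair_graph_iff antipodal_quotient_eq(1))
    then have "hdist y z = 1 \<or> hdist y (antipode z) = 1" using antipodal_quotient_arc_iff[OF y z(1)] Z by auto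
    then have "(y, z) \<in> parcs ?H \<or> (y, antipode z) \<in> parcs ?H"
      using parcs_cube_iff[OF y] z(1) antipode_cube by blast
    moreover have "antipodal_class (antipode z) = antipodal_class z"
      using z(1) antipode_antipode by (auto simp: antipodal_class_def)
    ultimately show "Z \<in> antipodal_class ` {z. (y, z) \<in> parcs ?H \<and> R (antipodal_class z)}"
      using Z z(2) by (elim disjE) (auto intro: rev_image_eqI)
  qed (use cl_arc in auto)
  have inj: "inj_on antipodal_class {z. (y, z) \<in> parcs ?H}" if y: "y \<in> ?V" for y
  proof (rule inj_onI)
    fix z w assume zw: "z \<in> {z. (y, z) \<in> parcs ?H}" "w \<in> {z. (y, z) \<in> parcs ?H}" "antipodal_class z = antipodal_class w"
    then have V: "z \<in> ?V" "w \<in> ?V" using cube_sub by auto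
    have "hdist z y = 1" using zw(1) parcs_cube_iff[OF y V(1)] by (simp add: hdist_commute)
    then have "hdist z w \<le> 2" using is_distance_step[OF is_distance_cube V(1) y, of w] zw(2) by simp
    then have "w \<noteq> antipode z" using hdist_eq_dim_iff[OF V] assms by auto
    then show "z = w" using antipodal_class_eq_iff[OF V] zw(3) by auto
  qed
  have cnb: "card {Z. (antipodal_class y, Z) \<in> parcs ?A \<and> R Z} = card {z. (y, z) \<in> parcs ?H \<and> R (antipodal_class z)}"
    if y: "y \<in> ?V" for y R
    unfolding nbrs[OF y] by (intro card_image inj_on_subset[OF inj[OF y]]) auto
  \<comment> \<open>Every class has a representative in the half of the cube nearer to
    \<open>x\<close>, where \<open>m\<close> is Hamming distance itself.\<close>
  have rep: "\<exists>y'\<in>?V. antipodal_class y' = antipodal_class y \<and> hdist x y' \<le> d - hdist x y'" if "x \<in> ?V" "y \<in> ?V" for x y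
  proof (cases "hdist x y \<le> d - hdist x y")
    case True
    then show ?thesis using that by blast
  next
    case False
    then have "hdist x (antipode y) \<le> d - hdist x (antipode y)" using hdist_antipode[OF that] by linarith
    moreover have "antipodal_class (antipode y) = antipodal_class y"
      using that antipode_antipode by (auto simp: antipodal_class_def)
    ultimately show ?thesis using antipode_cube that(2) by blast
  qed
  \<comment> \<open>For q = 2 the linear array has a = 0, so every arc changes the level: the cube
    is bipartite.\<close>
  have step: "hdist x z = Suc (hdist x y) \<or> Suc (hdist x z) = hdist x y" if "x \<in> ?V" "(y, z) \<in> parcs ?H" for x y z
  proof -
    have V: "y \<in> ?V" "z \<in> ?V" "(z, y) \<in> parcs ?H"
      using that cube_sub pair_graph_cube[of d] by (auto simp: pair_graph_iff sym_def)
    have "card {z. (y, z) \<in> parcs ?H \<and> hdist x z = hdist x y} = 0" using cube_facts[of d] that(1) V(1) by simp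
    then have "{z. (y, z) \<in> parcs ?H \<and> hdist x z = hdist x y} = {}"
      using pair_graph_finite_nbrs[OF pair_graph_cube] by simp
    then have "hdist x z \<noteq> hdist x y" using that by blast
    then show ?thesis
      using is_distance_step[OF is_distance_cube that(1) V(1) that(2)] is_distance_step[OF is_distance_cube that(1) V(2,3)]
      by linarith
  qed
  have "is_distance ?A D"
    unfolding is_distance_def
  proof (intro ballI conjI allI impI)
    fix P Q assume "P \<in> pverts ?A" "Q \<in> pverts ?A"
    then obtain x y0 where x: "x \<in> ?V" "P = antipodal_class x" and y0: "y0 \<in> ?V" "Q = antipodal_class y0"
      by (auto simp: antipodal_quotient_eq(1))
    obtain y where y: "y \<in> ?V" "Q = antipodal_class y" "hdist x y \<le> d - hdist x y"
      using rep[OF x(1) y0(1)] y0(2) by auto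
    have Dxy: "D P Q = hdist x y" using D[OF x(1) y(1)] x y by (simp add: m_def)
    have le: "hdist x y \<le> d" using hdist_antipode[OF x(1) y(1)] by simp
    show "D P Q = 0 \<longleftrightarrow> P = Q"
    proof -
      have "y = antipode x \<Longrightarrow> hdist x y = d" using hdist_eq_dim_iff[OF x(1) y(1)] by simp
      then have "y = antipode x \<Longrightarrow> False" using y(3) assms by simp
      then show ?thesis
        using hdist_eq_0_iff[OF x(1) y(1)] antipodal_class_eq_iff[OF x(1) y(1)] x(2) y(2) Dxy by auto
    qed
    show "D P Z \<le> Suc (D P Q)" if Z: "(Q, Z) \<in> parcs ?A" for Z
    proof -
      obtain z where z: "(y, z) \<in> parcs ?H" "Z = antipodal_class z"
        using nbrs[OF y(1), of "\<lambda>_. True"] Z y(2) by auto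
      then have "z \<in> ?V" using cube_sub by auto
      then have "D P Z \<le> hdist x z" using D[OF x(1)] x(2) z(2) by (simp add: m_def)
      then show ?thesis using step[OF x(1) z(1)] Dxy by linarith
    qed
    show "\<exists>Z. (Z, Q) \<in> parcs ?A \<and> D P Z = n" if n: "D P Q = Suc n" for n
    proof -
      obtain z where z: "(z, y) \<in> parcs ?H" "hdist x z = n"
        using is_distance_pred[OF is_distance_cube x(1) y(1)] n Dxy by metis
      then have "z \<in> ?V" using cube_sub by auto
      then have "D P (antipodal_class z) = n" using D[OF x(1)] x(2) z(2) y(3) n Dxy by (simp add: m_def)
      then show ?thesis using cl_arc[OF z(1)] y(2) by blast
    qed
  qed
  moreover have "has_intersection_array ?A D (\<lambda>i. if 2 * i = d then d else i)
      (\<lambda>i. if 2 * i + 1 = d then d - i else 0) (\<lambda>i. if 2 * i + 1 < d then d - i else 0)"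
    unfolding has_intersection_array_def
  proof (intro ballI)
    fix P Q assume "P \<in> pverts ?A" "Q \<in> pverts ?A"
    then obtain x y0 where x: "x \<in> ?V" "P = antipodal_class x" and y0: "y0 \<in> ?V" "Q = antipodal_class y0"
      by (auto simp: antipodal_quotient_eq(1))
    obtain y where y: "y \<in> ?V" "Q = antipodal_class y" "hdist x y \<le> d - hdist x y"
      using rep[OF x(1) y0(1)] y0(2) by auto
    have Dxy: "D P Q = hdist x y" using D[OF x(1) y(1)] x y by (simp add: m_def)
    define i where "i = hdist x y"
    have i: "2 * i \<le> d" using y(3) hdist_antipode[OF x(1) y(1)] by (simp add: i_def)
    \<comment> \<open>An ascent from the middle is folded back: \<open>d - Suc i\<close> equals
      \<open>i\<close> if \<open>d = 2 * i + 1\<close>, and \<open>i - 1\<close> if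
      \<open>d = 2 * i\<close>.\<close>
    have DZ: "D P (antipodal_class z) = (if Suc (hdist x z) = i then hdist x z else if Suc (2 * i) < d then Suc i else d - Suc i)"
      if "(y, z) \<in> parcs ?H" for z
    proof -
      have "z \<in> ?V" using that cube_sub by auto
      then have "D P (antipodal_class z) = min (hdist x z) (d - hdist x z)" using D[OF x(1)] x(2) by (simp add: m_def)
      then show ?thesis using step[OF x(1) that] i i_def by auto
    qed
    have all: "card {z. (y, z) \<in> parcs ?H} = d" and lo: "card {z. (y, z) \<in> parcs ?H \<and> Suc (hdist x z) = i} = i"
      using cube_facts[of d] x(1) y(1) by (auto simp: i_def)
    have "{z. (y, z) \<in> parcs ?H \<and> hdist x z = Suc i} = {z. (y, z) \<in> parcs ?H} - {z. (y, z) \<in> parcs ?H \<and> Suc (hdist x z) = i}"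
      using step[OF x(1), of y] i_def by auto
    moreover have "finite {z. (y, z) \<in> parcs ?H}" using pair_graph_finite_nbrs[OF pair_graph_cube, of y _ "\<lambda>_. True"] by simp
    ultimately have hi: "card {z. (y, z) \<in> parcs ?H \<and> hdist x z = Suc i} = d - i"
      using all lo pair_graph_finite_nbrs[OF pair_graph_cube, of y d]
      by (simp add: card_Diff_subset Collect_mono)
    have cong: "card {Z. (Q, Z) \<in> parcs ?A \<and> R (D P Z)} = card {z. (y, z) \<in> parcs ?H \<and>
        R (if Suc (hdist x z) = i then hdist x z else if Suc (2 * i) < d then Suc i else d - Suc i)}" for R
    proof -
      have "{z. (y, z) \<in> parcs ?H \<and> R (D P (antipodal_class z))} = {z. (y, z) \<in> parcs ?H \<and>
        R (if Suc (hdist x z) = i then hdist x z else if Suc (2 * i) < d then Suc i else d - Suc i)}"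
        using DZ by auto
      then show ?thesis using cnb[OF y(1), of "\<lambda>Z. R (D P Z)"] y(2) by simp
    qed
    have st: "hdist x z = Suc i \<or> Suc (hdist x z) = i" if "(y, z) \<in> parcs ?H" for z
      using step[OF x(1) that] by (simp add: i_def)
    have lows: "card {z. (y, z) \<in> parcs ?H \<and> R (if Suc (hdist x z) = i then hdist x z else if Suc (2 * i) < d then Suc i else d - Suc i)}
       = (if R (i - 1) then i else 0) + (if R (if Suc (2 * i) < d then Suc i else d - Suc i) then d - i else 0)" for R
    proof -
      let ?w = "if Suc (2 * i) < d then Suc i else d - Suc i"
      have "{z. (y, z) \<in> parcs ?H \<and> R (if Suc (hdist x z) = i then hdist x z else ?w)} =
         (if R (i - 1) then {z. (y, z) \<in> parcs ?H \<and> Suc (hdist x z) = i} else {}) \<union>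
         (if R ?w then {z. (y, z) \<in> parcs ?H \<and> hdist x z = Suc i} else {})" (is "?S = ?L \<union> ?U")
      proof (rule Set.set_eqI)
        fix z
        consider "(y, z) \<notin> parcs ?H" | "(y, z) \<in> parcs ?H" "hdist x z = Suc i" | "(y, z) \<in> parcs ?H" "Suc (hdist x z) = i"
          using st[of z] by blast
        then show "z \<in> ?S \<longleftrightarrow> z \<in> ?L \<union> ?U"
        proof cases
          case 3
          then have "hdist x z = i - 1" "hdist x z \<noteq> Suc i" by auto
          with 3 show ?thesis by simp
        qed simp_all
      qed
      moreover have "card (?L \<union> ?U) = card ?L + card ?U"
        by (rule card_Un_disjoint) (auto intro: pair_graph_finite_nbrs[OF pair_graph_cube])
      ultimately show ?thesis using lo hi by simp
    qed
    have count: "card {Z. (Q, Z) \<in> parcs ?A \<and> R (D P Z)}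
       = (if R (i - 1) then i else 0) + (if R (if Suc (2 * i) < d then Suc i else d - Suc i) then d - i else 0)" for R
      using cong[of R] lows[of R] by simp
    have DPQ: "D P Q = i" using Dxy i_def by simp
    show "card {Z. (Q, Z) \<in> parcs ?A \<and> Suc (D P Z) = D P Q} = (if 2 * D P Q = d then d else D P Q) \<and>
      card {Z. (Q, Z) \<in> parcs ?A \<and> D P Z = D P Q} = (if 2 * D P Q + 1 = d then d - D P Q else 0) \<and>
      card {Z. (Q, Z) \<in> parcs ?A \<and> D P Z = Suc (D P Q)} = (if 2 * D P Q + 1 < d then d - D P Q else 0)"
      unfolding DPQ count[of "\<lambda>e. Suc e = i"] count[of "\<lambda>e. e = i"] count[of "\<lambda>e. e = Suc i"]
      using i assms by auto
  qed
  moreover have "pverts ?A \<noteq> {}" using cube_facts[of d] by (simp add: antipodal_quotient_eq(1))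
  ultimately show ?thesis unfolding distance_regular_iff[OF pair_graph_antipodal_quotient] by blast
qed

lemma distance_regular_antipodal_quotient:
  assumes "d \<ge> 2"
  shows "distance_regular (antipodal_quotient_hypercube d)"
  using assms distance_regular_antipodal_quotient_2 distance_regular_antipodal_quotient_ge3
  by (cases "d = 2") simp_all

section \<open>Embedding finite abelian groups\<close>

lemma Ints_cong_add: "a - b \<in> \<int> \<Longrightarrow> c - d \<in> \<int> \<Longrightarrow> (a + c) - (b + d) \<in> (\<int> :: real set)"
  using Ints_add[of "a - b" "c - d"] by (simp add: algebra_simps)

text \<open>The torus \<open>\<real>\<^sup>\<nat>/\<int>\<^sup>\<nat>\<close> is an abelian group of class \<^class>\<open>ab_group_add\<close> that contains every
  finite abelian group, so that Cayley graphs may be studied inside that class.\<close>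

quotient_type torus = "nat \<Rightarrow> real" / "\<lambda>f g. \<forall>i. f i - g i \<in> \<int>"
proof (rule equivpI)
  show "symp (\<lambda>f g :: nat \<Rightarrow> real. \<forall>i. f i - g i \<in> (\<int> :: real set))"
    by (rule sympI) (metis Ints_minus minus_diff_eq)
  show "transp (\<lambda>f g :: nat \<Rightarrow> real. \<forall>i. f i - g i \<in> (\<int> :: real set))"
  proof (rule transpI)
    fix f g h :: "nat \<Rightarrow> real"
    assume *: "\<forall>i. f i - g i \<in> \<int>" "\<forall>i. g i - h i \<in> \<int>"
    have "(f i - g i) + (g i - h i) \<in> \<int>" for i using * by (intro Ints_add) auto
    then show "\<forall>i. f i - h i \<in> \<int>" by simp
  qed
qed (simp add: reflp_def)

instantiation torus :: ab_group_add
begin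

lift_definition zero_torus :: torus is "\<lambda>_. 0" .

lift_definition plus_torus :: "torus \<Rightarrow> torus \<Rightarrow> torus" is "\<lambda>f g i. f i + g i"
  using Ints_cong_add by blast

lift_definition uminus_torus :: "torus \<Rightarrow> torus" is "\<lambda>f i. - f i"
  by (metis Ints_minus minus_diff_minus)

definition minus_torus :: "torus \<Rightarrow> torus \<Rightarrow> torus" where
  "minus_torus a b = a + - b"

instance
proof
  fix a b c :: torus
  show "a + b + c = a + (b + c)" by transfer (simp add: algebra_simps)
  show "a + b = b + a" by transfer (simp add: algebra_simps)
  show "0 + a = a" by transfer simp
  show "- a + a = 0" by transfer simp
  show "a - b = a + - b" by (rule minus_torus_def)
qed

end

text \<open>Phrased for real representatives: additive modulo the integers and with trivial kernel.
  For a subgroup \<open>H\<close> this becomes an injective homomorphism after passing to the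
  quotient.\<close>

definition torus_embedding :: "('a, 'b) monoid_scheme \<Rightarrow> 'a set \<Rightarrow> ('a \<Rightarrow> nat \<Rightarrow> real) \<Rightarrow> bool" where
  "torus_embedding G H f \<longleftrightarrow>
     (\<forall>x\<in>H. \<forall>y\<in>H. \<forall>i. f (x \<otimes>\<^bsub>G\<^esub> y) i - (f x i + f y i) \<in> \<int>) \<and>
     (\<forall>x\<in>H. (\<forall>i. f x i \<in> \<int>) \<longrightarrow> x = \<one>\<^bsub>G\<^esub>)"

text \<open>\<open>x\<close> is sent to an \<open>m\<close>-th root of the image of \<open>x\<^sup>m\<close>, where \<open>m\<close> is the order of \<open>x\<close> modulo \<open>H\<close>,
  and a fresh coordinate with value \<open>1/m\<close> keeps the map injective.\<close>

lemma (in comm_group) torus_embedding_extend: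
  assumes fin: "finite (carrier G)" and H: "subgroup H G" and f: "torus_embedding G H f"
    and x: "x \<in> carrier G" "x \<notin> H"
  shows "\<exists>K g. subgroup K G \<and> H \<subset> K \<and> torus_embedding G K g"
proof -
  define m where "m = (LEAST m :: nat. 0 < m \<and> x [^] m \<in> H)"
  have "0 < order G \<and> x [^] order G \<in> H"
    using order_gt_0_iff_finite fin pow_order_eq_1[OF x(1)] subgroup.one_closed[OF H] by simp
  then have m: "0 < m \<and> x [^] m \<in> H"
    unfolding m_def by (rule LeastI[of "\<lambda>m :: nat. 0 < m \<and> x [^] m \<in> H"])
  have m_min: "x [^] j \<notin> H" if "0 < j" "j < m" for j
    using not_less_Least[of j "\<lambda>m :: nat. 0 < m \<and> x [^] m \<in> H"] that unfolding m_def by blast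
  note Hc = subgroup.mem_carrier[OF H] and Hm = subgroup.m_closed[OF H] and Hi = subgroup.m_inv_closed[OF H]
  have uniq: "h = h' \<and> j = j'"
    if "h \<in> H" "h' \<in> H" "j < m" "j' < m" "h \<otimes> x [^] j = h' \<otimes> x [^] j'" for h h' and j j' :: nat
  proof -
    \<comment> \<open>Cancelling the smaller power puts \<open>x [^] (i' - i)\<close> into
      \<open>H\<close>; minimality of \<open>m\<close> then leaves only
      \<open>i = i'\<close>.\<close>
    have le: "i = i' \<and> h = h'" if "h \<in> H" "h' \<in> H" "i \<le> i'" "i' < m" "h \<otimes> x [^] i = h' \<otimes> x [^] i'" for h h' and i i' :: nat
    proof -
      have "x [^] i' = x [^] (i' - i) \<otimes> x [^] i" using x(1) that(3) by (simp add: nat_pow_mult)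
      then have "h \<otimes> x [^] i = (h' \<otimes> x [^] (i' - i)) \<otimes> x [^] i"
        using that x(1) Hc by (simp add: m_assoc)
      then have e: "h = h' \<otimes> x [^] (i' - i)" using that x(1) Hc by (simp only: right_cancel m_closed nat_pow_closed)
      then have "x [^] (i' - i) = inv h' \<otimes> h" using that x(1) Hc by (simp add: m_assoc[symmetric])
      then have "x [^] (i' - i) \<in> H" using Hm[OF Hi] that by simp
      then have "i' - i = 0" using m_min[of "i' - i"] that by linarith
      then show ?thesis using e that Hc by simp
    qed
    show ?thesis using le[of h h' j j'] le[of h' h j' j] that by (cases "j \<le> j'") auto
  qed
  define K where "K = {h \<otimes> x [^] j |h j. h \<in> H \<and> j < m}"
  have pow: "a [^] n \<in> H" if "a \<in> H" for a and n :: nat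
    using that Hm subgroup.one_closed[OF H] by (induction n) simp_all
  have K: "h \<otimes> x [^] j \<in> K" if "h \<in> H" for h and j :: nat
  proof -
    have "x [^] j = (x [^] m) [^] (j div m) \<otimes> x [^] (j mod m)"
      using x(1) by (simp add: nat_pow_pow nat_pow_mult)
    then have "h \<otimes> x [^] j = (h \<otimes> (x [^] m) [^] (j div m)) \<otimes> x [^] (j mod m)"
      using x(1) Hc[OF that] by (simp add: m_assoc)
    moreover have "h \<otimes> (x [^] m) [^] (j div m) \<in> H" using Hm[OF that pow] m by blast
    ultimately show ?thesis unfolding K_def using m by (auto intro: mod_less_divisor)
  qed
  have "subgroup K G"
  proof (rule subgroupI)
    show "K \<subseteq> carrier G" using Hc x(1) by (auto simp: K_def)
    show "K \<noteq> {}" using K[OF subgroup.one_closed[OF H]] by blast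
    fix a assume "a \<in> K"
    then obtain h j where a: "h \<in> H" "j < m" "a = h \<otimes> x [^] j" by (auto simp: K_def)
    have "x [^] m = x [^] (m - j) \<otimes> x [^] j" using x(1) a(2) by (simp add: nat_pow_mult)
    then have "((inv h \<otimes> inv (x [^] m)) \<otimes> x [^] (m - j)) \<otimes> a = \<one>"
      using a Hc x(1) by (simp add: inv_mult m_ac)
    then have "inv a = (inv h \<otimes> inv (x [^] m)) \<otimes> x [^] (m - j)"
      using a Hc x(1) by (intro inv_equality) auto
    then show "inv a \<in> K" using K[of "inv h \<otimes> inv (x [^] m)" "m - j"] Hm Hi conjunct2[OF m] a(1) by simp
    fix b assume "b \<in> K"
    then obtain h' j' where b: "h' \<in> H" "j' < m" "b = h' \<otimes> x [^] j'" by (auto simp: K_def)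
    have "a \<otimes> b = (h \<otimes> h') \<otimes> x [^] (j + j')" using a b Hc x(1) by (simp add: m_ac nat_pow_mult[symmetric])
    then show "a \<otimes> b \<in> K" using K Hm a b by simp
  qed
  moreover have "H \<subset> K"
  proof -
    have "h \<in> K" if "h \<in> H" for h using K[OF that, of 0] Hc[OF that] by simp
    moreover have "x \<in> K" using K[OF subgroup.one_closed[OF H], of 1] x(1) by simp
    ultimately show ?thesis using x(2) by blast
  qed
  moreover have "\<exists>g. torus_embedding G K g"
  proof -
    have "\<exists>hj. \<forall>k\<in>K. fst (hj k) \<in> H \<and> snd (hj k) < m \<and> k = fst (hj k) \<otimes> x [^] (snd (hj k) :: nat)"
      by (rule bchoice) (auto simp: K_def)
    then obtain hj where hj: "\<And>k. k \<in> K \<Longrightarrow> fst (hj k) \<in> H \<and> snd (hj k) < m \<and> k = fst (hj k) \<otimes> x [^] (snd (hj k) :: nat)"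
      by blast
    have hj_eq: "hj (h \<otimes> x [^] j) = (h, j)" if "h \<in> H" "j < m" for h j
      using uniq[of "fst (hj (h \<otimes> x [^] j))" h "snd (hj (h \<otimes> x [^] j))" j] hj[OF K[OF that(1), of j]] that
      by (simp add: prod_eq_iff)
    define g where "g k i = (case i of 0 \<Rightarrow> real (snd (hj k)) / m
      | Suc n \<Rightarrow> f (fst (hj k)) n + real (snd (hj k)) * (f (x [^] m) n / m))" for k i
    have fadd: "f (a \<otimes> b) i - (f a i + f b i) \<in> \<int>" if "a \<in> H" "b \<in> H" for a b i
      using f that unfolding torus_embedding_def by blast
    have "g (k \<otimes> l) i - (g k i + g l i) \<in> \<int>" if kl: "k \<in> K" "l \<in> K" for k l i
    proof -
      obtain h j h' j' where k: "h \<in> H" "j < m" "k = h \<otimes> x [^] j" "hj k = (h, j)"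
        and l: "h' \<in> H" "j' < m" "l = h' \<otimes> x [^] j'" "hj l = (h', j')"
        using hj[OF kl(1)] hj[OF kl(2)] by (metis prod.collapse)
      have mult: "k \<otimes> l = (h \<otimes> h') \<otimes> x [^] (j + j')" using k l Hc x(1) by (simp add: m_ac nat_pow_mult[symmetric])
      show ?thesis
      proof (cases "j + j' < m")
        case True
        then have "hj (k \<otimes> l) = (h \<otimes> h', j + j')" using mult hj_eq Hm k l by simp
        then show ?thesis using fadd[OF k(1) l(1)] k l
          by (cases i) (auto simp: g_def algebra_simps add_divide_distrib)
      next
        case False
        \<comment> \<open>The exponents overflow: \<open>x [^] m\<close> is absorbed by the part
          from \<open>H\<close>, and the fresh coordinate is off by exactly -1, an integer.\<close>
        have kl': "k \<otimes> l = (h \<otimes> h' \<otimes> x [^] m) \<otimes> x [^] (j + j' - m)"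
          using mult False x(1) Hc k l by (simp add: m_assoc nat_pow_mult)
        define d where "d = j + j' - m"
        have e: "hj (k \<otimes> l) = (h \<otimes> h' \<otimes> x [^] m, d)" unfolding kl' d_def using hj_eq[of "h \<otimes> h' \<otimes> x [^] m" "j + j' - m"] Hm k(1,2) l(1,2) m False by simp
        have r: "real j = real m + real d - real j'" using False by (simp add: d_def)
        show ?thesis
        proof (cases i)
          case 0
          have "g (k \<otimes> l) i - (g k i + g l i) = -1"
            using conjunct1[OF m] by (simp add: g_def 0 e k(4) l(4) r field_simps)
          then show ?thesis by simp
        next
          case (Suc n)
          have "g (k \<otimes> l) i - (g k i + g l i) = (f (h \<otimes> h' \<otimes> x [^] m) n - (f (h \<otimes> h') n + f (x [^] m) n))
              + (f (h \<otimes> h') n - (f h n + f h' n))"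
            using conjunct1[OF m] by (simp add: g_def Suc e k(4) l(4) r field_simps)
          then show ?thesis using Ints_add[OF fadd[OF Hm[OF k(1) l(1)] conjunct2[OF m]] fadd[OF k(1) l(1)]] by (simp only:)
        qed
      qed
    qed
    moreover have "k = \<one>" if k: "k \<in> K" "\<forall>i. g k i \<in> \<int>" for k
    proof -
      obtain z where z: "real (snd (hj k)) / m = of_int z" using k(2)[rule_format, of 0] by (auto simp: g_def Ints_def)
      have j: "snd (hj k) < m" using hj[OF k(1)] by simp
      have "0 \<le> real (snd (hj k)) / m" "real (snd (hj k)) / m < 1" using j by simp_all
      then have "z = 0" unfolding z by linarith
      then have "snd (hj k) = 0" using z conjunct1[OF m] by simp
      moreover have "f (fst (hj k)) n \<in> \<int>" for n using k(2)[rule_format, of "Suc n"] calculation by (simp add: g_def)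
      then have "fst (hj k) = \<one>" using f hj[OF k(1)] unfolding torus_embedding_def by blast
      ultimately show ?thesis using hj[OF k(1)] by simp
    qed
    ultimately show ?thesis unfolding torus_embedding_def by blast
  qed
  ultimately show ?thesis by blast
qed

text \<open>Among the subgroups that embed, starting from the trivial one, a maximal one exists by
  finiteness, and the extension step shows that it is the whole group.\<close>

theorem (in comm_group) finite_embeds_torus:
  assumes fin: "finite (carrier G)"
  shows "\<exists>\<phi> :: 'a \<Rightarrow> torus. inj_on \<phi> (carrier G) \<and> (\<forall>x\<in>carrier G. \<forall>y\<in>carrier G. \<phi> (x \<otimes> y) = \<phi> x + \<phi> y)"
proof -
  define F where "F = {H. subgroup H G \<and> (\<exists>f. torus_embedding G H f)}"
  have "F \<subseteq> Pow (carrier G)" using subgroup.subset by (auto simp: F_def)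
  then have "finite F" using fin finite_subset by blast
  moreover have "{\<one>} \<in> F" using triv_subgroup by (auto simp: F_def torus_embedding_def intro!: exI[of _ "\<lambda>_ _. 0"])
  ultimately obtain H where H: "H \<in> F" "\<And>K. K \<in> F \<Longrightarrow> H \<subseteq> K \<Longrightarrow> K = H"
    using finite_has_maximal[of F] by (metis empty_iff)
  then obtain f where f: "subgroup H G" "torus_embedding G H f" by (auto simp: F_def)
  have "H = carrier G"
  proof (rule ccontr)
    assume "H \<noteq> carrier G"
    then obtain x where "x \<in> carrier G" "x \<notin> H" using subgroup.subset[OF f(1)] by blast
    then obtain K g where "subgroup K G" "H \<subset> K" "torus_embedding G K g"
      using torus_embedding_extend[OF fin f] by blast
    then show False using H(2)[of K] by (auto simp: F_def)
  qed
  define \<phi> where "\<phi> x = abs_torus (f x)" for x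
  have add: "\<phi> (x \<otimes> y) = \<phi> x + \<phi> y" if "x \<in> carrier G" "y \<in> carrier G" for x y
    using f(2) that unfolding \<phi>_def plus_torus.abs_eq torus.abs_eq_iff torus_embedding_def \<open>H = carrier G\<close> by blast
  have zero: "x = \<one>" if "x \<in> carrier G" "\<phi> x = 0" for x
  proof -
    have "\<forall>i. f x i \<in> \<int>" using that(2) unfolding \<phi>_def zero_torus_def torus.abs_eq_iff by simp
    then show ?thesis using f(2) that(1) unfolding torus_embedding_def \<open>H = carrier G\<close> by blast
  qed
  have "inj_on \<phi> (carrier G)"
  proof (rule inj_onI)
    fix x y assume xy: "x \<in> carrier G" "y \<in> carrier G" "\<phi> x = \<phi> y"
    have "\<phi> (x \<otimes> inv y) + \<phi> y = \<phi> x" using xy add[of "x \<otimes> inv y" y] by (simp add: m_assoc)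
    then have "x \<otimes> inv y = \<one>" using zero[of "x \<otimes> inv y"] xy by simp
    moreover have "x = (x \<otimes> inv y) \<otimes> y" using xy by (simp add: m_assoc)
    ultimately show "x = y" using xy by simp
  qed
  then show ?thesis using add by blast
qed

section \<open>Cayley graphs of abelian groups\<close>

text \<open>As a set of sums this is a submonoid. It is a subgroup under the assumptions of
  \<open>cayley\<close>, where \<open>S\<close> is closed under minus.\<close>

definition gen :: "'g::ab_group_add set \<Rightarrow> 'g set" where
  "gen S = {sum_list xs |xs. set xs \<subseteq> S}"

text \<open>The distance from 0 in the Cayley graph; meaningful on \<open>gen S\<close>
  only.\<close>

definition wlen :: "'g::ab_group_add set \<Rightarrow> 'g \<Rightarrow> nat" where
  "wlen S x = (LEAST n. \<exists>xs. set xs \<subseteq> S \<and> length xs = n \<and> sum_list xs = x)"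

definition cay :: "'g::ab_group_add set \<Rightarrow> 'g pair_pre_digraph" where
  "cay S = \<lparr>pverts = gen S, parcs = {(x, y). x \<in> gen S \<and> y \<in> gen S \<and> y - x \<in> S}\<rparr>"

text \<open>\<open>dn S x\<close>, \<open>lv S x\<close> and \<open>up S x\<close> are the numbers \<open>c\<^sub>i\<close>, \<open>a\<^sub>i\<close> and \<open>b\<^sub>i\<close> of the pair \<open>(0, x)\<close>.\<close>

definition dn :: "'g::ab_group_add set \<Rightarrow> 'g \<Rightarrow> nat" where
  "dn S x = card {s \<in> S. Suc (wlen S (x + s)) = wlen S x}"

definition lv :: "'g::ab_group_add set \<Rightarrow> 'g \<Rightarrow> nat" where
  "lv S x = card {s \<in> S. wlen S (x + s) = wlen S x}"

definition up :: "'g::ab_group_add set \<Rightarrow> 'g \<Rightarrow> nat" where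
  "up S x = card {s \<in> S. wlen S (x + s) = Suc (wlen S x)}"

text \<open>The number of common neighbours of 0 and \<open>x\<close> when \<open>S\<close> is
  closed under minus: a_1 for \<open>x\<close> in \<open>S\<close>, and c_2 for \<open>x\<close> at
  distance 2.\<close>

definition sols :: "'g::ab_group_add set \<Rightarrow> 'g \<Rightarrow> nat" where
  "sols S x = card {u \<in> S. x - u \<in> S}"

definition linear_cay :: "nat \<Rightarrow> 'g::ab_group_add set \<Rightarrow> bool" where
  "linear_cay q S \<longleftrightarrow> (\<forall>x\<in>gen S. dn S x = wlen S x \<and> lv S x = (q - 2) * wlen S x)"

section \<open>Generated subgroups and word length\<close>

lemma gen_0: "0 \<in> gen S"
  unfolding gen_def by (rule CollectI, rule exI[of _ "[]"]) simp

lemma gen_base: "x \<in> S \<Longrightarrow> x \<in> gen S"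
  unfolding gen_def by (rule CollectI, rule exI[of _ "[x]"]) simp

lemma gen_add: "x \<in> gen S \<Longrightarrow> y \<in> gen S \<Longrightarrow> x + y \<in> gen S"
proof -
  assume "x \<in> gen S" "y \<in> gen S"
  then obtain xs ys where "set xs \<subseteq> S" "x = sum_list xs" "set ys \<subseteq> S" "y = sum_list ys"
    by (auto simp: gen_def)
  then show ?thesis unfolding gen_def by (intro CollectI exI[of _ "xs @ ys"]) simp
qed

lemma gen_add_base: "x \<in> gen S \<Longrightarrow> s \<in> S \<Longrightarrow> x + s \<in> gen S"
  by (rule gen_add) (simp_all add: gen_base)

lemma gen_minimal:
  assumes "0 \<in> A" "\<And>x s. x \<in> A \<Longrightarrow> s \<in> S \<Longrightarrow> s + x \<in> A"
  shows "gen S \<subseteq> A"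
proof
  fix x assume "x \<in> gen S"
  then obtain xs where "set xs \<subseteq> S" "x = sum_list xs" by (auto simp: gen_def)
  then show "x \<in> A" by (induction xs arbitrary: x) (use assms in auto)
qed

lemma gen_subset: "S \<subseteq> gen T \<Longrightarrow> gen S \<subseteq> gen T"
  by (rule gen_minimal) (auto intro: gen_0 gen_add)

lemma gen_mono: "S \<subseteq> T \<Longrightarrow> gen S \<subseteq> gen T"
  by (rule gen_subset) (auto intro: gen_base)

lemma wlen_le: "set xs \<subseteq> S \<Longrightarrow> wlen S (sum_list xs) \<le> length xs"
  unfolding wlen_def by (rule Least_le) blast

lemma wlen_witness:
  assumes "x \<in> gen S"
  obtains xs where "set xs \<subseteq> S" "length xs = wlen S x" "sum_list xs = x"
proof -
  have "\<exists>n xs. set xs \<subseteq> S \<and> length xs = n \<and> sum_list xs = x" using assms by (auto simp: gen_def)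
  then have "\<exists>xs. set xs \<subseteq> S \<and> length xs = wlen S x \<and> sum_list xs = x"
    unfolding wlen_def by (rule LeastI_ex)
  then show ?thesis using that by blast
qed

lemma wlen_0: "wlen S 0 = 0"
  using wlen_le[of "[]" S] by simp

lemma wlen_eq_0_iff: "x \<in> gen S \<Longrightarrow> wlen S x = 0 \<longleftrightarrow> x = 0"
  using wlen_0[of S] by (metis wlen_witness length_0_conv sum_list.Nil)

lemma wlen_add: 
  assumes "x \<in> gen S" "y \<in> gen S"
  shows "wlen S (x + y) \<le> wlen S x + wlen S y"
proof -
  obtain xs where xs: "set xs \<subseteq> S" "length xs = wlen S x" "sum_list xs = x" using wlen_witness assms(1) .
  obtain ys where ys: "set ys \<subseteq> S" "length ys = wlen S y" "sum_list ys = y" using wlen_witness assms(2) .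
  show ?thesis using wlen_le[of "xs @ ys" S] xs ys by simp
qed

lemma wlen_le_1: "x \<in> S \<Longrightarrow> wlen S x \<le> 1"
  using wlen_le[of "[x]" S] by simp

text \<open>Finiteness is required of the generated subgroup, because the ambient type, such as
  \<open>torus\<close>, may be infinite.\<close>

locale cayley =
  fixes S :: "'g::ab_group_add set"
  assumes finite_gen: "finite (gen S)" and zero_notin: "0 \<notin> S" and minus_in: "x \<in> S \<Longrightarrow> - x \<in> S"
begin

lemma finite_S: "finite S"
  using finite_gen by (rule rev_finite_subset) (auto intro: gen_base)

lemma minus_in_iff: "- x \<in> S \<longleftrightarrow> x \<in> S"
  using minus_in[of x] minus_in[of "- x"] by auto

lemma minus_diff_in_iff: "x - y \<in> S \<longleftrightarrow> y - x \<in> S"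
  using minus_in_iff[of "x - y"] by simp

lemma sum_list_uminus: "sum_list (map uminus xs) = - sum_list (xs :: 'g list)"
  by (induction xs) simp_all

lemma gen_minus: "x \<in> gen S \<Longrightarrow> - x \<in> gen S"
proof -
  assume "x \<in> gen S"
  then obtain xs where "set xs \<subseteq> S" "x = sum_list xs" by (auto simp: gen_def)
  then show ?thesis unfolding gen_def
    by (intro CollectI exI[of _ "map uminus xs"]) (auto simp: sum_list_uminus minus_in)
qed

lemma gen_diff: "x \<in> gen S \<Longrightarrow> y \<in> gen S \<Longrightarrow> x - y \<in> gen S"
  using gen_add[of x S "- y"] gen_minus[of y] by simp

lemma gen_add_iff: "y \<in> gen S \<Longrightarrow> x + y \<in> gen S \<longleftrightarrow> x \<in> gen S"
  using gen_add[of x S y] gen_diff[of "x + y" y] by auto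

lemma gen_minus_iff: "- x \<in> gen S \<longleftrightarrow> x \<in> gen S"
  using gen_minus[of x] gen_minus[of "- x"] by auto

lemma wlen_minus: 
  assumes "x \<in> gen S" shows "wlen S (- x) = wlen S x"
proof -
  have le: "wlen S (- x) \<le> wlen S x" if "x \<in> gen S" for x
  proof -
    obtain xs where xs: "set xs \<subseteq> S" "length xs = wlen S x" "sum_list xs = x" using wlen_witness \<open>x \<in> gen S\<close> .
    then have "set (map uminus xs) \<subseteq> S" using minus_in by auto
    from wlen_le[OF this] xs show ?thesis by (simp add: sum_list_uminus)
  qed
  show ?thesis using le[OF assms] le[OF gen_minus[OF assms]] by simp
qed

lemma wlen_S: "x \<in> S \<Longrightarrow> wlen S x = 1"
  using wlen_le_1[of x S] wlen_eq_0_iff[OF gen_base, of x S] zero_notin by (cases "wlen S x") auto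

lemma wlen_step: 
  assumes "x \<in> gen S" "s \<in> S"
  shows "wlen S (x + s) \<le> Suc (wlen S x)" "wlen S x \<le> Suc (wlen S (x + s))"
proof -
  show "wlen S (x + s) \<le> Suc (wlen S x)"
    using wlen_add[OF assms(1) gen_base[OF assms(2)]] wlen_S[OF assms(2)] by simp
  show "wlen S x \<le> Suc (wlen S (x + s))"
    using wlen_add[OF gen_add[OF assms(1) gen_base[OF assms(2)]] gen_base[OF minus_in[OF assms(2)]]]
      wlen_S[OF minus_in[OF assms(2)]] by simp
qed

lemma wlen_pred:
  assumes "x \<in> gen S" "wlen S x = Suc n"
  obtains s where "s \<in> S" "wlen S (x + s) = n"
proof -
  obtain xs where xs: "set xs \<subseteq> S" "length xs = Suc n" "sum_list xs = x" using wlen_witness assms by metis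
  then obtain t ys where t: "xs = t # ys" by (cases xs) auto
  have "x + - t = sum_list ys" using xs t by auto
  then have "wlen S (x + - t) \<le> n" using wlen_le[of ys S] xs t by simp
  moreover have "- t \<in> S" using xs t minus_in by simp
  ultimately show ?thesis using that[of "- t"] wlen_step(2)[OF assms(1), of "- t"] assms(2) by simp
qed

lemma wlen_eq_1_iff: "x \<in> gen S \<Longrightarrow> wlen S x = 1 \<longleftrightarrow> x \<in> S"
proof
  assume x: "x \<in> gen S" "wlen S x = 1"
  obtain xs where xs: "set xs \<subseteq> S" "length xs = Suc 0" "sum_list xs = x" using wlen_witness[OF x(1)] x(2) by auto
  then show "x \<in> S" by (cases xs) auto
qed (rule wlen_S)

text \<open>Cutting a shortest word after \<open>j\<close> letters leaves two shortest words, by the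
  triangle inequality.\<close>

lemma wlen_geodesic:
  assumes "x \<in> gen S" "j \<le> wlen S x"
  obtains h where "h \<in> gen S" "wlen S h = j" "wlen S (x - h) = wlen S x - j"
proof -
  obtain xs where xs: "set xs \<subseteq> S" "length xs = wlen S x" "sum_list xs = x" using wlen_witness assms(1) .
  let ?h = "sum_list (take j xs)"
  have h: "?h \<in> gen S" using xs(1) set_take_subset[of j xs] by (auto simp: gen_def)
  have x: "?h + sum_list (drop j xs) = x" using xs(3) by (metis append_take_drop_id sum_list_append)
  then have xh: "x - ?h = sum_list (drop j xs)" by (metis add_diff_cancel_left')
  have "wlen S ?h \<le> j" using wlen_le[of "take j xs" S] xs set_take_subset[of j xs] assms(2) by simp
  moreover have "wlen S (x - ?h) \<le> wlen S x - j"
    using wlen_le[of "drop j xs" S] xs set_drop_subset[of j xs] xh by simp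
  moreover have "wlen S x \<le> wlen S ?h + wlen S (x - ?h)"
    using wlen_add[OF h gen_diff[OF assms(1) h]] by simp
  ultimately show ?thesis using that[OF h] assms(2) by simp
qed

lemma up_eq:
  assumes "x \<in> gen S"
  shows "dn S x + lv S x + up S x = card S"
proof -
  have "s \<in> S \<Longrightarrow> wlen S (x + s) = Suc (wlen S x) \<or> Suc (wlen S (x + s)) = wlen S x \<or> wlen S (x + s) = wlen S x" for s
    using wlen_step[OF assms, of s] by linarith
  then have eq: "S = {s \<in> S. Suc (wlen S (x + s)) = wlen S x} \<union> ({s \<in> S. wlen S (x + s) = wlen S x}
      \<union> {s \<in> S. wlen S (x + s) = Suc (wlen S x)})" (is "_ = ?A \<union> (?B \<union> ?C)") by blast
  have "card S = card (?A \<union> (?B \<union> ?C))" using eq by simp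
  also have "\<dots> = card ?A + card (?B \<union> ?C)"
    by (rule card_Un_disjoint) (use finite_S in auto)
  also have "card (?B \<union> ?C) = card ?B + card ?C"
    by (rule card_Un_disjoint) (use finite_S in auto)
  finally show ?thesis by (simp add: dn_def lv_def up_def)
qed

lemma wlen_eq_2I: "u \<in> S \<Longrightarrow> x - u \<in> S \<Longrightarrow> x \<noteq> 0 \<Longrightarrow> x \<notin> S \<Longrightarrow> wlen S x = 2"
proof -
  assume a: "u \<in> S" "x - u \<in> S" "x \<noteq> 0" "x \<notin> S"
  have x: "x \<in> gen S" using gen_add[OF gen_base[OF a(1)] gen_base[OF a(2)]] by simp
  have "wlen S x \<le> 2" using wlen_le[of "[u, x - u]" S] a by simp
  moreover have "wlen S x \<noteq> 0" "wlen S x \<noteq> 1" using wlen_eq_0_iff[OF x] wlen_eq_1_iff[OF x] a by auto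
  ultimately show ?thesis by linarith
qed

lemma sols_eq: "sols S x = card {s \<in> S. x + s \<in> S}"
proof -
  have "{s \<in> S. x + s \<in> S} = uminus ` {u \<in> S. x - u \<in> S}"
  proof (intro equalityI subsetI)
    fix s assume "s \<in> {s \<in> S. x + s \<in> S}"
    then have "- s \<in> {u \<in> S. x - u \<in> S}" "s = - (- s)" using minus_in by auto
    then show "s \<in> uminus ` {u \<in> S. x - u \<in> S}" by blast
  qed (use minus_in in auto)
  then show ?thesis unfolding sols_def by (simp add: card_image)
qed

lemma lv_S: "x \<in> S \<Longrightarrow> lv S x = sols S x"
proof -
  assume x: "x \<in> S"
  have "{s \<in> S. wlen S (x + s) = 1} = {s \<in> S. x + s \<in> S}"
    using wlen_eq_1_iff[OF gen_add[OF gen_base[OF x] gen_base]] by blast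
  then show ?thesis using wlen_S[OF x] by (simp add: lv_def sols_eq)
qed

lemma dn_2: "x \<in> gen S \<Longrightarrow> wlen S x = 2 \<Longrightarrow> dn S x = sols S x"
proof -
  assume x: "x \<in> gen S" "wlen S x = 2"
  have "{s \<in> S. Suc (wlen S (x + s)) = 2} = {s \<in> S. x + s \<in> S}"
    using wlen_eq_1_iff[OF gen_add[OF x(1) gen_base]] by auto
  then show ?thesis using x(2) by (simp add: dn_def sols_eq)
qed

lemma pair_graph_cay: "pair_graph (cay S)"
  unfolding pair_graph_iff cay_def sym_def irrefl_def
  using finite_gen zero_notin minus_diff_in_iff by auto

lemma is_distance_cay: "is_distance (cay S) (\<lambda>x y. wlen S (y - x))"
  unfolding is_distance_def
proof (intro ballI conjI allI impI)
  fix x y assume "x \<in> pverts (cay S)" "y \<in> pverts (cay S)"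
  then have xy: "x \<in> gen S" "y \<in> gen S" "y - x \<in> gen S" using gen_diff by (auto simp: cay_def)
  show "wlen S (y - x) = 0 \<longleftrightarrow> x = y" using wlen_eq_0_iff[OF xy(3)] by auto
  show "wlen S (z - x) \<le> Suc (wlen S (y - x))" if "(y, z) \<in> parcs (cay S)" for z
    using wlen_step(1)[OF xy(3), of "z - y"] that by (simp add: cay_def)
  show "\<exists>z. (z, y) \<in> parcs (cay S) \<and> wlen S (z - x) = n" if n: "wlen S (y - x) = Suc n" for n
  proof -
    obtain s where s: "s \<in> S" "wlen S (y - x + s) = n" using wlen_pred[OF xy(3) n] .
    have "(y + s, y) \<in> parcs (cay S)" using s xy gen_add[OF xy(2) gen_base[OF s(1)]] minus_in[OF s(1)] by (simp add: cay_def)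
    moreover have "y + s - x = y - x + s" by simp
    ultimately show ?thesis using s(2) by metis
  qed
qed

lemma card_cay_nbrs:
  assumes "y \<in> gen S"
  shows "card {z. (y, z) \<in> parcs (cay S) \<and> P (wlen S z)} = card {s \<in> S. P (wlen S (y + s))}"
proof -
  have "{z. (y, z) \<in> parcs (cay S) \<and> P (wlen S z)} = (\<lambda>s. y + s) ` {s \<in> S. P (wlen S (y + s))}"
  proof (intro equalityI subsetI)
    fix z assume "z \<in> {z. (y, z) \<in> parcs (cay S) \<and> P (wlen S z)}"
    then have "z - y \<in> {s \<in> S. P (wlen S (y + s))}" "z = y + (z - y)" by (auto simp: cay_def)
    then show "z \<in> (\<lambda>s. y + s) ` {s \<in> S. P (wlen S (y + s))}" by blast
  qed (use assms gen_add_base in \<open>auto simp: cay_def\<close>)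
  then show ?thesis by (simp add: card_image)
qed

text \<open>The array is read off at the base point 0, where uniqueness of distances makes
  \<open>D\<close> equal to word length.\<close>

lemma distance_regular_cay_imp:
  assumes "distance_regular (cay S)"
  obtains c a where "\<And>x. x \<in> gen S \<Longrightarrow> dn S x = c (wlen S x) \<and> lv S x = a (wlen S x)"
proof -
  obtain D c a b where D: "is_distance (cay S) D" "has_intersection_array (cay S) D c a b"
    using assms distance_regular_iff[OF pair_graph_cay] by blast
  interpret C: pair_graph "cay S" by (rule pair_graph_cay)
  have V: "pverts (cay S) = gen S" by (simp add: cay_def)
  have Deq: "D 0 y = wlen S y" if "y \<in> gen S" for y
    using C.gdist_eqI[OF D(1), of 0 y] C.gdist_eqI[OF is_distance_cay, of 0 y] that gen_0[of S] V by simp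
  have nb: "{z. (y, z) \<in> parcs (cay S) \<and> P (D 0 z)} = {z. (y, z) \<in> parcs (cay S) \<and> P (wlen S z)}" for y P
    using Deq by (auto simp: cay_def)
  have "dn S y = c (wlen S y) \<and> lv S y = a (wlen S y)" if y: "y \<in> gen S" for y
  proof -
    have "card {z. (y, z) \<in> parcs (cay S) \<and> Suc (D 0 z) = D 0 y} = c (D 0 y)"
      "card {z. (y, z) \<in> parcs (cay S) \<and> D 0 z = D 0 y} = a (D 0 y)"
      using D(2)[unfolded has_intersection_array_def V, rule_format, OF gen_0 y] by simp_all
    then show ?thesis
      using nb[of y "\<lambda>d. Suc d = wlen S y"] nb[of y "\<lambda>d. d = wlen S y"]
        card_cay_nbrs[OF y, of "\<lambda>d. Suc d = wlen S y"] card_cay_nbrs[OF y, of "\<lambda>d. d = wlen S y"]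
      by (simp add: Deq[OF y] dn_def lv_def)
  qed
  then show ?thesis by (rule that)
qed

end

section \<open>Recognition of Hamming and Doob graphs\<close>

context cayley
begin

text \<open>Double counting of the arcs between two consecutive levels: reversing the arc
  \<open>(x, s)\<close> gives \<open>(x + s, - s)\<close>.\<close>

lemma card_layers:
  assumes "\<And>x. x \<in> gen S \<Longrightarrow> wlen S x = i \<Longrightarrow> up S x = b"
    and "\<And>x. x \<in> gen S \<Longrightarrow> wlen S x = Suc i \<Longrightarrow> dn S x = c"
  shows "card {x \<in> gen S. wlen S x = i} * b = card {x \<in> gen S. wlen S x = Suc i} * c"
proof -
  let ?X = "SIGMA x : {x \<in> gen S. wlen S x = i}. {s \<in> S. wlen S (x + s) = Suc (wlen S x)}"
  let ?Y = "SIGMA x : {x \<in> gen S. wlen S x = Suc i}. {s \<in> S. Suc (wlen S (x + s)) = wlen S x}"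
  have "card ?X = card ?Y"
  proof (rule bij_betw_same_card[of "\<lambda>(x, s). (x + s, - s)"], rule bij_betw_imageI)
    show "inj_on (\<lambda>(x, s). (x + s, - s)) ?X" by (auto simp: inj_on_def)
    show "(\<lambda>(x, s). (x + s, - s)) ` ?X = ?Y"
    proof (intro equalityI subsetI)
      fix p assume "p \<in> ?Y"
      then obtain y t where p: "p = (y, t)" "y \<in> gen S" "t \<in> S" "wlen S y = Suc i" "wlen S (y + t) = i" by auto
      then have "(y + t, - t) \<in> ?X" using gen_add_base minus_in by auto
      moreover have "p = (\<lambda>(x, s). (x + s, - s)) (y + t, - t)" using p by simp
      ultimately show "p \<in> (\<lambda>(x, s). (x + s, - s)) ` ?X" by blast
    qed (use gen_add_base minus_in in auto)
  qed
  moreover have "card ?X = (\<Sum>x\<in>{x \<in> gen S. wlen S x = i}. up S x)"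
    using finite_gen finite_S by (subst card_SigmaI) (auto simp: up_def)
  moreover have "card ?Y = (\<Sum>x\<in>{x \<in> gen S. wlen S x = Suc i}. dn S x)"
    using finite_gen finite_S by (subst card_SigmaI) (auto simp: dn_def)
  ultimately show ?thesis using assms by simp
qed

text \<open>The exponent is the largest word length. No generator leads beyond it, which determines
  \<open>card S\<close>; the level sizes then obey the recursion of (d choose i) (q - 1)^i, and the
  binomial theorem sums them to q^d.\<close>

lemma linear_cay_card:
  assumes lin: "linear_cay q S" and q: "q \<ge> 2"
  shows "\<exists>d. card S = (q - 1) * d \<and> card (gen S) = q ^ d"
proof -
  define d where "d = Max (wlen S ` gen S)"
  have le: "wlen S x \<le> d" if "x \<in> gen S" for x unfolding d_def using finite_gen that by simp
  have "d \<in> wlen S ` gen S" unfolding d_def using finite_gen gen_0 by (intro Max_in) auto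
  then obtain z where z: "z \<in> gen S" "wlen S z = d" by blast
  obtain r where r: "q = r + 2" using q by (metis add.commute le_Suc_ex)
  have up: "up S x + (q - 1) * wlen S x = card S" if "x \<in> gen S" for x
    using up_eq[OF that] lin that by (simp add: linear_cay_def r)
  have "{s \<in> S. wlen S (z + s) = Suc (wlen S z)} = {}"
  proof -
    have "wlen S (z + s) \<noteq> Suc (wlen S z)" if "s \<in> S" for s
      using le[OF gen_add[OF z(1) gen_base[OF that]]] z(2) by simp
    then show ?thesis by blast
  qed
  then have "up S z = 0" unfolding up_def by (simp only: card.empty)
  then have k: "card S = (q - 1) * d" using up[OF z(1)] z(2) by simp
  define N where "N i = card {x \<in> gen S. wlen S x = i}" for i
  have step: "N i * ((q - 1) * (d - i)) = N (Suc i) * Suc i" for i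
    unfolding N_def
  proof (rule card_layers)
    show "up S x = (q - 1) * (d - i)" if "x \<in> gen S" "wlen S x = i" for x
      using up[OF that(1)] that(2) k le[OF that(1)] by (simp add: diff_mult_distrib2)
    show "dn S x = Suc i" if "x \<in> gen S" "wlen S x = Suc i" for x
      using lin that by (simp add: linear_cay_def)
  qed
  have N: "N i = (d choose i) * (q - 1) ^ i" for i
  proof (induction i)
    case 0
    have "{x \<in> gen S. wlen S x = 0} = {0}" using wlen_eq_0_iff wlen_0 gen_0 by auto
    then show ?case by (simp add: N_def)
  next
    case (Suc i)
    have "(d - i) * (d choose i) = Suc i * (d choose Suc i)"
      by (simp only: binomial_absorb_comp binomial_absorption)
    have "N (Suc i) * Suc i = (q - 1) ^ Suc i * ((d - i) * (d choose i))"
      unfolding step[symmetric] Suc.IH by (simp add: algebra_simps)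
    also have "\<dots> = ((d choose Suc i) * (q - 1) ^ Suc i) * Suc i"
      unfolding \<open>(d - i) * (d choose i) = Suc i * (d choose Suc i)\<close> by (simp only: mult_ac)
    finally show ?case by (metis mult_cancel2 nat.distinct(1))
  qed
  have "gen S = (\<Union>i\<in>{..d}. {x \<in> gen S. wlen S x = i})" using le by auto
  then have "card (gen S) = card (\<Union>i\<in>{..d}. {x \<in> gen S. wlen S x = i})" by simp
  also have "\<dots> = (\<Sum>i\<le>d. N i)" unfolding N_def
    using finite_gen by (intro card_UN_disjoint) auto
  also have "\<dots> = (\<Sum>i\<le>d. (d choose i) * (q - 1) ^ i * 1 ^ (d - i))" by (simp add: N)
  also have "\<dots> = ((q - 1) + 1) ^ d" by (simp only: binomial of_nat_id)
  finally show ?thesis using k q by auto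
qed

end

section \<open>Unions of independent generating sets\<close>

lemma gen_Un: "gen (A \<union> B) = (\<lambda>(a, b). a + b) ` (gen A \<times> gen B)"
proof
  show "gen (A \<union> B) \<subseteq> (\<lambda>(a, b). a + b) ` (gen A \<times> gen B)"
  proof (rule gen_minimal)
    show "0 \<in> (\<lambda>(a, b). a + b) ` (gen A \<times> gen B)"
      by (rule image_eqI[of _ _ "(0, 0)"]) (simp_all add: gen_0)
    fix x s assume "x \<in> (\<lambda>(a, b). a + b) ` (gen A \<times> gen B)" "s \<in> A \<union> B"
    then obtain a b where ab: "x = a + b" "a \<in> gen A" "b \<in> gen B" by auto
    show "s + x \<in> (\<lambda>(a, b). a + b) ` (gen A \<times> gen B)"
    proof (cases "s \<in> A")
      case True
      then have "(s + a, b) \<in> gen A \<times> gen B" using ab gen_add[OF gen_base] by auto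
      then show ?thesis using ab by (intro image_eqI[of _ _ "(s + a, b)"]) (simp_all add: add.assoc)
    next
      case False
      then have "(a, s + b) \<in> gen A \<times> gen B" using ab gen_add[OF gen_base] \<open>s \<in> A \<union> B\<close> by auto
      then show ?thesis using ab by (intro image_eqI[of _ _ "(a, s + b)"]) (simp_all add: add.left_commute)
    qed
  qed
  show "(\<lambda>(a, b). a + b) ` (gen A \<times> gen B) \<subseteq> gen (A \<union> B)"
    using gen_mono[of A "A \<union> B"] gen_mono[of B "A \<union> B"] by (auto intro: gen_add)
qed

lemma card_gen_Un_le:
  assumes "finite (gen A)" "finite (gen B)"
  shows "card (gen (A \<union> B)) \<le> card (gen A) * card (gen B)"
  unfolding gen_Un card_cartesian_product[symmetric] using assms by (intro card_image_le) simp

lemma cayley_Un: "cayley A \<Longrightarrow> cayley B \<Longrightarrow> cayley (A \<union> B)"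
  unfolding cayley_def gen_Un by auto

text \<open>Addition maps \<open>gen A \<times> gen B\<close> onto
  \<open>gen (A \<union> B)\<close>, and equal cardinalities make it injective. A sum of two
  components then lies in \<open>A\<close> or in \<open>B\<close> only if the other component
  vanishes.\<close>

lemma cay_direct_product:
  assumes A: "cayley A" and B: "cayley B"
    and card: "card (gen (A \<union> B)) = card (gen A) * card (gen B)"
  shows "is_isomorphic (cay (A \<union> B)) (cay A \<box> cay B)"
proof (rule is_isomorphic_sym)
  interpret A: cayley A by fact
  interpret B: cayley B by fact
  have "inj_on (\<lambda>(a, b). a + b) (gen A \<times> gen B)"
    using card A.finite_gen B.finite_gen unfolding gen_Un card_cartesian_product[symmetric]
    by (intro eq_card_imp_inj_on) simp_all
  then have inj: "a = c \<and> b = d" if "a \<in> gen A" "b \<in> gen B" "c \<in> gen A" "d \<in> gen B" "a + b = c + d" for a b c d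
    using that by (auto simp: inj_on_def)
  show "is_isomorphic (cay A \<box> cay B) (cay (A \<union> B))"
  proof (rule is_isomorphicI[of "\<lambda>(a, b). a + b"])
    show "bij_betw (\<lambda>(a, b). a + b) (pverts (cay A \<box> cay B)) (pverts (cay (A \<union> B)))"
      using \<open>inj_on _ _\<close> by (simp add: cay_def cart_prod_def bij_betw_def gen_Un)
    fix x y assume "x \<in> pverts (cay A \<box> cay B)" "y \<in> pverts (cay A \<box> cay B)"
    then obtain a b c d where x: "x = (a, b)" "a \<in> gen A" "b \<in> gen B" and y: "y = (c, d)" "c \<in> gen A" "d \<in> gen B"
      by (auto simp: cay_def cart_prod_def)
    have ca: "c - a \<in> gen A" and db: "d - b \<in> gen B" using A.gen_diff B.gen_diff x y by auto
    have eq: "(c + d) - (a + b) = (c - a) + (d - b)" by simp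
    have "(c - a) + (d - b) \<in> A \<longleftrightarrow> c - a \<in> A \<and> d = b"
    proof
      assume "(c - a) + (d - b) \<in> A"
      then have "c - a = (c - a) + (d - b) \<and> d - b = 0"
        using inj[OF ca db gen_base gen_0, of "(c - a) + (d - b)"] by simp
      then show "c - a \<in> A \<and> d = b" using \<open>(c - a) + (d - b) \<in> A\<close> by simp
    qed simp
    moreover have "(c - a) + (d - b) \<in> B \<longleftrightarrow> d - b \<in> B \<and> c = a"
    proof
      assume "(c - a) + (d - b) \<in> B"
      then have "c - a = 0 \<and> d - b = (c - a) + (d - b)"
        using inj[OF ca db gen_0 gen_base, of "(c - a) + (d - b)"] by simp
      then show "d - b \<in> B \<and> c = a" using \<open>(c - a) + (d - b) \<in> B\<close> by simp
    qed simp
    moreover have "c + d \<in> gen (A \<union> B)" "a + b \<in> gen (A \<union> B)" using x y by (auto simp: gen_Un)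
    moreover have "(x, y) \<in> parcs (cay A \<box> cay B) \<longleftrightarrow> (c - a \<in> A \<and> d = b) \<or> (d - b \<in> B \<and> c = a)"
      using x y by (auto simp: cay_def cart_prod_def)
    moreover have "((case x of (a, b) \<Rightarrow> a + b), (case y of (a, b) \<Rightarrow> a + b)) \<in> parcs (cay (A \<union> B)) \<longleftrightarrow>
        (c + d) - (a + b) \<in> A \<union> B"
      using x y \<open>c + d \<in> _\<close> \<open>a + b \<in> _\<close> by (simp add: cay_def)
    ultimately show "(x, y) \<in> parcs (cay A \<box> cay B) \<longleftrightarrow>
        ((case x of (a, b) \<Rightarrow> a + b), (case y of (a, b) \<Rightarrow> a + b)) \<in> parcs (cay (A \<union> B))"
      by (simp only: eq Un_iff)
  qed
qed

abbreviation hamming_shrikhande :: "nat \<Rightarrow> nat \<Rightarrow> nat \<Rightarrow> (nat list \<times> (int \<times> int) list) pair_pre_digraph" where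
  "hamming_shrikhande q i j \<equiv> hamming_graph i q \<box> cart_power shrikhande_graph j"

lemma hamming_shrikhande_add:
  "is_isomorphic (hamming_shrikhande q i j \<box> hamming_shrikhande q i' j') (hamming_shrikhande q (i + i') (j + j'))"
proof -
  have "is_isomorphic (hamming_shrikhande q i j \<box> hamming_shrikhande q i' j')
    ((hamming_graph i q \<box> hamming_graph i' q) \<box> (cart_power shrikhande_graph j \<box> cart_power shrikhande_graph j'))"
    by (rule is_isomorphicI[of "\<lambda>((a, b), (c, d)). ((a, c), (b, d))"])
      (auto simp: cart_prod_def bij_betw_def inj_on_def image_iff)
  also have "is_isomorphic \<dots> (hamming_shrikhande q (i + i') (j + j'))"
    unfolding hamming_graph_def by (intro cart_prod_cong cart_power_add_iso)
  finally show ?thesis .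
qed

lemma hamming_shrikhande_0: "is_isomorphic (hamming_graph i q) (hamming_shrikhande q i 0)"
  using is_isomorphic_sym[OF is_isomorphic_trans[OF cart_prod_commute cart_power_0_cart_prod]] .

text \<open>A set of \<open>(q - 1) (i + 2 j)\<close> generators can generate at most \<open>q\<^bsup>i + 2 j\<^esup>\<close> elements; equality
  makes its pieces independent.\<close>

definition decomposes :: "nat \<Rightarrow> nat \<Rightarrow> nat \<Rightarrow> 'g::ab_group_add set \<Rightarrow> bool" where
  "decomposes q i j S \<longleftrightarrow> cayley S \<and> card S = (q - 1) * (i + 2 * j) \<and> card (gen S) \<le> q ^ (i + 2 * j) \<and>
     (card (gen S) = q ^ (i + 2 * j) \<longrightarrow> is_isomorphic (cay S) (hamming_shrikhande q i j))"

text \<open>The order of the generated group is at most the product of the two orders. If it attains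
  the combined bound, both parts attain theirs and the product is direct.\<close>

lemma decomposes_Un:
  assumes A: "decomposes q i j A" and B: "decomposes q i' j' B" and "A \<inter> B = {}" and q: "q > 0"
  shows "decomposes q (i + i') (j + j') (A \<union> B)"
proof -
  have cA: "cayley A" and cB: "cayley B" using A B by (auto simp: decomposes_def)
  interpret A: cayley A by fact
  interpret B: cayley B by fact
  have le: "card (gen (A \<union> B)) \<le> card (gen A) * card (gen B)"
    by (rule card_gen_Un_le[OF A.finite_gen B.finite_gen])
  have leA: "card (gen A) \<le> q ^ (i + 2 * j)" and leB: "card (gen B) \<le> q ^ (i' + 2 * j')"
    using A B by (auto simp: decomposes_def)
  have pow: "q ^ (i + i' + 2 * (j + j')) = q ^ (i + 2 * j) * q ^ (i' + 2 * j')"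
    by (simp add: power_add[symmetric] algebra_simps)
  have "card (A \<union> B) = card A + card B" using assms(3) A.finite_S B.finite_S by (rule_tac card_Un_disjoint)
  then have "card (A \<union> B) = (q - 1) * (i + i' + 2 * (j + j'))"
    using A B by (simp add: decomposes_def algebra_simps)
  moreover have "card (gen (A \<union> B)) \<le> q ^ (i + i' + 2 * (j + j'))"
    unfolding pow using le mult_le_mono[OF leA leB] by linarith
  moreover have "is_isomorphic (cay (A \<union> B)) (hamming_shrikhande q (i + i') (j + j'))"
    if eq: "card (gen (A \<union> B)) = q ^ (i + i' + 2 * (j + j'))"
  proof -
    have ge: "q ^ (i + 2 * j) * q ^ (i' + 2 * j') \<le> card (gen A) * card (gen B)" using le eq pow by simp
    have pos: "0 < q ^ (i + 2 * j)" "0 < q ^ (i' + 2 * j')" using q by simp_all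
    have eqA: "card (gen A) = q ^ (i + 2 * j)" (is "_ = ?a")
    proof (rule ccontr)
      assume "card (gen A) \<noteq> ?a"
      then have "card (gen A) < q ^ (i + 2 * j)" using leA by simp
      then have "card (gen A) * card (gen B) < q ^ (i + 2 * j) * q ^ (i' + 2 * j')"
        using mult_le_mono2[OF leB, of "card (gen A)"] mult_less_mono1[OF _ pos(2)] by (meson le_less_trans)
      then show False using ge by simp
    qed
    have "q ^ (i' + 2 * j') \<le> card (gen B)"
      using ge unfolding eqA by (simp only: nat_mult_le_cancel1[OF pos(1)])
    then have eqB: "card (gen B) = q ^ (i' + 2 * j')" using leB by simp
    have "card (gen (A \<union> B)) = card (gen A) * card (gen B)" using eqA eqB eq pow by simp
    from cay_direct_product[OF cA cB this]
    have "is_isomorphic (cay (A \<union> B)) (cay A \<box> cay B)" .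
    also have "is_isomorphic \<dots> (hamming_shrikhande q i j \<box> hamming_shrikhande q i' j')"
      using A B eqA eqB by (intro cart_prod_cong) (auto simp: decomposes_def)
    also have "is_isomorphic \<dots> (hamming_shrikhande q (i + i') (j + j'))"
      by (rule hamming_shrikhande_add)
    finally show ?thesis .
  qed
  ultimately show ?thesis unfolding decomposes_def using cayley_Un[OF cA cB] by blast
qed

section \<open>The pieces: complete graphs, 4-cycles and Shrikhande graphs\<close>

lemma gen_closed:
  assumes "\<And>x y. x \<in> P \<Longrightarrow> y \<in> P \<Longrightarrow> x + y \<in> insert 0 P"
  shows "gen P = insert 0 P"
proof
  show "gen P \<subseteq> insert 0 P" by (rule gen_minimal) (use assms in auto)
qed (auto intro: gen_0 gen_base)

lemma gen_empty: "gen {} = {0}"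
  using gen_closed[of "{}"] by simp

lemma decomposes_empty: "decomposes q 0 0 {}"
proof -
  have "is_isomorphic (cay {}) (hamming_graph 0 q)"
    by (rule is_isomorphicI[of "\<lambda>_. []"]) (auto simp: cay_def gen_empty hamming_graph_def)
  also have "is_isomorphic \<dots> (hamming_shrikhande q 0 0)" by (rule hamming_shrikhande_0)
  finally show ?thesis by (simp add: decomposes_def cayley_def gen_empty)
qed

text \<open>\<open>insert 0 P\<close> is a subgroup of order \<open>q\<close>, and all of its
  nonzero elements are generators, which gives K_q.\<close>

lemma decomposes_complete:
  assumes closed: "\<And>x y. x \<in> P \<Longrightarrow> y \<in> P \<Longrightarrow> x + y \<in> insert 0 P"
    and minus: "\<And>x. x \<in> P \<Longrightarrow> - x \<in> P" and "0 \<notin> P" "card P = q - 1" "q \<ge> 2"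
  shows "decomposes q 1 0 P"
proof -
  have g: "gen P = insert 0 P" by (rule gen_closed[OF closed])
  have fin: "finite P" using assms by (intro card_ge_0_finite) simp
  then have cq: "card (gen P) = q" using assms g by simp
  have c: "cayley P" using fin g minus assms(3) by (simp add: cayley_def)
  interpret cayley P by fact
  have "y - x \<in> P" if "x \<in> gen P" "y \<in> gen P" "x \<noteq> y" for x y
    using gen_diff[OF that(2,1)] that(3) g by auto
  then have "parcs (cay P) = {(x, y). x \<in> pverts (cay P) \<and> y \<in> pverts (cay P) \<and> x \<noteq> y}"
    using assms(3) by (auto simp: cay_def)
  from complete_graph_iso[OF _ this] have "is_isomorphic (cay P) (complete_graph q)"
    using finite_gen cq by (simp add: cay_def)
  also have "is_isomorphic \<dots> (hamming_graph 1 q)" unfolding hamming_graph_def by (rule cart_power_1_iso)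
  also have "is_isomorphic \<dots> (hamming_shrikhande q 1 0)" by (rule hamming_shrikhande_0)
  finally show ?thesis using c cq assms by (simp add: decomposes_def)
qed

text \<open>With \<open>u\<close> and its inverse as generators, a cyclic group of order 4 has the
  4-cycle as its graph, that is H(2,2); the piece therefore counts as two dimensions for q =
  2.\<close>

lemma decomposes_4_cycle:
  fixes u :: "'g::ab_group_add"
  assumes "u + u \<noteq> 0" "u + u + u + u = 0"
  shows "decomposes 2 2 0 {u, - u}"
proof -
  define w where "w = u + u"
  have ww: "w + w = 0" using assms(2) by (simp add: w_def add.assoc)
  then have mw: "- w = w" by (simp add: neg_eq_iff_add_eq_0)
  have uw: "u + w = - u" using ww by (simp add: w_def eq_neg_iff_add_eq_0 add_ac)
  have e: "u + u = w" "w + w = 0" "- w = w" "u + w = - u" "w + u = - u" "- u + w = u" "w + - u = u" "- u + - u = w"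
    using ww mw uw by (simp_all add: w_def add_ac)
  have e': "w - u = u" "- u - u = w" by (simp_all only: diff_conv_add_uminus e)
  have ne: "u \<noteq> 0" "w \<noteq> 0" "u \<noteq> - u" "- u \<noteq> u" "u \<noteq> w" "- u \<noteq> w" "w \<noteq> u" "w \<noteq> - u" "0 \<noteq> u" "0 \<noteq> w" "- u \<noteq> 0" "0 \<noteq> - u"
  proof -
    show w: "w \<noteq> 0" using assms(1) by (simp add: w_def)
    then show "u \<noteq> 0" by (auto simp: w_def)
    then show "u \<noteq> w" "w \<noteq> u" by (simp_all add: w_def)
    have "u = - u \<Longrightarrow> w = 0" unfolding w_def by (metis add.right_inverse)
    then show "u \<noteq> - u" "- u \<noteq> u" using w by auto
    have "- u = w \<Longrightarrow> u = 0" using e(6) by (metis e(2))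
    then show "- u \<noteq> w" "w \<noteq> - u" using \<open>u \<noteq> 0\<close> by auto
  qed (use assms(1) in \<open>auto simp: w_def\<close>)
  have g: "gen {u, - u} = {0, u, - u, w}"
  proof
    show "gen {u, - u} \<subseteq> {0, u, - u, w}"
      by (rule gen_minimal) (use e in auto)
    show "{0, u, - u, w} \<subseteq> gen {u, - u}"
      using gen_0 gen_base[of u "{u, - u}"] gen_base[of "- u" "{u, - u}"] gen_add[of u "{u, - u}" u] by (auto simp: w_def)
  qed
  have cg: "card (gen {u, - u}) = 4" using ne unfolding g by simp
  have c: "cayley {u, - u}" using g ne by (auto simp: cayley_def)
  \<comment> \<open>The inverse elements \<open>u\<close> and \<open>- u\<close> serve as the two
    coordinate directions; their common double \<open>w\<close> is the opposite corner.\<close>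
  define f where "f x = (if x = 0 then [0, 0] else if x = u then [1, 0] else if x = - u then [0, 1] else [1, 1 :: nat])" for x
  have f: "f 0 = [0, 0]" "f u = [1, 0]" "f (- u) = [0, 1]" "f w = [1, 1]"
    using ne by (simp_all add: f_def)
  have V: "pverts (hamming_graph 2 2) = {[0, 0], [1, 0], [0, 1], [1, 1]}"
    unfolding pverts_cube by (auto simp: length_Suc_conv numeral_2_eq_2)
  have "is_isomorphic (cay {u, - u}) (hamming_graph 2 2)"
  proof (rule is_isomorphicI[of f])
    show "bij_betw f (pverts (cay {u, - u})) (pverts (hamming_graph 2 2))"
      unfolding bij_betw_def V by (simp add: cay_def g f inj_on_def)
    fix x y assume "x \<in> pverts (cay {u, - u})" "y \<in> pverts (cay {u, - u})"
    then have xy: "x \<in> {0, u, - u, w}" "y \<in> {0, u, - u, w}" by (simp_all add: cay_def g)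
    have "f x \<in> pverts (hamming_graph 2 2)" "f y \<in> pverts (hamming_graph 2 2)"
      using xy f unfolding V by auto
    then have "(f x, f y) \<in> parcs (hamming_graph 2 2) \<longleftrightarrow> hdist (f x) (f y) = 1" by (rule parcs_cube_iff)
    moreover have "(x, y) \<in> parcs (cay {u, - u}) \<longleftrightarrow> y + - x \<in> {u, - u}" using xy by (simp add: cay_def g)
    moreover have "y + - x \<in> {u, - u} \<longleftrightarrow> hdist (f x) (f y) = 1"
      using xy unfolding insert_iff empty_iff
      by (elim disjE FalseE; hypsubst) (simp_all add: f hdist_def e e' ne del: add_uminus_conv_diff)
    ultimately show "(x, y) \<in> parcs (cay {u, - u}) \<longleftrightarrow> (f x, f y) \<in> parcs (hamming_graph 2 2)" by blast
  qed
  also have "is_isomorphic \<dots> (hamming_shrikhande 2 2 0)" by (rule hamming_shrikhande_0)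
  finally show ?thesis using c cg ne by (simp add: decomposes_def)
qed

lemma order_4_simps:
  fixes x :: "'g::ab_group_add"
  assumes "x + x + x + x = 0"
  shows "x + (x + x) = - x" "x + x + (x + x) = 0" "- x + - x = x + x" "- (x + x) = x + x" "- x + (x + x) = x"
proof -
  have "x + (x + (x + x)) = 0" using assms by (simp add: add.assoc)
  from minus_unique[OF this] show 1: "x + (x + x) = - x" by simp
  show 2: "x + x + (x + x) = 0" using assms by (simp add: add.assoc)
  from minus_unique[OF this] show 3: "- (x + x) = x + x" .
  then show "- x + - x = x + x" by simp
  show "- x + (x + x) = x" by simp
qed

text \<open>Sending \<open>(i, j)\<close> to the sum of \<open>i\<close> times \<open>v\<close> and
  \<open>j\<close> times \<open>w\<close> maps Z_4 x Z_4 onto \<open>gen P\<close>, so there are at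
  most 16 = 4^2 elements. With 16 elements the map is injective and carries the Shrikhande
  connection set to \<open>P\<close>. Whether 16 is attained is left to the global count.\<close>

lemma decomposes_shrikhande:
  fixes v w :: "'g::ab_group_add"
  assumes v: "v + v + v + v = 0" and w: "w + w + w + w = 0"
    and P: "P = {v, - v, w, - w, v + w, - (v + w)}" and "card P = 6" "0 \<notin> P"
  shows "decomposes 4 0 1 P"
proof -
  \<comment> \<open>\<open>sc x i\<close> is the \<open>i\<close>-fold multiple of \<open>x\<close>
    for a residue \<open>i\<close> modulo 4, written as \<open>- x\<close> for residue 3.\<close>
  define sc where "sc x i = (if i = 0 then 0 else if i = 1 then x else if i = 2 then x + x else - x)"
    for x :: 'g and i :: int
  let ?I = "{0, 1, 2, 3 :: int}" and ?T = "[(1, 0), (1, 1), (0, 1), (3, 0), (3, 3), (0, 3)] :: (int \<times> int) list"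
  have I: "{0..<4 :: int} = ?I" by auto
  have sc: "sc x ((i + j) mod 4) = sc x i + sc x j" if x: "x + x + x + x = 0" and ij: "i \<in> ?I" "j \<in> ?I" for x i j
  proof -
    note o = order_4_simps[OF x]
    have "x + x + x = - x" "- x - x = x + x" using o(1,3) by (simp_all add: add.assoc)
    then show ?thesis using ij unfolding insert_iff empty_iff
      by (elim disjE FalseE; hypsubst) (simp_all add: sc_def o)
  qed
  define g where "g p = sc v (fst p) + sc w (snd p)" for p
  have g: "g ((fst p + fst t) mod 4, (snd p + snd t) mod 4) = g p + g t"
    if "p \<in> ?I \<times> ?I" "t \<in> ?I \<times> ?I" for p t
  proof -
    have "fst p \<in> ?I" "fst t \<in> ?I" "snd p \<in> ?I" "snd t \<in> ?I" using that by (simp_all only: mem_Times_iff)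
    then show ?thesis unfolding g_def fst_conv snd_conv by (simp only: sc[OF v] sc[OF w] add_ac)
  qed
  have gT: "g ` set ?T = P" unfolding P by (auto simp: g_def sc_def)
  have TI: "t \<in> ?I \<times> ?I" if "t \<in> set ?T" for t using that by auto
  have mod: "((fst p + fst t) mod 4, (snd p + snd t) mod 4) \<in> ?I \<times> ?I" for p t :: "int \<times> int"
    unfolding I[symmetric] by simp
  have sub: "gen P \<subseteq> g ` (?I \<times> ?I)"
  proof (rule gen_minimal)
    show "0 \<in> g ` (?I \<times> ?I)" by (rule image_eqI[of _ _ "(0, 0)"]) (simp_all add: g_def sc_def)
    fix x s assume "x \<in> g ` (?I \<times> ?I)" "s \<in> P"
    then obtain p t where p: "p \<in> ?I \<times> ?I" "x = g p" and t: "t \<in> set ?T" "s = g t" unfolding gT[symmetric] by blast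
    have "s + x = g ((fst p + fst t) mod 4, (snd p + snd t) mod 4)"
      using g[OF p(1) TI[OF t(1)]] p t by (simp add: add.commute)
    then show "s + x \<in> g ` (?I \<times> ?I)" using mod by blast
  qed
  have card_I: "card (?I \<times> ?I) = 16" by (simp add: card_cartesian_product)
  have fin: "finite (gen P)" by (rule finite_subset[OF sub]) simp
  have le16: "card (g ` (?I \<times> ?I)) \<le> 16" using card_image_le[of "?I \<times> ?I" g] card_I by simp
  then have le: "card (gen P) \<le> 16" using card_mono[OF _ sub] by (simp del: insert_Times_insert)
  have c: "cayley P" using fin assms(5) unfolding cayley_def P by (auto simp: add.commute)
  moreover have "is_isomorphic (cay P) (hamming_shrikhande 4 0 1)" if eq: "card (gen P) = 16"
  proof -
    have gI: "g ` (?I \<times> ?I) = gen P"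
      using card_subset_eq[OF _ sub] le16 card_mono[OF _ sub] eq by (metis finite_imageI finite_SigmaI finite.intros le_antisym)
    then have inj: "inj_on g (?I \<times> ?I)"
      using eq card_I by (intro eq_card_imp_inj_on) simp_all
    have "is_isomorphic shrikhande_graph (cay P)"
    proof (rule is_isomorphicI[of g])
      show "bij_betw g (pverts shrikhande_graph) (pverts (cay P))"
        using inj gI by (simp only: shrikhande_graph_eq I bij_betw_def) (simp add: cay_def)
      fix x y assume "x \<in> pverts shrikhande_graph" "y \<in> pverts shrikhande_graph"
      then have x: "x \<in> ?I \<times> ?I" and y: "y \<in> ?I \<times> ?I" by (simp_all only: shrikhande_graph_eq I)
      have "(x, y) \<in> parcs shrikhande_graph \<longleftrightarrow> (\<exists>t\<in>set ?T. y = ((fst x + fst t) mod 4, (snd x + snd t) mod 4))"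
        using x by (simp only: shrikhande_graph_eq I mem_Collect_eq case_prod_conv set_map image_iff case_prod_beta fst_conv snd_conv simp_thms)
      also have "\<dots> \<longleftrightarrow> (\<exists>t\<in>set ?T. g y = g x + g t)"
      proof (rule bex_cong[OF refl])
        fix t assume t: "t \<in> set ?T"
        show "y = ((fst x + fst t) mod 4, (snd x + snd t) mod 4) \<longleftrightarrow> g y = g x + g t"
          unfolding g[OF x TI[OF t], symmetric] using inj_on_eq_iff[OF inj y mod] by blast
      qed
      also have "\<dots> \<longleftrightarrow> g y - g x \<in> g ` set ?T" by (auto simp: image_iff algebra_simps)
      also have "\<dots> \<longleftrightarrow> (g x, g y) \<in> parcs (cay P)"
        unfolding gT using x y gI by (auto simp: cay_def)
      finally show "(x, y) \<in> parcs shrikhande_graph \<longleftrightarrow> (g x, g y) \<in> parcs (cay P)" .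
    qed
    then have "is_isomorphic (cay P) shrikhande_graph" by (rule is_isomorphic_sym)
    also have "is_isomorphic \<dots> (cart_power shrikhande_graph 1)" by (rule cart_power_1_iso)
    also have "is_isomorphic \<dots> (hamming_shrikhande 4 0 1)"
      unfolding hamming_graph_def by (rule is_isomorphic_sym[OF cart_power_0_cart_prod])
    finally show ?thesis .
  qed
  ultimately show ?thesis using le assms(4) by (simp add: decomposes_def)
qed

text \<open>The part of a linear array that the local analysis uses, a_1 = q - 2 and c_2 = 2. An
  explicit representation of \<open>x\<close> replaces the condition of having length 2.\<close>

locale locally_linear = cayley S for S :: "'g::ab_group_add set" +
  fixes q :: nat
  assumes q: "q = 2 \<or> q = 3 \<or> q = 4"
    and lambda: "x \<in> S \<Longrightarrow> sols S x = q - 2"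
    and mu: "x \<noteq> 0 \<Longrightarrow> x \<notin> S \<Longrightarrow> u \<in> S \<Longrightarrow> x - u \<in> S \<Longrightarrow> sols S x = 2"
begin

lemma sols_le_2: "x \<noteq> 0 \<Longrightarrow> sols S x \<le> 2"
proof (cases "x \<in> S")
  case False
  assume "x \<noteq> 0"
  show ?thesis
  proof (cases "{u \<in> S. x - u \<in> S} = {}")
    case True
    then show ?thesis unfolding sols_def by (simp only: card.empty)
  next
    case ne: False
    then show ?thesis using mu[OF \<open>x \<noteq> 0\<close> False] by auto
  qed
qed (use lambda q in auto)

text \<open>Otherwise \<open>e = v - v'\<close> equals its own negative, so that \<open>v\<close>,
  \<open>- v'\<close>, \<open>v'\<close> and \<open>- v\<close> are four distinct solutions for
  \<open>e\<close>, where at most two are possible.\<close>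

lemma double_inj:
  assumes "v \<in> S" "v' \<in> S" "v + v = v' + v'" "v + v \<noteq> 0"
  shows "v' = v \<or> v' = - v"
proof (rule ccontr)
  assume ne: "\<not> (v' = v \<or> v' = - v)"
  define e where "e = v - v'"
  have e: "e = v' - v" unfolding e_def using assms(3) by (simp add: algebra_simps)
  have ne': "v \<noteq> v'" "v \<noteq> - v'" using ne by auto
  then have "e \<noteq> 0" by (simp add: e_def)
  have sub: "{v, - v', v', - v} \<subseteq> {u \<in> S. e - u \<in> S}"
  proof -
    have "e - v = - v'" "e - - v' = v" "e - v' = - v" "e - - v = v'" unfolding e_def
      using e[unfolded e_def] by (simp_all add: algebra_simps)
    then show ?thesis using assms(1,2) minus_in by simp
  qed
  have "v \<noteq> - v" "v' \<noteq> - v'" using assms(3,4) by (metis add.right_inverse)+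
  moreover have "- v' \<noteq> v'" using calculation by auto
  ultimately have "card {v, - v', v', - v} = 4" using ne ne' by (simp add: card_insert_if)
  then have "4 \<le> sols S e" unfolding sols_def using card_mono[OF _ sub] finite_S by simp
  then show False using sols_le_2[OF \<open>e \<noteq> 0\<close>] by simp
qed

lemma two_solutions:
  assumes "sols S x = 2"
  obtains u u' where "{u \<in> S. x - u \<in> S} = {u, u'}" "u \<noteq> u'"
  using assms that unfolding sols_def card_2_iff by blast

text \<open>The swap of \<open>t\<close> and \<open>u + u - t\<close> permutes the two solutions and
  fixes \<open>u\<close>; hence it fixes the other one, which is thus a second half of
  \<open>u + u\<close>.\<close>

lemma two_solutions_double:
  assumes "sols S (u + u) = 2" "u \<in> S"
  obtains u' where "u' \<in> S" "u' \<noteq> u" "u' + u' = u + u"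
proof -
  obtain a b where ab: "{t \<in> S. u + u - t \<in> S} = {a, b}" "a \<noteq> b" using two_solutions[OF assms(1)] .
  have "u \<in> {t \<in> S. u + u - t \<in> S}" using assms(2) by simp
  then obtain t where t: "{t \<in> S. u + u - t \<in> S} = {u, t}" "t \<noteq> u" using ab by (metis doubleton_eq_iff insertE empty_iff)
  then have tS: "t \<in> S" "u + u - t \<in> S" by auto
  then have "u + u - t \<in> {t \<in> S. u + u - t \<in> S}" by simp
  then have "u + u - t = t \<or> u + u - t = u" unfolding t(1) by blast
  moreover have "u + u - t \<noteq> u" using t(2) by (auto simp: algebra_simps)
  ultimately have "t + t = u + u" by (auto simp: algebra_simps)
  then show ?thesis using that tS t by blast
qed

text \<open>The second half of \<open>u + u\<close> can only be \<open>- u\<close>, so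
  \<open>u + u\<close> equals its own negative.\<close>

lemma quadruple_eq_0:
  assumes "u \<in> S" "sols S (u + u) = 2"
  shows "u + u + u + u = 0"
proof (cases "u + u = 0")
  case False
  obtain u' where "u' \<in> S" "u' \<noteq> u" "u' + u' = u + u" using two_solutions_double[OF assms(2,1)] .
  then have "u' = - u" using double_inj[of u u'] assms(1) False by auto
  then have "u + u = - (u + u)" using \<open>u' + u' = u + u\<close> by simp
  then show ?thesis by (metis add.assoc add.right_inverse)
qed (simp add: add.assoc)

lemma quadruple_eq_0':
  assumes "u \<in> S" "u + u \<notin> S"
  shows "u + u + u + u = 0"
proof (cases "u + u = 0")
  case False
  then show ?thesis using quadruple_eq_0[OF assms(1) mu[OF False assms(2,1)]] assms(1) by simp
qed (simp add: add.assoc)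

text \<open>A union of components of the graph on \<open>S\<close> in which \<open>u \<sim> v\<close> when \<open>u - v \<in> S\<close>.\<close>

definition closed_part :: "'g set \<Rightarrow> bool" where
  "closed_part A \<longleftrightarrow> A \<subseteq> S \<and> (\<forall>x\<in>A. - x \<in> A) \<and> (\<forall>x\<in>A. \<forall>y\<in>S. x - y \<in> S \<longrightarrow> y \<in> A)"

lemma closed_part_S: "closed_part S"
  using minus_in by (auto simp: closed_part_def)

lemma closed_part_Diff:
  assumes A: "closed_part A" and P: "\<And>x. x \<in> P \<Longrightarrow> - x \<in> P" "\<And>x y. x \<in> P \<Longrightarrow> y \<in> S \<Longrightarrow> x - y \<in> S \<Longrightarrow> y \<in> P"
  shows "closed_part (A - P)"
  unfolding closed_part_def
proof (intro conjI ballI impI)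
  show "A - P \<subseteq> S" using A by (auto simp: closed_part_def)
  show "- x \<in> A - P" if x: "x \<in> A - P" for x
    using A P(1)[of "- x"] x by (auto simp: closed_part_def)
  show "y \<in> A - P" if "x \<in> A - P" "y \<in> S" "x - y \<in> S" for x y
    using that A P(2)[of y x] minus_diff_in_iff[of x y] by (auto simp: closed_part_def)
qed

text \<open>A piece that can be removed with only a union of components left behind. The last
  conjunct records that Shrikhande pieces occur only for q = 4.\<close>

definition peel :: "'g set \<Rightarrow> 'g set \<Rightarrow> nat \<Rightarrow> nat \<Rightarrow> bool" where
  "peel A P i j \<longleftrightarrow> P \<subseteq> A \<and> P \<noteq> {} \<and> closed_part (A - P) \<and> decomposes q i j P \<and> (q = 4 \<or> j = 0)"

text \<open>For \<open>x\<close> in \<open>P\<close> the other \<open>q - 2\<close> elements of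
  \<open>P\<close> already exhaust the neighbours that \<open>lambda\<close> allows, so
  \<open>P\<close> is closed under adjacency in \<open>S\<close>.\<close>

lemma peel_complete:
  assumes A: "closed_part A" and P: "P \<subseteq> A" "card P = q - 1"
    and add: "\<And>x y. x \<in> P \<Longrightarrow> y \<in> P \<Longrightarrow> x + y \<in> insert 0 P" and minus: "\<And>x. x \<in> P \<Longrightarrow> - x \<in> P"
  shows "peel A P 1 0"
proof -
  have PS: "P \<subseteq> S" using A P by (auto simp: closed_part_def)
  have "0 \<notin> P" using PS zero_notin by blast
  have fin: "finite P" using PS finite_S finite_subset by blast
  have "P \<noteq> {}" using P(2) q by auto
  moreover have "y \<in> P" if "x \<in> P" "y \<in> S" "x - y \<in> S" for x y
  proof -
    have "P - {x} \<subseteq> {u \<in> S. x - u \<in> S}"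
    proof
      fix u assume u: "u \<in> P - {x}"
      then have "x + - u \<in> insert 0 P" using add minus that(1) by blast
      then show "u \<in> {u \<in> S. x - u \<in> S}" using u PS by auto
    qed
    moreover have "card (P - {x}) = q - 2" using P(2) that(1) fin by simp
    moreover have "card {u \<in> S. x - u \<in> S} = q - 2" using lambda[of x] that(1) PS by (auto simp: sols_def)
    ultimately have "P - {x} = {u \<in> S. x - u \<in> S}" using finite_S by (intro card_subset_eq) simp_all
    then show ?thesis using that by blast
  qed
  then have "closed_part (A - P)" using closed_part_Diff[OF A minus] by blast
  moreover have "decomposes q 1 0 P" using decomposes_complete[OF add minus \<open>0 \<notin> P\<close> P(2)] q by auto
  ultimately show ?thesis using P(1) unfolding peel_def by blast
qed

lemma peel_K4:
  assumes A: "closed_part A" and "q = 4" "u \<in> A" "u + u \<in> A" "u + u + u + u = 0"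
  shows "peel A {u, u + u, - u} 1 0"
proof (rule peel_complete[OF A])
  have nz: "u \<noteq> 0" "u + u \<noteq> 0" using assms(3,4) A zero_notin by (auto simp: closed_part_def)
  note o = order_4_simps[OF assms(5)]
  have o': "u + u + u = - u" "- u - u = u + u" using o(1,3) by (simp_all add: add.assoc)
  have ne: "u \<noteq> u + u" "u \<noteq> - u" "u + u \<noteq> - u"
  proof -
    show "u \<noteq> u + u" using nz by simp
    show "u \<noteq> - u" using nz by (metis add.right_inverse)
    show "u + u \<noteq> - u"
    proof
      assume "u + u = - u"
      then have "- u = 0" using o(1) by simp
      then show False using nz by simp
    qed
  qed
  show "{u, u + u, - u} \<subseteq> A" using A assms(3,4) by (auto simp: closed_part_def)
  show "card {u, u + u, - u} = q - 1" using ne assms(2) by (simp add: card_insert_if)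
  show "x + y \<in> insert 0 {u, u + u, - u}" if "x \<in> {u, u + u, - u}" "y \<in> {u, u + u, - u}" for x y
    using that unfolding insert_iff empty_iff
    by (elim disjE FalseE; hypsubst) (simp_all add: o o')
  show "- x \<in> {u, u + u, - u}" if "x \<in> {u, u + u, - u}" for x
    using that unfolding insert_iff empty_iff by (elim disjE FalseE; hypsubst) (simp_all only: o, simp_all)
qed

text \<open>The six elements form a hexagon in the adjacency on \<open>S\<close>. As every vertex
  has exactly two neighbours there, the hexagon is a component. It also shows that
  \<open>v + v\<close> and \<open>w + w\<close> are not in \<open>S\<close>, since
  \<open>- v\<close> and \<open>- w\<close> would become third neighbours; this yields the orders
  dividing 4 that a Shrikhande piece requires.\<close>

lemma peel_hexagon:
  assumes A: "closed_part A" and "q = 4" and vw: "v \<in> A" "w \<in> A" "v + w \<in> A"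
    and d: "distinct [v, - v, w, - w, v + w, - (v + w)]"
  shows "peel A {v, - v, w, - w, v + w, - (v + w)} 0 1"
proof -
  let ?P = "{v, - v, w, - w, v + w, - (v + w)}"
  have AS: "A \<subseteq> S" using A by (simp add: closed_part_def)
  have S: "v \<in> S" "w \<in> S" "v + w \<in> S" "- v \<in> S" "- w \<in> S" "- (v + w) \<in> S"
    using vw AS minus_in by blast+
  have ne: "v \<noteq> - v" "v \<noteq> w" "v \<noteq> - w" "v \<noteq> v + w" "v \<noteq> - (v + w)" "- v \<noteq> w" "- v \<noteq> - w" "- v \<noteq> v + w"
    "- v \<noteq> - (v + w)" "w \<noteq> - w" "w \<noteq> v + w" "w \<noteq> - (v + w)" "- w \<noteq> v + w" "- w \<noteq> - (v + w)" "v + w \<noteq> - (v + w)"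
    using d by simp_all
  have card6: "card ?P = 6" using distinct_card[OF d] by simp
  have two: "{t \<in> S. x - t \<in> S} = {a, b}" if "x \<in> S" "a \<in> S" "b \<in> S" "x - a \<in> S" "x - b \<in> S" "a \<noteq> b" for x a b
  proof -
    have "{a, b} \<subseteq> {t \<in> S. x - t \<in> S}" using that by simp
    moreover have "card {t \<in> S. x - t \<in> S} = 2" using lambda[OF that(1)] \<open>q = 4\<close> by (simp add: sols_def)
    moreover have "card {a, b} = 2" using that(6) by simp
    ultimately show ?thesis using finite_S by (intro card_subset_eq[symmetric]) simp_all
  qed
  have diffs: "v - (v + w) = - w" "v - - w = v + w" "w - (v + w) = - v" "w - - v = v + w" "v + w - v = w" "v + w - w = v"
    by (simp_all add: algebra_simps)
  have Nv: "{t \<in> S. v - t \<in> S} = {v + w, - w}"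
    by (rule two) (simp_all only: S diffs ne ne[symmetric] not_False_eq_True)
  have Nw: "{t \<in> S. w - t \<in> S} = {v + w, - v}"
    by (rule two) (simp_all only: S diffs ne ne[symmetric] not_False_eq_True)
  have Nu: "{t \<in> S. v + w - t \<in> S} = {v, w}"
    by (rule two) (simp_all only: S diffs ne ne[symmetric] not_False_eq_True)
  have Nm: "{t \<in> S. - x - t \<in> S} \<subseteq> uminus ` {t \<in> S. x - t \<in> S}" for x
  proof
    fix t assume t: "t \<in> {t \<in> S. - x - t \<in> S}"
    have eq: "x - - t = - (- x - t)" by simp
    have "x - - t \<in> S" unfolding eq using t minus_in by blast
    then have "- t \<in> {t \<in> S. x - t \<in> S}" using t minus_in by blast
    then show "t \<in> uminus ` {t \<in> S. x - t \<in> S}" by (rule rev_image_eqI) simp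
  qed
  have h: "{t \<in> S. v - t \<in> S} \<subseteq> ?P" "{t \<in> S. w - t \<in> S} \<subseteq> ?P" "{t \<in> S. v + w - t \<in> S} \<subseteq> ?P"
    unfolding Nv Nw Nu by blast+
  have um: "uminus ` ?P \<subseteq> ?P" by auto
  have neg: "{t \<in> S. - x - t \<in> S} \<subseteq> ?P" if "{t \<in> S. x - t \<in> S} \<subseteq> ?P" for x
    by (rule subset_trans[OF Nm subset_trans[OF image_mono[OF that] um]])
  note h' = neg[OF h(1)] neg[OF h(2)] neg[OF h(3)]
  have closed: "y \<in> ?P" if "x \<in> ?P" "y \<in> S" "x - y \<in> S" for x y
  proof -
    have "\<forall>x\<in>?P. {t \<in> S. x - t \<in> S} \<subseteq> ?P"
      using h h' unfolding ball_simps by (intro conjI TrueI)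
    then show ?thesis using that by blast
  qed
  have minus: "- x \<in> ?P" if "x \<in> ?P" for x using um that by blast
  have cl: "closed_part (A - ?P)" by (rule closed_part_Diff[OF A minus closed])
  have vv: "v + v \<notin> S"
  proof
    assume "v + v \<in> S"
    then have "- v \<in> {t \<in> S. v - t \<in> S}" using S by simp
    then show False unfolding Nv by (simp only: insert_iff empty_iff ne ne[symmetric] simp_thms)
  qed
  have ww: "w + w \<notin> S"
  proof
    assume "w + w \<in> S"
    then have "- w \<in> {t \<in> S. w - t \<in> S}" using S by simp
    then show False unfolding Nw by (simp only: insert_iff empty_iff ne ne[symmetric] simp_thms)
  qed
  have "?P \<subseteq> S" using S by blast
  then have "0 \<notin> ?P" using zero_notin by blast
  then have "decomposes q 0 1 ?P"
    using decomposes_shrikhande[OF quadruple_eq_0'[OF S(1) vv] quadruple_eq_0'[OF S(2) ww] refl card6] \<open>q = 4\<close> by blast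
  moreover have "?P \<subseteq> A" using A vw unfolding closed_part_def by blast
  ultimately show ?thesis using cl \<open>q = 4\<close> unfolding peel_def by blast
qed

end

section \<open>Existence of pieces, and the decomposition of \<open>S\<close>\<close>

context locally_linear
begin

text \<open>The argument exploits that \<open>t \<mapsto> u - t\<close> permutes the
  \<open>q - 2\<close> solutions of \<open>u = t + t'\<close> in \<open>S\<close>, with the halves
  of \<open>u\<close> as its fixed points.\<close>

lemma peel_exists:
  assumes A: "closed_part A" and "A \<noteq> {}"
  shows "\<exists>P i j. peel A P i j"
proof -
  obtain u where u: "u \<in> A" using assms(2) by blast
  have AS: "A \<subseteq> S" and Am: "\<And>x. x \<in> A \<Longrightarrow> - x \<in> A" and AN: "\<And>x y. x \<in> A \<Longrightarrow> y \<in> S \<Longrightarrow> x - y \<in> S \<Longrightarrow> y \<in> A"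
    using A by (simp_all add: closed_part_def)
  have uS: "u \<in> S" and u0: "u \<noteq> 0" using u AS zero_notin by auto
  consider "q = 2" | "q = 3" | "q = 4" using q by blast
  then show ?thesis
  proof cases
    case 1
    \<comment> \<open>For q = 2 there are no adjacencies inside \<open>S\<close>, so an element and
      its inverse can be split off freely.\<close>
    have N: "{t \<in> S. x - t \<in> S} = {}" if "x \<in> S" for x
      using lambda[OF that] 1 finite_S by (simp add: sols_def)
    show ?thesis
    proof (cases "u + u = 0")
      case True
      then have "- u = u" by (simp add: neg_eq_iff_add_eq_0)
      then have "peel A {u} 1 0" using u True 1 by (intro peel_complete[OF A]) auto
      then show ?thesis by blast
    next
      case False
      have "u + u \<notin> S"
      proof
        assume "u + u \<in> S"
        moreover have "u \<in> {t \<in> S. u + u - t \<in> S}" using uS by simp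
        ultimately show False using N by blast
      qed
      then have "decomposes 2 2 0 {u, - u}"
        using decomposes_4_cycle[OF False quadruple_eq_0'[OF uS]] by blast
      moreover have "closed_part (A - {u, - u})"
      proof (rule closed_part_Diff[OF A])
        show "- x \<in> {u, - u}" if "x \<in> {u, - u}" for x using that by auto
        show "y \<in> {u, - u}" if "x \<in> {u, - u}" "y \<in> S" "x - y \<in> S" for x y
        proof -
          have "x \<in> S" using that(1) uS minus_in by auto
          then show ?thesis using N that(2,3) by blast
        qed
      qed
      ultimately have "peel A {u, - u} 2 0" using u Am 1 unfolding peel_def by simp
      then show ?thesis by blast
    qed
  next
    case 2
    \<comment> \<open>The single solution is fixed by the swap, so each element of \<open>S\<close>
      is twice an element of \<open>S\<close>; by finiteness doubling permutes
      \<open>S\<close>.\<close>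
    have half: "\<exists>v\<in>S. v + v = x" if "x \<in> S" for x
    proof -
      have "card {t \<in> S. x - t \<in> S} = 1" using lambda[OF that] 2 by (simp add: sols_def)
      then obtain v where v: "{t \<in> S. x - t \<in> S} = {v}" using card_1_singletonE by blast
      then have vS: "v \<in> S" "x - v \<in> S" by blast+
      then have "x - v \<in> {t \<in> S. x - t \<in> S}" by simp
      then have "x - v = v" unfolding v by blast
      then have "v + v = x" by (simp add: algebra_simps)
      then show ?thesis using vS by blast
    qed
    have "S \<subseteq> (\<lambda>v. v + v) ` S" using half by blast
    then have "(\<lambda>v. v + v) ` S = S" using finite_S by (metis card_image_le card_seteq finite_imageI)
    then have uuS: "u + u \<in> S" using uS by blast
    have "card {t \<in> S. u - t \<in> S} = 1" using lambda[OF uS] 2 by (simp add: sols_def)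
    then obtain v where v: "{t \<in> S. u - t \<in> S} = {v}" using card_1_singletonE by blast
    \<comment> \<open>Both \<open>u + u\<close> and \<open>- u\<close> are neighbours of
      \<open>u\<close>, which has only one; so \<open>u\<close> has order 3.\<close>
    have "u + u \<in> {t \<in> S. u - t \<in> S}" "- u \<in> {t \<in> S. u - t \<in> S}" using uuS uS minus_in by auto
    then have uu: "u + u = - u" unfolding v by (metis singletonD)
    then have mm: "- u + - u = u" by (metis minus_add_distrib minus_minus)
    have "u + u \<noteq> 0" using uuS zero_notin by metis
    then have "u \<noteq> - u" using uu u0 by auto
    then have "peel A {u, - u} 1 0"
      using u Am uu mm 2 by (intro peel_complete[OF A]) auto
    then show ?thesis by blast
  next
    case 3
    have sols2: "sols S x = 2" if "x \<in> S" for x using lambda[OF that] 3 by simp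
    have double: "\<exists>P i j. peel A P i j" if "x \<in> A" "x + x \<in> A" for x
    proof -
      have xS: "x \<in> S" "x + x \<in> S" using that AS by auto
      then have "x + x + x + x = 0" using quadruple_eq_0 sols2 by blast
      then show ?thesis using peel_K4[OF A 3 that] by blast
    qed
    obtain v w where vw: "{t \<in> S. u - t \<in> S} = {v, w}" "v \<noteq> w" using two_solutions[OF sols2[OF uS]] .
    have vwA: "v \<in> A" "w \<in> A" and vwS: "v \<in> S" "w \<in> S" "u - v \<in> S" "u - w \<in> S" using vw AN[OF u] by blast+
    have "u - v \<in> {t \<in> S. u - t \<in> S}" using vwS by simp
    then have "u - v = v \<or> u - v = w" unfolding vw by blast
    then show ?thesis
    proof
      assume "u - v = v"
      then have "v + v = u" by (simp add: algebra_simps)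
      then show ?thesis using double[OF vwA(1)] u by simp
    next
      assume "u - v = w"
      then have uvw: "u = v + w" by (simp add: algebra_simps)
      have v0: "v \<noteq> 0" "w \<noteq> 0" using vwS zero_notin by auto
      show ?thesis
      proof (cases "u = - v \<or> u = - w")
        case True
        then have "w = - (v + v) \<or> v = - (w + w)" unfolding uvw by (auto simp: algebra_simps eq_neg_iff_add_eq_0)
        then have "v + v \<in> A \<or> w + w \<in> A" using Am[OF vwA(1)] Am[OF vwA(2)] by (metis minus_minus)
        then show ?thesis using double vwA by blast
      next
        case F1: False
        \<comment> \<open>If \<open>u\<close> is an involution, \<open>- v\<close> and
          \<open>- w\<close> solve the same equation. This makes \<open>v\<close> and
          \<open>w\<close> involutions too, and together with 0 the three form a Klein
          four-group.\<close>
        have inv: "\<exists>P i j. peel A P i j" if "u = - u"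
        proof -
          have "u + w = - v" "u + v = - w" using that uvw by (metis add.commute add_diff_cancel_left' diff_conv_add_uminus minus_add_distrib minus_minus add_minus_cancel)+
          then have "- w \<in> {t \<in> S. u - t \<in> S}" "- v \<in> {t \<in> S. u - t \<in> S}" using vwS minus_in by auto
          then have "- w = v \<or> - w = w" "- v = v \<or> - v = w" unfolding vw by blast+
          moreover have "- w \<noteq> v" "- v \<noteq> w" using uvw u0 by auto
          ultimately have m: "- w = w" "- v = v" by blast+
          have "peel A {u, v, w} 1 0"
          proof (rule peel_complete[OF A])
            show "{u, v, w} \<subseteq> A" using u vwA by blast
            have "u \<noteq> v" "u \<noteq> w" using uvw v0 by auto
            then show "card {u, v, w} = q - 1" using vw(2) 3 by simp
            have d: "u + u = 0" "v + v = 0" "w + w = 0" using that m by (metis add.right_inverse)+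
            have e: "v + w = u" "w + v = u" "u + v = w" "v + u = w" "u + w = v" "w + u = v"
              using \<open>u + w = - v\<close> \<open>u + v = - w\<close> m uvw by (simp_all add: add.commute)
            show "x + y \<in> insert 0 {u, v, w}" if "x \<in> {u, v, w}" "y \<in> {u, v, w}" for x y
              using that unfolding insert_iff empty_iff by (elim disjE FalseE) (simp_all only: d e simp_thms)
            show "- x \<in> {u, v, w}" if "x \<in> {u, v, w}" for x
              using that m \<open>u = - u\<close> by auto
          qed
          then show ?thesis by blast
        qed
        have N2: "z = a \<or> z = b" if H: "x \<in> S" "x - a \<in> S" "x - b \<in> S" "a \<in> S" "b \<in> S" "a \<noteq> b" "z \<in> S" "x - z \<in> S" for x a b z
        proof -
          obtain c d where cd: "{t \<in> S. x - t \<in> S} = {c, d}" using two_solutions[OF sols2[OF H(1)]] .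
          then have "a \<in> {c, d}" "b \<in> {c, d}" "z \<in> {c, d}" using H by blast+
          then have "a = c \<or> a = d" "b = c \<or> b = d" "z = c \<or> z = d" by blast+
          then show ?thesis using H(6) by metis
        qed
        \<comment> \<open>An involution \<open>a\<close> with \<open>u = a + b\<close> has the
          neighbours \<open>u\<close>, \<open>- b\<close> and \<open>- u\<close>. Two of them
          coincide, and only \<open>u = - u\<close> is possible.\<close>
        have inv_v: "\<exists>P i j. peel A P i j" if m: "- a = a" "a \<in> S" "b \<in> S" "u = a + b" "u \<noteq> - b" for a b
        proof -
          have "- u = u \<or> - u = - b"
          proof (rule N2[of a])
            have "a - u = - b" "a - - b = u" unfolding m(4) by simp_all
            then show "a - u \<in> S" "a - - b \<in> S" using minus_in[OF m(3)] uS by simp_all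
            have "a - - u = a + a + b" unfolding m(4) by simp
            also have "\<dots> = b" using m(1) by (metis add.right_inverse add_0)
            finally have eq: "a - - u = b" .
            show "a - - u \<in> S" unfolding eq by (rule m(3))
            show "a \<in> S" "u \<in> S" "- b \<in> S" "- u \<in> S" using m(2) uS minus_in[OF m(3)] minus_in[OF uS] by simp_all
            show "u \<noteq> - b" by (rule m(5))
          qed
          moreover have "u \<noteq> b" unfolding m(4) using m(2) zero_notin by auto
          ultimately show ?thesis using inv by auto
        qed
        show ?thesis
        proof (cases "u = - u \<or> v = - v \<or> w = - w")
          case True
          have "u = w + v" using uvw by (simp only: add.commute)
          have ne: "u \<noteq> - v" "u \<noteq> - w" using F1 by simp_all
          from True show ?thesis
          proof (elim disjE)
            assume "u = - u"
            then show ?thesis by (rule inv)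
          next
            assume "v = - v"
            then show ?thesis using inv_v[OF _ vwS(1,2) uvw ne(2)] by simp
          next
            assume "w = - w"
            then show ?thesis using inv_v[OF _ vwS(2,1) \<open>u = w + v\<close> ne(1)] by simp
          qed
        next
          case F2: False
          have "v \<noteq> - w" "- v \<noteq> w" using uvw u0 by auto
          moreover have "v \<noteq> - u" "w \<noteq> - u" "- v \<noteq> u" "- w \<noteq> u" using F1 by auto
          ultimately have "distinct [v, - v, w, - w, u, - u]"
            using F1 F2 vw(2) v0 uvw by (simp only: distinct.simps list.set insert_iff empty_iff) auto
          then have "peel A {v, - v, w, - w, v + w, - (v + w)} 0 1"
            using peel_hexagon[OF A 3 vwA] u unfolding uvw by blast
          then show ?thesis by blast
        qed
      qed
    qed
  qed
qed

lemma decomposes_closed_part: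
  assumes "closed_part A"
  shows "\<exists>i j. (q = 4 \<or> j = 0) \<and> decomposes q i j A"
  using assms
proof (induction "card A" arbitrary: A rule: less_induct)
  case less
  show ?case
  proof (cases "A = {}")
    case True
    then show ?thesis using decomposes_empty by blast
  next
    case False
    obtain P i j where P: "peel A P i j" using peel_exists[OF less.prems False] by blast
    have fin: "finite A" using less.prems finite_S finite_subset unfolding closed_part_def by blast
    have "card (A - P) < card A" using P fin unfolding peel_def by (intro psubset_card_mono) auto
    then obtain i' j' where A: "q = 4 \<or> j' = 0" "decomposes q i' j' (A - P)"
      using less.hyps P unfolding peel_def by blast
    have Pd: "decomposes q i j P" "P \<union> (A - P) = A" "q = 4 \<or> j = 0" using P unfolding peel_def by blast+
    have "decomposes q (i + i') (j + j') (P \<union> (A - P))"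
      by (rule decomposes_Un[OF Pd(1) A(2)]) (use q in auto)
    then have "decomposes q (i + i') (j + j') A" unfolding Pd(2) .
    moreover have "q = 4 \<or> j + j' = 0" using A(1) Pd(3) by auto
    ultimately show ?thesis by blast
  qed
qed

end

lemma (in cayley) linear_cay_locally_linear:
  assumes lin: "linear_cay q S" and q: "q = 2 \<or> q = 3 \<or> q = 4"
  shows "locally_linear S q"
proof (unfold_locales)
  show "sols S x = q - 2" if "x \<in> S" for x
    using lin lv_S[OF that] wlen_S[OF that] gen_base[OF that] by (simp add: linear_cay_def)
  show "sols S x = 2" if "x \<noteq> 0" "x \<notin> S" "u \<in> S" "x - u \<in> S" for x u
  proof -
    have x: "x \<in> gen S" using gen_add[OF gen_base[OF that(3)] gen_base[OF that(4)]] by simp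
    have "wlen S x = 2" using wlen_eq_2I that by blast
    then show ?thesis using lin dn_2[OF x] x by (simp add: linear_cay_def)
  qed
qed (rule q)

text \<open>\<open>P\<close> is empty or a prescribed K_4 piece that is split off at the start. In
  the latter case at least one Hamming factor is guaranteed.\<close>

theorem (in cayley) linear_cay_classification:
  assumes lin: "linear_cay q S" and q: "q = 2 \<or> q = 3 \<or> q = 4"
    and P: "P \<noteq> {} \<Longrightarrow> q = 4 \<and> (\<exists>s. P = {s, s + s, - s} \<and> s \<in> S \<and> s + s \<in> S \<and> s + s + s + s = 0)"
  obtains i j where "q = 4 \<or> j = 0" "P \<noteq> {} \<Longrightarrow> 0 < i" "card S = (q - 1) * (i + 2 * j)"
    "is_isomorphic (cay S) (hamming_shrikhande q i j)"
proof -
  interpret locally_linear S q by (rule linear_cay_locally_linear[OF lin q])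
  have "\<exists>i j. (q = 4 \<or> j = 0) \<and> (P \<noteq> {} \<longrightarrow> 0 < i) \<and> decomposes q i j S"
  proof (cases "P = {}")
    case True
    then show ?thesis using decomposes_closed_part[OF closed_part_S] by blast
  next
    case False
    then obtain s where s: "q = 4" "P = {s, s + s, - s}" "s \<in> S" "s + s \<in> S" "s + s + s + s = 0" using P by blast
    have peel: "peel S P 1 0" using peel_K4[OF closed_part_S s(1,3,4,5)] s(2) by simp
    then obtain i j where ij: "q = 4 \<or> j = 0" "decomposes q i j (S - P)"
      using decomposes_closed_part unfolding peel_def by blast
    have Pd: "decomposes q 1 0 P" "P \<union> (S - P) = S" using peel unfolding peel_def by blast+
    have "decomposes q (1 + i) (0 + j) (P \<union> (S - P))"
      by (rule decomposes_Un[OF Pd(1) ij(2)]) (use q in auto)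
    then have "decomposes q (1 + i) j S" unfolding Pd(2) by simp
    then show ?thesis using ij(1) by (intro exI[of _ "1 + i"] exI[of _ j]) simp
  qed
  then obtain i j where ij: "q = 4 \<or> j = 0" "P \<noteq> {} \<longrightarrow> 0 < i" "decomposes q i j S" by blast
  \<comment> \<open>The array makes the group as large as \<open>decomposes\<close> permits, which
    turns the decomposition into an isomorphism.\<close>
  obtain d where d: "card S = (q - 1) * d" "card (gen S) = q ^ d" using linear_cay_card[OF lin] q by auto
  have "(q - 1) * d = (q - 1) * (i + 2 * j)" using ij(3) d(1) by (simp add: decomposes_def)
  then have "d = i + 2 * j" using q by auto
  then have "is_isomorphic (cay S) (hamming_shrikhande q i j)" using ij(3) d(2) by (simp add: decomposes_def)
  then show ?thesis using that ij d \<open>d = i + 2 * j\<close> by blast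
qed

section \<open>A generator that is a direct factor\<close>

text \<open>A function that vanishes at 0 and grows by at most one per generator is a lower bound
  for word length.\<close>

lemma (in cayley) wlen_eqI:
  assumes "F 0 = 0" "\<And>x t. x \<in> gen S \<Longrightarrow> t \<in> S \<Longrightarrow> F (x + t) \<le> Suc (F x)"
    and "x \<in> gen S" "wlen S x \<le> F x"
  shows "wlen S x = F x"
proof -
  have "F (sum_list xs) \<le> length xs \<and> sum_list xs \<in> gen S" if "set xs \<subseteq> S" for xs
    using that
  proof (induction xs)
    case Nil
    then show ?case using assms(1) gen_0 by simp
  next
    case (Cons t xs)
    then have IH: "F (sum_list xs) \<le> length xs" "sum_list xs \<in> gen S" and t: "t \<in> S" by auto
    have "F (sum_list xs + t) \<le> Suc (length xs)" using assms(2)[OF IH(2) t] IH(1) by linarith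
    moreover have "sum_list xs + t \<in> gen S" using gen_add_base[OF IH(2) t] .
    ultimately show ?case by (simp add: add.commute)
  qed
  moreover obtain xs where "set xs \<subseteq> S" "length xs = wlen S x" "sum_list xs = x" using wlen_witness assms(3) .
  ultimately show ?thesis using assms(4) by fastforce
qed

lemma cayley_pair: 
  assumes "s \<noteq> 0" "finite (gen {s, - s :: 'g::ab_group_add})"
  shows "cayley {s, - s}"
  using assms by unfold_locales auto

section \<open>Word length in a direct sum\<close>

context
  fixes A B :: "'g::ab_group_add set"
  assumes A: "cayley A" and B: "cayley B" and int0: "gen A \<inter> gen B = {0}"
begin

interpretation A: cayley A by (rule A)
interpretation B: cayley B by (rule B)
interpretation AB: cayley "A \<union> B" by (rule cayley_Un[OF A B])

lemma direct_sum_unique: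
  assumes "x \<in> gen A" "y \<in> gen B" "x' \<in> gen A" "y' \<in> gen B" "x + y = x' + y'"
  shows "x = x' \<and> y = y'"
proof -
  have "x - x' = y' - y" using assms(5) by (simp add: algebra_simps)
  then have "x - x' \<in> gen A \<inter> gen B" using A.gen_diff[OF assms(1,3)] B.gen_diff[OF assms(4,2)] by simp
  then have "x - x' = 0" using int0 by blast
  then show ?thesis using assms(5) by simp
qed

text \<open>Sorting the letters of a word into \<open>A\<close> and \<open>B\<close> preserves its
  length, and directness determines the two partial sums.\<close>

lemma wlen_direct_sum:
  assumes x: "x \<in> gen A" and y: "y \<in> gen B"
  shows "wlen (A \<union> B) (x + y) = wlen A x + wlen B y"
proof (rule antisym)
  obtain xs where xs: "set xs \<subseteq> A" "length xs = wlen A x" "sum_list xs = x" using wlen_witness x .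
  obtain ys where ys: "set ys \<subseteq> B" "length ys = wlen B y" "sum_list ys = y" using wlen_witness y .
  show "wlen (A \<union> B) (x + y) \<le> wlen A x + wlen B y" using wlen_le[of "xs @ ys" "A \<union> B"] xs ys by auto
  have split: "\<exists>us vs. set us \<subseteq> A \<and> set vs \<subseteq> B \<and> sum_list us + sum_list vs = sum_list zs \<and> length us + length vs = length zs"
    if "set zs \<subseteq> A \<union> B" for zs
    using that
  proof (induction zs)
    case Nil
    show ?case by (intro exI[of _ "[]"]) simp
  next
    case (Cons z zs)
    then obtain us vs where uv: "set us \<subseteq> A" "set vs \<subseteq> B" "sum_list us + sum_list vs = sum_list zs" "length us + length vs = length zs"
      by auto
    show ?case
    proof (cases "z \<in> A")
      case True
      then show ?thesis using uv by (intro exI[of _ "z # us"] exI[of _ vs]) (simp add: add.assoc)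
    next
      case False
      then have "z \<in> B" using Cons.prems by simp
      then show ?thesis using uv by (intro exI[of _ us] exI[of _ "z # vs"]) (simp add: add.left_commute uv(3)[symmetric])
    qed
  qed
  have xy: "x + y \<in> gen (A \<union> B)" using x y by (auto simp: gen_Un)
  obtain zs where zs: "set zs \<subseteq> A \<union> B" "length zs = wlen (A \<union> B) (x + y)" "sum_list zs = x + y" using wlen_witness xy .
  obtain us vs where uv: "set us \<subseteq> A" "set vs \<subseteq> B" "sum_list us + sum_list vs = x + y" "length us + length vs = length zs"
    using split[OF zs(1)] zs(3) by auto
  have "sum_list us \<in> gen A" "sum_list vs \<in> gen B" using uv unfolding gen_def by blast+
  from direct_sum_unique[OF this x y uv(3)]
  have e: "sum_list us = x" "sum_list vs = y" by blast+
  show "wlen A x + wlen B y \<le> wlen (A \<union> B) (x + y)"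
    using wlen_le[OF uv(1), unfolded e] wlen_le[OF uv(2), unfolded e] uv(4) zs(2) by linarith
qed

lemma card_direct_sum:
  assumes x: "x \<in> gen A" and y: "y \<in> gen B"
  shows "card {t \<in> A \<union> B. P (wlen (A \<union> B) (x + y + t))} =
    card {t \<in> A. P (wlen A (x + t) + wlen B y)} + card {t \<in> B. P (wlen A x + wlen B (y + t))}"
proof -
  have "A \<inter> B \<subseteq> gen A \<inter> gen B" using gen_base by blast
  then have "A \<inter> B = {}" unfolding int0 using A.zero_notin by blast
  have "{t \<in> A \<union> B. P (wlen (A \<union> B) (x + y + t))} =
      {t \<in> A. P (wlen (A \<union> B) (x + y + t))} \<union> {t \<in> B. P (wlen (A \<union> B) (x + y + t))}" by blast
  also have "card \<dots> = card {t \<in> A. P (wlen (A \<union> B) (x + y + t))} + card {t \<in> B. P (wlen (A \<union> B) (x + y + t))}"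
    by (rule card_Un_disjoint) (use \<open>A \<inter> B = {}\<close> A.finite_S B.finite_S in auto)
  also have "{t \<in> A. P (wlen (A \<union> B) (x + y + t))} = {t \<in> A. P (wlen A (x + t) + wlen B y)}"
  proof -
    have "wlen (A \<union> B) (x + y + t) = wlen A (x + t) + wlen B y" if "t \<in> A" for t
      using wlen_direct_sum[OF gen_add_base[OF x that] y] by (simp add: add_ac)
    then show ?thesis by auto
  qed
  also have "{t \<in> B. P (wlen (A \<union> B) (x + y + t))} = {t \<in> B. P (wlen A x + wlen B (y + t))}"
  proof -
    have "wlen (A \<union> B) (x + y + t) = wlen A x + wlen B (y + t)" if "t \<in> B" for t
      using wlen_direct_sum[OF x gen_add_base[OF y that]] by (simp add: add_ac)
    then show ?thesis by auto
  qed
  finally show ?thesis .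
qed

lemma dn_lv_direct_sum:
  assumes "x \<in> gen A" "y \<in> gen B"
  shows "dn (A \<union> B) (x + y) = dn A x + dn B y" "lv (A \<union> B) (x + y) = lv A x + lv B y"
  using card_direct_sum[OF assms, of "\<lambda>d. Suc d = wlen A x + wlen B y"]
    card_direct_sum[OF assms, of "\<lambda>d. d = wlen A x + wlen B y"]
  by (simp_all add: dn_def lv_def wlen_direct_sum[OF assms] add_Suc[symmetric] add_Suc_right[symmetric]
      del: add_Suc add_Suc_right)

end

text \<open>Here \<open>indep\<close> is the hypothesis on the generator \<open>s\<close>; it yields
  \<open>s \<notin> gen T\<close>. The functions \<open>c\<close> and \<open>a\<close> always take
  lengths over \<open>S\<close> as arguments.\<close>

locale split_cayley = cayley S for S :: "'g::ab_group_add set" +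
  fixes s :: 'g and T :: "'g set" and c a :: "nat \<Rightarrow> nat"
  assumes s_in: "s \<in> S" and T_def: "T = S - {s, - s}" and indep: "gen T \<noteq> gen S"
    and dn_c: "x \<in> gen S \<Longrightarrow> dn S x = c (wlen S x)"
    and lv_a: "x \<in> gen S \<Longrightarrow> lv S x = a (wlen S x)"
begin

lemma T_subset: "T \<subseteq> S"
  by (auto simp: T_def)

lemma S_eq: "S = insert s (insert (- s) T)"
  using s_in minus_in[OF s_in] by (auto simp: T_def)

lemma gen_T_subset: "gen T \<subseteq> gen S"
  by (rule gen_mono[OF T_subset])

sublocale T: cayley T
proof
  show "finite (gen T)" using finite_gen gen_T_subset finite_subset by blast
  show "0 \<notin> T" using zero_notin by (simp add: T_def)
  show "- x \<in> T" if "x \<in> T" for x using that minus_in[of x] by (auto simp: T_def)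
qed

lemma s_notin: "s \<notin> gen T"
proof
  assume s: "s \<in> gen T"
  then have "S \<subseteq> gen T" using T.gen_minus[OF s] gen_base by (subst S_eq) auto
  then show False using gen_subset[of S T] gen_T_subset indep by blast
qed

lemma ms_notin: "- s \<notin> gen T"
  using s_notin T.gen_minus_iff by blast

lemma s_neq_0: "s \<noteq> 0"
  using s_in zero_notin by auto

lemma T_S: "t \<in> T \<Longrightarrow> t \<in> S"
  using T_subset by blast

lemma gen_T_S: "h \<in> gen T \<Longrightarrow> h \<in> gen S"
  using gen_T_subset by blast

lemma T_add: "h \<in> gen T \<Longrightarrow> t \<in> T \<Longrightarrow> h + t \<in> gen T"
  by (rule gen_add_base)

lemma S_cases: 
  assumes "t \<in> S" obtains "t \<in> T" | "t = s" | "t = - s"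
  using assms S_eq by blast

text \<open>The last summand avoids counting \<open>s\<close> twice when it is an
  involution.\<close>

lemma card_S_split:
  "card {t \<in> S. P t} = card {t \<in> T. P t} + of_bool (P s) + of_bool (s \<noteq> - s \<and> P (- s))"
proof -
  have "{t \<in> S. P t} = {t \<in> T. P t} \<union> {t \<in> {s, - s}. P t}" using S_eq by auto
  also have "card \<dots> = card {t \<in> T. P t} + card {t \<in> {s, - s}. P t}"
    by (rule card_Un_disjoint) (use T.finite_S in \<open>auto simp: T_def\<close>)
  also have "{t \<in> {s, - s}. P t} = (if P s then {s} else {}) \<union> (if P (- s) then {- s} else {})" by auto
  also have "card \<dots> = of_bool (P s) + of_bool (s \<noteq> - s \<and> P (- s))" by (auto simp: card_insert_if)
  finally show ?thesis by simp
qed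

lemma wlen_le_T: "h \<in> gen T \<Longrightarrow> wlen S h \<le> wlen T h"
proof -
  assume "h \<in> gen T"
  then obtain xs where "set xs \<subseteq> T" "length xs = wlen T h" "sum_list xs = h" using wlen_witness by blast
  then show ?thesis using wlen_le[of xs S] T_subset by auto
qed

lemma wlen_add_le: "x \<in> gen S \<Longrightarrow> t \<in> S \<Longrightarrow> wlen S x \<le> n \<Longrightarrow> wlen S (x + t) \<le> Suc n"
  using wlen_step(1)[of x t] by simp

text \<open>Eliminating the counts over \<open>T\<close> gives c (i + 1) = c i + 1 and a (i + 1) = a
  i + k for every length \<open>i\<close> that occurs in \<open>gen T\<close>; at 0 both counts
  vanish.\<close>

lemma linear_array_induct:
  assumes "\<And>h. h \<in> gen T \<Longrightarrow> c (wlen T h) = dn T h \<and> c (Suc (wlen T h)) = Suc (dn T h) \<and>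
      a (wlen T h) = lv T h \<and> a (Suc (wlen T h)) = lv T h + k"
    and "h \<in> gen T"
  shows "c (wlen T h) = wlen T h \<and> c (Suc (wlen T h)) = Suc (wlen T h) \<and>
      a (wlen T h) = k * wlen T h \<and> a (Suc (wlen T h)) = k * Suc (wlen T h)"
  using assms(2)
proof (induction "wlen T h" arbitrary: h)
  case 0
  then have "h = 0" using wlen_eq_0_iff[of h T] by simp
  moreover have "dn T 0 = 0" by (simp add: dn_def wlen_0)
  moreover have "{t \<in> T. wlen T t = 0} = {}" using T.wlen_S by force
  then have "lv T 0 = 0" unfolding lv_def wlen_0 add_0 by (simp only: card.empty)
  ultimately show ?case using assms(1)[OF gen_0] by (simp add: wlen_0)
next
  case (Suc n)
  obtain t where t: "t \<in> T" "wlen T (h + t) = n" using T.wlen_pred[OF Suc.prems] Suc.hyps(2) by metis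
  have "c (Suc n) = Suc n" "a (Suc n) = k * Suc n" using Suc.hyps(1)[of "h + t"] t T_add[OF Suc.prems t(1)] by simp_all
  then show ?case using assms(1)[OF Suc.prems] Suc.hyps(2) by simp
qed

text \<open>The lengths of \<open>h\<close> and \<open>h + s\<close> differ by one, and in a direct
  sum the counts at both reduce to those of \<open>h\<close> over \<open>T\<close>. These are the
  recursions of \<open>linear_array_induct\<close> with \<open>k = q - 2\<close>.\<close>

lemma linear_product:
  assumes int0: "gen T \<inter> gen {s, - s} = {0}" and lin: "linear_cay q {s, - s}"
  shows "linear_cay q S"
proof -
  have fin: "finite (gen {s, - s})"
    using finite_subset[OF gen_mono[of "{s, - s}" S] finite_gen] s_in minus_in by auto
  have B: "cayley {s, - s}" by (rule cayley_pair[OF s_neq_0 fin])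
  interpret B: cayley "{s, - s}" by (rule B)
  have SU: "T \<union> {s, - s} = S" using S_eq by blast
  note D = wlen_direct_sum[OF T.cayley_axioms B int0, unfolded SU]
  note dl = dn_lv_direct_sum[OF T.cayley_axioms B int0, unfolded SU]
  have linB: "dn {s, - s} y = wlen {s, - s} y" "lv {s, - s} y = (q - 2) * wlen {s, - s} y" if "y \<in> gen {s, - s}" for y
    using lin that by (simp_all add: linear_cay_def)
  have s: "s \<in> gen {s, - s}" "wlen {s, - s} s = 1" using gen_base[of s "{s, - s}"] B.wlen_S[of s] by simp_all
  have genS: "h + y \<in> gen S" if "h \<in> gen T" "y \<in> gen {s, - s}" for h y
    using that gen_Un[of T "{s, - s}"] unfolding SU by auto
  have ca: "c (wlen T h + wlen {s, - s} y) = dn T h + wlen {s, - s} y"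
     "a (wlen T h + wlen {s, - s} y) = lv T h + (q - 2) * wlen {s, - s} y" if "h \<in> gen T" "y \<in> gen {s, - s}" for h y
    using dl[OF that] dn_c[OF genS[OF that]] lv_a[OF genS[OF that]] D[OF that] linB[OF that(2)] by simp_all
  have "c (wlen T h) = dn T h \<and> c (Suc (wlen T h)) = Suc (dn T h) \<and>
      a (wlen T h) = lv T h \<and> a (Suc (wlen T h)) = lv T h + (q - 2)" if h: "h \<in> gen T" for h
    using ca[OF h s(1)] ca[OF h gen_0] s(2) by (simp add: wlen_0)
  note ind = linear_array_induct[OF this]
  show ?thesis unfolding linear_cay_def
  proof
    fix x assume "x \<in> gen S"
    then obtain h y where hy: "x = h + y" "h \<in> gen T" "y \<in> gen {s, - s}"
      using gen_Un[of T "{s, - s}"] unfolding SU by auto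
    have "dn T h = wlen T h" "lv T h = (q - 2) * wlen T h"
      using ind[OF _ hy(2)] ca[OF hy(2) gen_0] by (simp_all add: wlen_0)
    then show "dn S x = wlen S x \<and> lv S x = (q - 2) * wlen S x"
      unfolding hy(1) using dl[OF hy(2,3)] D[OF hy(2,3)] linB[OF hy(3)] by (simp add: distrib_left)
  qed
qed

lemma linear_product_2:
  assumes ss: "s + s = 0"
  shows "linear_cay 2 S"
proof (rule linear_product)
  have ms: "- s = s" using ss by (simp add: neg_eq_iff_add_eq_0)
  have g: "gen {s, - s} = insert 0 {s, - s}" by (rule gen_closed) (use ss ms in auto)
  have eq: "{s, - s} = {s}" using ms by simp
  show "gen T \<inter> gen {s, - s} = {0}" unfolding g using s_notin ms_notin gen_0[of T] by auto
  interpret B: cayley "{s, - s}" by (rule cayley_pair[OF s_neq_0]) (simp add: g)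
  have w: "wlen {s} s = 1" using B.wlen_S[of s] unfolding eq by simp
  have sets: "{t \<in> {s}. P t} = (if P s then {s} else {})" for P by auto
  show "linear_cay 2 {s, - s}"
    unfolding linear_cay_def g unfolding eq dn_def lv_def sets using w by (simp add: wlen_0 ss)
qed

lemma linear_product_3:
  assumes sss: "s + s + s = 0" and s2: "s \<noteq> - s"
  shows "linear_cay 3 S"
proof (rule linear_product)
  have ss: "s + s = - s" using sss by (simp add: eq_neg_iff_add_eq_0)
  have mm: "- s - s = s" using ss by (metis diff_conv_add_uminus minus_add_distrib minus_minus)
  have g: "gen {s, - s} = insert 0 {s, - s}" by (rule gen_closed) (use ss mm in auto)
  show "gen T \<inter> gen {s, - s} = {0}" unfolding g using s_notin ms_notin gen_0[of T] by auto
  interpret B: cayley "{s, - s}" by (rule cayley_pair[OF s_neq_0]) (simp add: g)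
  have w: "wlen {s, - s} s = 1" "wlen {s, - s} (- s) = 1" using B.wlen_S[of s] B.wlen_S[of "- s"] by simp_all
  have sets: "card {t \<in> {s, - s}. P t} = (if P s then 1 else 0) + (if P (- s) then 1 else 0)" for P
  proof -
    have "{t \<in> {s, - s}. P t} = (if P s then {s} else {}) \<union> (if P (- s) then {- s} else {})" by auto
    then show ?thesis using s2 by simp
  qed
  show "linear_cay 3 {s, - s}"
    unfolding linear_cay_def g dn_def lv_def sets using w by (simp add: wlen_0 ss mm)
qed

text \<open>The parameter is 2 although the factor has order 4: its graph is the 4-cycle H(2,2),
  where \<open>s + s\<close> has length 2 and two descents.\<close>

lemma linear_product_4:
  assumes s4: "s + s + s + s = 0" and s2: "s \<noteq> - s" and sT: "s + s \<notin> gen T"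
  shows "linear_cay 2 S"
proof (rule linear_product)
  note o = order_4_simps[OF s4]
  have mm: "- s - s = s + s" "s + s + s = - s" using o(1,3) by (simp_all add: add.assoc)
  have g: "gen {s, - s} = {0, s, - s, s + s}"
  proof
    show "gen {s, - s} \<subseteq> {0, s, - s, s + s}" by (rule gen_minimal) (use o mm in auto)
    show "{0, s, - s, s + s} \<subseteq> gen {s, - s}"
      using gen_0 gen_base[of s "{s, - s}"] gen_base[of "- s" "{s, - s}"] gen_add[of s "{s, - s}" s] by auto
  qed
  show "gen T \<inter> gen {s, - s} = {0}" unfolding g using s_notin ms_notin sT gen_0[of T] by auto
  interpret B: cayley "{s, - s}" by (rule cayley_pair[OF s_neq_0]) (simp add: g)
  have ss0: "s + s \<noteq> 0" using sT gen_0[of T] by auto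
  have "s + s \<noteq> - s"
  proof
    assume "s + s = - s"
    then have "- s = 0" using o(1) by simp
    then show False using s_neq_0 by simp
  qed
  then have "s + s \<notin> {s, - s}" using s_neq_0 by simp
  then have w: "wlen {s, - s} s = 1" "wlen {s, - s} (- s) = 1" "wlen {s, - s} (s + s) = 2"
    using B.wlen_S[of s] B.wlen_S[of "- s"] B.wlen_eq_2I[of s "s + s"] ss0 by simp_all
  have sets: "card {t \<in> {s, - s}. P t} = (if P s then 1 else 0) + (if P (- s) then 1 else 0)" for P
  proof -
    have "{t \<in> {s, - s}. P t} = (if P s then {s} else {}) \<union> (if P (- s) then {- s} else {})" by auto
    then show ?thesis using s2 by simp
  qed
  have ws: "wlen {s, - s} (s + s + s) = 1" using w mm by simp
  show "linear_cay 2 {s, - s}"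
    unfolding linear_cay_def g dn_def lv_def sets using w ws by (simp add: wlen_0 mm)
qed

end

section \<open>A generator whose double lies in the subgroup\<close>

lemma min_eq_iffs:
  fixes m n k :: nat
  shows "n < k \<Longrightarrow> min m k = n \<longleftrightarrow> m = n" "n < k \<Longrightarrow> Suc (min m k) = n \<longleftrightarrow> Suc m = n"
    "n \<le> k \<Longrightarrow> Suc (Suc (min m k)) = Suc n \<longleftrightarrow> Suc m = n"
  by (auto simp: min_def)

text \<open>As \<open>s + s\<close> lies in \<open>gen T\<close>, the group \<open>gen S\<close>
  consists of \<open>gen T\<close> and its translate by \<open>s\<close>.\<close>

locale index_two = split_cayley S s T c a for S :: "'g::ab_group_add set" and s T c a +
  fixes r :: 'g
  assumes r: "r = s + s" and r_in: "r \<in> gen T" and r_neq_0: "r \<noteq> 0"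
begin

section \<open>Representations as sums of two generators\<close>

lemma s_neq_ms: "s \<noteq> - s"
  using r_neq_0 r by (metis add.right_inverse)

lemma mem_S_iff_T: "x \<in> gen T \<Longrightarrow> x \<in> S \<longleftrightarrow> x \<in> T"
  using s_notin ms_notin by (auto simp: T_def)

lemma add_s_notin: "h \<in> gen T \<Longrightarrow> h + s \<notin> gen T"
  using s_notin T.gen_add_iff[of h s] by (simp add: add.commute)

lemma add_s_in_S_iff: "h \<in> gen T \<Longrightarrow> h + s \<in> S \<longleftrightarrow> h = 0 \<or> h = - r"
proof -
  assume "h \<in> gen T"
  then have "h + s \<notin> T" using add_s_notin gen_base by blast
  then have "h + s \<in> S \<longleftrightarrow> h + s = s \<or> h + s = - s" using S_eq by blast
  also have "h + s = s \<longleftrightarrow> h = 0" by simp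
  also have "h + s = - s \<longleftrightarrow> h = - r" unfolding r eq_neg_iff_add_eq_0 by (simp only: add.assoc)
  finally show ?thesis .
qed

lemma r_double_iff: "r = - r \<longleftrightarrow> r + r = 0"
  by (rule eq_neg_iff_add_eq_0)

text \<open>Outside \<open>T\<close> there is the representation \<open>s + s\<close> and, for an
  involution \<open>r\<close>, also \<open>(- s) + (- s)\<close>.\<close>

lemma sols_r: "sols S r = card {t \<in> T. r - t \<in> T} + 1 + of_bool (r + r = 0)"
proof -
  have "{t \<in> T. r - t \<in> S} = {t \<in> T. r - t \<in> T}"
    using mem_S_iff_T[OF T.gen_diff[OF r_in gen_base]] by blast
  moreover have "r - s \<in> S" using s_in r by simp
  moreover have "r - - s \<in> S \<longleftrightarrow> r + r = 0"
    using add_s_in_S_iff[OF r_in] r_neq_0 r_double_iff by simp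
  ultimately show ?thesis unfolding sols_def card_S_split using s_neq_ms by simp
qed

text \<open>The only candidate is \<open>s = r + (- s)\<close>, counted in both orders.\<close>

lemma sols_s: "sols S s = 2 * of_bool (r \<in> T)"
proof -
  have "s - t \<in> S \<longleftrightarrow> t = r" if "t \<in> T" for t
  proof -
    have "s - t \<in> S \<longleftrightarrow> - t + s \<in> S" by (simp add: algebra_simps)
    also have "\<dots> \<longleftrightarrow> - t = 0 \<or> - t = - r" by (rule add_s_in_S_iff[OF T.gen_minus[OF gen_base[OF that]]])
    finally show ?thesis using that T.zero_notin by auto
  qed
  then have "{t \<in> T. s - t \<in> S} = (if r \<in> T then {r} else {})" by auto
  moreover have "s - - s \<in> S \<longleftrightarrow> r \<in> T" using mem_S_iff_T[OF r_in] r by simp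
  ultimately show ?thesis unfolding sols_def card_S_split using s_neq_ms zero_notin by simp
qed

text \<open>Besides \<open>t\<close> and \<open>s\<close>, the only possible pair of summands is
  \<open>t + r\<close> and \<open>- s\<close>; each pair is counted in both orders.\<close>

lemma sols_s_add:
  assumes t: "t \<in> T"
  shows "sols S (t + s) = 2 + 2 * of_bool (t + r \<in> T)"
proof -
  have tH: "t \<in> gen T" by (rule gen_base[OF t])
  have "t + s - u \<in> S \<longleftrightarrow> u = t \<or> u = t + r" if "u \<in> T" for u
  proof -
    have eq: "t + s - u = (t - u) + s" by simp
    have "t + s - u \<in> S \<longleftrightarrow> t - u = 0 \<or> t - u = - r"
      unfolding eq by (rule add_s_in_S_iff[OF T.gen_diff[OF tH gen_base[OF that]]])
    also have "t - u = - r \<longleftrightarrow> u = t + r" by (auto simp: algebra_simps)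
    finally show ?thesis by auto
  qed
  then have "{u \<in> T. t + s - u \<in> S} = insert t (if t + r \<in> T then {t + r} else {})" using t by auto
  then have "card {u \<in> T. t + s - u \<in> S} = 1 + of_bool (t + r \<in> T)" using r_neq_0 by simp
  moreover have "t + s - s \<in> S" using T_S[OF t] by simp
  moreover have "t + s - - s \<in> S \<longleftrightarrow> t + r \<in> T"
    using mem_S_iff_T[OF gen_add[OF tH r_in]] r by (simp add: add.assoc)
  ultimately show ?thesis unfolding sols_def card_S_split using s_neq_ms by simp
qed

text \<open>For \<open>t = - r\<close> the sum \<open>t + s\<close> is the generator
  \<open>- s\<close>; otherwise it has length 2. As \<open>c 2\<close> is one number, the condition
  on \<open>t + r\<close> holds for all such \<open>t\<close> or for none.\<close>

lemma c2_eq: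
  assumes t: "t \<in> T" "t \<noteq> - r"
  shows "c 2 = 2 + 2 * of_bool (t + r \<in> T)"
proof -
  have tH: "t \<in> gen T" by (rule gen_base[OF t(1)])
  have n: "t + s \<noteq> 0" using add_s_notin[OF tH] gen_0[of T] by metis
  have "t + s \<notin> S" using add_s_in_S_iff[OF tH] t T.zero_notin by auto
  then have w: "wlen S (t + s) = 2" using wlen_eq_2I[of s "t + s"] s_in T_S[OF t(1)] n by simp
  have "t + s \<in> gen S" using gen_add_base[OF gen_T_S[OF tH] s_in] .
  then show ?thesis using dn_c dn_2 w sols_s_add[OF t(1)] by metis
qed

text \<open>A generator \<open>r\<close> is compared with the generator \<open>s\<close>; otherwise
  \<open>r\<close> itself has length 2.\<close>

lemma sols_r_eq:
  shows "r \<in> T \<Longrightarrow> sols S r = 2" "r \<notin> T \<Longrightarrow> sols S r = c 2"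
proof -
  assume "r \<in> T"
  then have "lv S r = a 1" "lv S s = a 1" "sols S r = lv S r" "sols S s = lv S s"
    using lv_a gen_base T_S s_in wlen_S lv_S by metis+
  then show "sols S r = 2" using sols_s \<open>r \<in> T\<close> by simp
next
  assume "r \<notin> T"
  then have "r \<notin> S" using mem_S_iff_T[OF r_in] by simp
  then have w: "wlen S r = 2" using wlen_eq_2I[of s r] s_in r_neq_0 r by simp
  show "sols S r = c 2" using dn_c[OF gen_T_S[OF r_in]] dn_2[OF gen_T_S[OF r_in] w] w by simp
qed

end

section \<open>The two cosets when \<open>r\<close> is an involution\<close>

locale index_two_involution = index_two S s T c a r for S :: "'g::ab_group_add set" and s T c a r +
  assumes rr: "r + r = 0"
begin

abbreviation f where "f \<equiv> wlen T"

lemma mr: "- r = r"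
  using rr by (simp add: neg_eq_iff_add_eq_0)

lemma hrr: "h + r + r = h"
  using rr by (simp add: add.assoc)

lemma hr_in: "h \<in> gen T \<Longrightarrow> h + r \<in> gen T"
  using gen_add r_in by blast

lemma hss: "h + s + s = h + r"
  by (simp add: r add.assoc)

lemma hms: "h + - s = h + r + s"
proof -
  have "h + r + s + s = h" unfolding hss hrr ..
  then show ?thesis by (metis add_diff_cancel_right' diff_conv_add_uminus)
qed

lemma htr: "h + t + r = h + r + t"
  by (simp add: add_ac)

lemma gen_S_cases:
  assumes "x \<in> gen S"
  obtains h where "h \<in> gen T" "x = h \<or> x = h + s"
proof -
  have "gen S \<subseteq> {x. \<exists>h\<in>gen T. x = h \<or> x = h + s}"
  proof (rule gen_minimal)
    fix x t assume x: "x \<in> {x. \<exists>h\<in>gen T. x = h \<or> x = h + s}" and t: "t \<in> S"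
    then obtain h where h: "h \<in> gen T" "x = h \<or> x = h + s" by blast
    have "\<exists>k\<in>gen T. x + t = k \<or> x + t = k + s"
    proof (rule S_cases[OF t])
      assume "t \<in> T"
      then have "h + t \<in> gen T" "x + t = h + t \<or> x + t = h + t + s" using h T_add by (auto simp: add_ac)
      then show ?thesis by blast
    next
      assume "t = s"
      then show ?thesis using h hr_in[OF h(1)] by (auto simp: hss)
    next
      assume t: "t = - s"
      have "h + s + - s = h" by simp
      then have "x + t = h + r + s \<or> x + t = h" using h(2) unfolding t hms[symmetric] by (elim disjE) (simp_all only: simp_thms)
      then show ?thesis using h(1) hr_in[OF h(1)] by blast
    qed
    then show "t + x \<in> {x. \<exists>h\<in>gen T. x = h \<or> x = h + s}" by (simp add: add.commute)
  qed (use gen_0 in blast)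
  then show ?thesis using assms that by blast
qed

text \<open>Two letters from \<open>s\<close> and \<open>- s\<close> add up to 0 or to
  \<open>r = - r\<close>. A shortest word for \<open>h\<close> therefore uses none of them or a pair
  of value \<open>r\<close>, and one for \<open>h + s\<close> uses a single one, since
  \<open>- s = r + s\<close>. The formulas define \<open>F\<close>, to which \<open>wlen_eqI\<close>
  applies.\<close>

lemma wlen_index_two:
  assumes h: "h \<in> gen T"
  shows "wlen S h = min (f h) (f (h + r) + 2)" "wlen S (h + s) = Suc (min (f h) (f (h + r)))"
proof -
  define F where "F x = (if x \<in> gen T then min (f x) (f (x + r) + 2) else Suc (min (f (x + - s)) (f (x + s))))" for x
  have F: "F h = min (f h) (f (h + r) + 2)" "F (h + s) = Suc (min (f h) (f (h + r)))"
    if "h \<in> gen T" for h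
  proof -
    have "h + s + - s = h" by simp
    then show "F (h + s) = Suc (min (f h) (f (h + r)))" using add_s_notin[OF that] by (simp add: F_def hss)
  qed (use that in \<open>simp add: F_def\<close>)
  have step: "F (x + t) \<le> Suc (F x)" if x: "x \<in> gen S" and t: "t \<in> S" for x t
  proof -
    obtain h where h: "h \<in> gen T" "x = h \<or> x = h + s" using gen_S_cases[OF x] .
    note hr = hr_in[OF h(1)]
    show ?thesis
    proof (rule S_cases[OF t])
      assume t: "t \<in> T"
      have e: "h + s + t = h + t + s" by (simp add: add_ac)
      show ?thesis using h(2) F[OF h(1)] F[OF T_add[OF h(1) t]] T.wlen_step(1)[OF h(1) t] T.wlen_step(1)[OF hr t]
        by (auto simp: e htr)
    next
      assume t: "t = s"
      have "F (h + r) = min (f (h + r)) (f h + 2)" using F(1)[OF hr] unfolding hrr .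
      then show ?thesis using h(2) F[OF h(1)] unfolding t by (auto simp: hss)
    next
      assume t: "t = - s"
      have "F (h + r + s) = Suc (min (f (h + r)) (f h))" using F(2)[OF hr] unfolding hrr .
      then have "F (h + - s) = Suc (min (f (h + r)) (f h))" unfolding hms .
      moreover have "F (h + s + - s) = F h" by simp
      ultimately show ?thesis using h(2) F[OF h(1)] unfolding t by (elim disjE) (simp_all del: add_uminus_conv_diff)
    qed
  qed
  have ss: "wlen S (h + s) \<le> Suc (f h)" if "h \<in> gen T" for h
    using wlen_add_le[OF gen_T_S[OF that] s_in wlen_le_T[OF that]] .
  have ms: "wlen S (h + - s) \<le> Suc (f h)" if "h \<in> gen T" for h
    using wlen_add_le[OF gen_T_S[OF that] minus_in[OF s_in] wlen_le_T[OF that]] .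
  have hsg: "h + s \<in> gen S" if "h \<in> gen T" for h using gen_add_base[OF gen_T_S[OF that] s_in] .
  have F0: "F 0 = 0" using F(1)[OF gen_0] by (simp add: wlen_0)
  have "wlen S h \<le> f (h + r) + 2"
    using wlen_add_le[OF hsg[OF hr_in[OF h]] s_in ss[OF hr_in[OF h]]] unfolding hss hrr by simp
  then have "wlen S h \<le> F h" using F(1)[OF h] wlen_le_T[OF h] by simp
  then show "wlen S h = min (f h) (f (h + r) + 2)"
    using wlen_eqI[OF F0 step gen_T_S[OF h]] F(1)[OF h] by simp
  have "wlen S (h + s) \<le> Suc (f (h + r))"
    using ms[OF hr_in[OF h]] unfolding hms hrr .
  then have "wlen S (h + s) \<le> F (h + s)" using F(2)[OF h] ss[OF h] by simp
  then show "wlen S (h + s) = Suc (min (f h) (f (h + r)))"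
    using wlen_eqI[OF F0 step hsg[OF h]] F(2)[OF h] by simp
qed

text \<open>The neighbours \<open>h + s\<close> and \<open>h - s = h + r + s\<close> have equal
  lengths, whence the factor 2.\<close>

lemma count_H:
  assumes h: "h \<in> gen T"
  shows "card {t \<in> S. P (wlen S (h + t))} =
    card {t \<in> T. P (min (f (h + t)) (f (h + r + t) + 2))} + 2 * of_bool (P (Suc (min (f h) (f (h + r)))))"
proof -
  have "{t \<in> T. P (wlen S (h + t))} = {t \<in> T. P (min (f (h + t)) (f (h + r + t) + 2))}"
    using wlen_index_two(1)[OF T_add[OF h]] by (auto simp: htr)
  moreover have "wlen S (h + - s) = Suc (min (f h) (f (h + r)))"
    unfolding hms using wlen_index_two(2)[OF hr_in[OF h]] by (simp add: hrr min.commute)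
  ultimately show ?thesis unfolding card_S_split using s_neq_ms wlen_index_two(2)[OF h] by simp
qed

lemma count_s:
  assumes h: "h \<in> gen T"
  shows "card {t \<in> S. P (wlen S (h + s + t))} =
    card {t \<in> T. P (Suc (min (f (h + t)) (f (h + r + t))))} + of_bool (P (wlen S (h + r))) + of_bool (P (wlen S h))"
proof -
  have e: "h + s + t = h + t + s" for t by (simp add: add_ac)
  have "{t \<in> T. P (wlen S (h + s + t))} = {t \<in> T. P (Suc (min (f (h + t)) (f (h + r + t))))}"
    unfolding e using wlen_index_two(2)[OF T_add[OF h]] by (auto simp: htr)
  moreover have "h + s + - s = h" by simp
  ultimately show ?thesis unfolding card_S_split hss using s_neq_ms by simp
qed

lemma f_step:
  assumes "h \<in> gen T" "t \<in> T"
  shows "f (h + t) \<le> Suc (f h)" "f h \<le> Suc (f (h + t))"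
    "f (h + r + t) \<le> Suc (f (h + r))" "f (h + r) \<le> Suc (f (h + r + t))"
  using T.wlen_step[OF assms] T.wlen_step[OF hr_in[OF assms(1)] assms(2)] by simp_all

text \<open>Where \<open>h\<close> is not farther out than \<open>h + r\<close>, a detour through
  \<open>r\<close> does not pay, and \<open>h + s\<close> and \<open>h - s\<close> are both one
  level up; the counts over \<open>S\<close> and \<open>T\<close> agree.\<close>

lemma near_arrays:
  assumes h: "h \<in> gen T" and le: "f h \<le> f (h + r)"
  shows "wlen S h = f h" "c (f h) = dn T h" "a (f h) = lv T h"
proof -
  show w: "wlen S h = f h" using wlen_index_two(1)[OF h] le by simp
  have far: "f h < f (h + r + t) + 2" if "t \<in> T" for t using f_step(4)[OF h that] le by linarith
  have "{t \<in> T. Suc (min (f (h + t)) (f (h + r + t) + 2)) = f h} = {t \<in> T. Suc (f (h + t)) = f h}"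
    "{t \<in> T. min (f (h + t)) (f (h + r + t) + 2) = f h} = {t \<in> T. f (h + t) = f h}"
    by (intro Collect_cong conj_cong refl min_eq_iffs far; assumption)+
  then have "dn S h = dn T h" "lv S h = lv T h"
    unfolding dn_def lv_def w using count_H[OF h, of "\<lambda>d. Suc d = f h"] count_H[OF h, of "\<lambda>d. d = f h"] le by simp_all
  then show "c (f h) = dn T h" "a (f h) = lv T h" using dn_c lv_a gen_T_S[OF h] w by metis+
qed

text \<open>Below \<open>h + s\<close> lie \<open>h\<close> itself and the translates by
  \<open>s\<close> of the descents of \<open>h\<close>; \<open>h + r\<close> is too far out to
  count.\<close>

lemma near_c_Suc:
  assumes h: "h \<in> gen T" and less: "f h < f (h + r)"
  shows "c (Suc (f h)) = Suc (c (f h))"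
proof -
  have w: "wlen S (h + s) = Suc (f h)" using wlen_index_two(2)[OF h] less by simp
  have w': "wlen S h = f h" "wlen S (h + r) = min (f (h + r)) (f h + 2)"
    using near_arrays(1)[OF h] wlen_index_two(1)[OF hr_in[OF h]] less by (simp_all add: hrr)
  have far: "f h \<le> f (h + r + t)" if "t \<in> T" for t using f_step(4)[OF h that] less by linarith
  have "{t \<in> T. Suc (Suc (min (f (h + t)) (f (h + r + t)))) = Suc (f h)} = {t \<in> T. Suc (f (h + t)) = f h}"
    by (intro Collect_cong conj_cong refl min_eq_iffs far; assumption)
  then have "dn S (h + s) = Suc (dn T h)"
    unfolding dn_def w using count_s[OF h, of "\<lambda>d. Suc d = Suc (f h)"] w' less by simp
  moreover have "h + s \<in> gen S" using gen_add_base[OF gen_T_S[OF h] s_in] .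
  ultimately show ?thesis using dn_c[of "h + s"] w near_arrays(2)[OF h] less by simp
qed

end

lemma (in cayley) dn_lv_0: "dn S 0 = 0" "lv S 0 = 0"
proof -
  have "{t \<in> S. wlen S t = 0} = {}" using wlen_S by force
  then show "lv S 0 = 0" unfolding lv_def wlen_0 add_0 by (simp only: card.empty)
qed (simp add: dn_def wlen_0)

lemma (in cayley) lv_eq_0D: "lv S x = 0 \<Longrightarrow> t \<in> S \<Longrightarrow> wlen S (x + t) \<noteq> wlen S x"
  using finite_S by (auto simp: lv_def)

section \<open>Ties between \<open>h\<close> and \<open>h + r\<close>, and the case that
  \<open>r\<close> is a generator\<close>

context index_two_involution
begin

lemma c_a_0: "c 0 = 0" "a 0 = 0"
  using dn_c[OF gen_0] lv_a[OF gen_0] dn_lv_0 by (simp_all add: wlen_0)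

text \<open>At a tie both \<open>h\<close> and \<open>h + r\<close> lie directly below
  \<open>h + s\<close>, in addition to the translated descents of \<open>h\<close>.\<close>

lemma tie_c_ge:
  assumes h: "h \<in> gen T" and tie: "f h = f (h + r)"
  shows "c (f h) + 2 \<le> c (Suc (f h))"
proof -
  have w: "wlen S (h + s) = Suc (f h)" using wlen_index_two(2)[OF h] tie by simp
  have w': "wlen S h = f h" "wlen S (h + r) = f h"
    using near_arrays(1)[OF h] near_arrays(1)[OF hr_in[OF h]] tie by (simp_all add: hrr)
  have "{t \<in> T. Suc (f (h + t)) = f h} \<subseteq> {t \<in> T. Suc (Suc (min (f (h + t)) (f (h + r + t)))) = Suc (f h)}"
  proof
    fix t assume "t \<in> {t \<in> T. Suc (f (h + t)) = f h}"
    then show "t \<in> {t \<in> T. Suc (Suc (min (f (h + t)) (f (h + r + t)))) = Suc (f h)}"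
      using f_step(4)[OF h, of t] tie by (auto simp: min_def)
  qed
  from card_mono[OF _ this] have "dn T h \<le> card {t \<in> T. Suc (Suc (min (f (h + t)) (f (h + r + t)))) = Suc (f h)}"
    using T.finite_S by (simp add: dn_def)
  then have "dn T h + 2 \<le> dn S (h + s)"
    unfolding dn_def[of S] w using count_s[OF h, of "\<lambda>d. Suc d = Suc (f h)"] w' by simp
  moreover have "h + s \<in> gen S" using gen_add_base[OF gen_T_S[OF h] s_in] .
  ultimately show ?thesis using dn_c[of "h + s"] w near_arrays(2)[OF h] tie by simp
qed

text \<open>If no letter of \<open>T\<close> lowers \<open>h\<close> and \<open>h + r\<close> at
  once, the descents of both contribute to \<open>h + s\<close> separately.\<close>

lemma tie_c_eq:
  assumes h: "h \<in> gen T" and tie: "f h = f (h + r)"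
    and disj: "\<And>t. t \<in> T \<Longrightarrow> Suc (f (h + t)) = f h \<Longrightarrow> Suc (f (h + r + t)) \<noteq> f h"
  shows "c (Suc (f h)) = 2 * c (f h) + 2"
proof -
  have w: "wlen S (h + s) = Suc (f h)" using wlen_index_two(2)[OF h] tie by simp
  have w': "wlen S h = f h" "wlen S (h + r) = f h"
    using near_arrays(1)[OF h] near_arrays(1)[OF hr_in[OF h]] tie by (simp_all add: hrr)
  have "Suc (Suc (min (f (h + t)) (f (h + r + t)))) = Suc (f h) \<longleftrightarrow> Suc (f (h + t)) = f h \<or> Suc (f (h + r + t)) = f h"
    if "t \<in> T" for t
    using f_step(2,4)[OF h that] tie by (auto simp: min_def)
  then have eq: "{t \<in> T. Suc (Suc (min (f (h + t)) (f (h + r + t)))) = Suc (f h)} =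
    {t \<in> T. Suc (f (h + t)) = f h} \<union> {t \<in> T. Suc (f (h + r + t)) = f h}" by blast
  have "card {t \<in> T. Suc (Suc (min (f (h + t)) (f (h + r + t)))) = Suc (f h)} = dn T h + dn T (h + r)"
    unfolding eq dn_def tie[symmetric]
    by (rule card_Un_disjoint) (use T.finite_S disj in auto)
  moreover have "c (f h) = dn T h" "c (f h) = dn T (h + r)"
    using near_arrays(2)[OF h] near_arrays(2)[OF hr_in[OF h]] tie by (simp_all add: hrr)
  ultimately have "dn S (h + s) = 2 * c (f h) + 2"
    unfolding dn_def[of S] w using count_s[OF h, of "\<lambda>d. Suc d = Suc (f h)"] w' by simp
  moreover have "h + s \<in> gen S" using gen_add_base[OF gen_T_S[OF h] s_in] .
  ultimately show ?thesis using dn_c[of "h + s"] w by simp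
qed

text \<open>Counting the neighbours of \<open>h + r\<close> in two ways excludes every \<open>t\<close> except the expected ones.\<close>

lemma low_flip:
  assumes rT: "r \<in> T" and h: "h \<in> gen T" and low: "f (h + r) = Suc (f h)" and t: "t \<in> T"
  shows "f (h + r + t) = f h \<longleftrightarrow> t = r \<or> Suc (f (h + t)) = f h"
proof -
  have w: "wlen S (h + r) = Suc (f h)" using wlen_index_two(1)[OF hr_in[OF h]] low by (simp add: hrr)
  have far: "f h < f (h + t) + 2" if "t \<in> T" for t using f_step(2)[OF h that] by linarith
  have "{t \<in> T. Suc (min (f (h + r + t)) (f (h + t) + 2)) = Suc (f h)} = {t \<in> T. f (h + r + t) = f h}"
    using far by (auto simp: min_eq_iffs)
  then have "card {t \<in> T. f (h + r + t) = f h} = dn S (h + r)"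
    unfolding dn_def[of S] w using count_H[OF hr_in[OF h], of "\<lambda>d. Suc d = Suc (f h)"] low by (simp add: hrr)
  also have "\<dots> = Suc (dn T h)"
    using dn_c[OF gen_T_S[OF hr_in[OF h]]] w near_c_Suc[OF h] near_arrays(2)[OF h] low by simp
  finally have card: "card {t \<in> T. f (h + r + t) = f h} = Suc (dn T h)" .
  have sub: "insert r {t \<in> T. Suc (f (h + t)) = f h} \<subseteq> {t \<in> T. f (h + r + t) = f h}"
  proof -
    have "f (h + r + t) = f h" if "t \<in> T" "Suc (f (h + t)) = f h" for t
      using f_step(4)[OF h that(1)] T.wlen_step(1)[OF T_add[OF h that(1)] rT] that(2) low by (simp add: htr)
    then show ?thesis using rT by (auto simp: hrr)
  qed
  have "r \<notin> {t \<in> T. Suc (f (h + t)) = f h}" using low by simp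
  then have "card (insert r {t \<in> T. Suc (f (h + t)) = f h}) = Suc (dn T h)"
    using T.finite_S by (simp add: dn_def)
  then have "insert r {t \<in> T. Suc (f (h + t)) = f h} = {t \<in> T. f (h + r + t) = f h}"
    using T.finite_S card by (intro card_subset_eq[OF _ sub]) simp_all
  then show ?thesis using t by blast
qed

text \<open>At \<open>h + s\<close> two level neighbours are new: \<open>h + r\<close>, reached by
  \<open>s\<close>, and \<open>h + s + r\<close>, reached by \<open>r\<close>. By
  \<open>low_flip\<close> there are no others.\<close>

lemma low_a_Suc:
  assumes rT: "r \<in> T" and h: "h \<in> gen T" and low: "f (h + r) = Suc (f h)"
  shows "a (Suc (f h)) = a (f h) + 2"
proof -
  have w: "wlen S (h + s) = Suc (f h)" using wlen_index_two(2)[OF h] low by simp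
  have w': "wlen S h = f h" "wlen S (h + r) = Suc (f h)"
    using near_arrays(1)[OF h] wlen_index_two(1)[OF hr_in[OF h]] low by (simp_all add: hrr)
  have "min (f (h + t)) (f (h + r + t)) = f h \<longleftrightarrow> t = r \<or> f (h + t) = f h" if t: "t \<in> T" for t
  proof (cases "t = r")
    case True
    then show ?thesis using low by (simp add: hrr)
  next
    case False
    then show ?thesis using low_flip[OF rT h low t] f_step(4)[OF h t] low by (auto simp: min_def)
  qed
  then have "{t \<in> T. min (f (h + t)) (f (h + r + t)) = f h} = insert r {t \<in> T. f (h + t) = f h}"
    using rT by auto
  moreover have "r \<notin> {t \<in> T. f (h + t) = f h}" using low by simp
  ultimately have "card {t \<in> T. min (f (h + t)) (f (h + r + t)) = f h} = Suc (lv T h)"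
    using T.finite_S by (simp add: lv_def)
  then have "lv S (h + s) = lv T h + 2"
    unfolding lv_def[of S] w using count_s[OF h, of "\<lambda>d. d = Suc (f h)"] w' by simp
  moreover have "h + s \<in> gen S" using gen_add_base[OF gen_T_S[OF h] s_in] .
  ultimately show ?thesis using lv_a[of "h + s"] w near_arrays(3)[OF h] low by simp
qed

text \<open>Take a tie \<open>h\<close> of least length p + 1 and a predecessor \<open>w\<close>; by
  minimality \<open>w + r\<close> is one level above \<open>w\<close>. As \<open>h + s\<close> is an
  ascent from \<open>h\<close>, level p + 1 has ascents, also at \<open>w + r\<close>. Such an
  ascent lies in \<open>T\<close> and leads to \<open>y\<close> with \<open>f y = p + 1\<close> and
  \<open>f (y + r) = p + 2\<close>, where \<open>c\<close> grows by 1; the tie demands growth by at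
  least 2.\<close>

lemma no_tie:
  assumes rT: "r \<in> T" and h: "h \<in> gen T"
  shows "f h \<noteq> f (h + r)"
  using h
proof (induction "f h" arbitrary: h rule: less_induct)
  case less
  note h = less.prems
  have adj: "f (x + r) \<le> Suc (f x)" "f x \<le> Suc (f (x + r))" if "x \<in> gen T" for x
    using T.wlen_step[OF that rT] by simp_all
  show ?case
  proof
    assume tie: "f h = f (h + r)"
    obtain p where p: "f h = Suc p"
    proof (cases "f h")
      case 0
      then have "h = 0" using wlen_eq_0_iff h by blast
      then show ?thesis using tie T.wlen_S[OF rT] by (simp add: wlen_0)
    qed
    obtain t where t: "t \<in> T" "f (h + t) = p" using T.wlen_pred[OF h p] .
    define w where "w = h + t"
    have w: "w \<in> gen T" "f w = p" using T_add[OF h t(1)] t(2) by (simp_all add: w_def)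
    have "f w \<noteq> f (w + r)" using less.hyps[OF _ w(1)] w(2) p by simp
    moreover have "p \<le> f (w + r)" using f_step(4)[OF h t(1)] tie p by (simp add: w_def htr)
    ultimately have low: "f (w + r) = Suc (f w)" using adj(1)[OF w(1)] w(2) by linarith
    have wh: "wlen S h = Suc p" using near_arrays(1)[OF h] tie p by simp
    have "s \<in> {u \<in> S. wlen S (h + u) = Suc (wlen S h)}"
      using s_in wlen_index_two(2)[OF h] tie wh p by simp
    then have "0 < up S h" unfolding up_def using finite_S card_gt_0_iff by fastforce
    then have lt: "c (Suc p) + a (Suc p) < card S"
      using up_eq[OF gen_T_S[OF h]] dn_c[OF gen_T_S[OF h]] lv_a[OF gen_T_S[OF h]] wh by simp
    have wr: "w + r \<in> gen T" "w + r \<in> gen S" using hr_in[OF w(1)] gen_T_S by blast+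
    have wx: "wlen S (w + r) = Suc p" using wlen_index_two(1)[OF wr(1)] low w(2) by (simp add: hrr)
    have "up S (w + r) \<noteq> 0" using lt up_eq[OF wr(2)] dn_c[OF wr(2)] lv_a[OF wr(2)] wx by simp
    then have "{u \<in> S. wlen S (w + r + u) = Suc (wlen S (w + r))} \<noteq> {}" unfolding up_def by (metis card.empty)
    then obtain u where u: "u \<in> S" "wlen S (w + r + u) = Suc (Suc p)" using wx by auto
    have ws: "wlen S (w + r + s) = Suc p" "wlen S (w + s) = Suc p"
      using wlen_index_two(2)[OF wr(1)] wlen_index_two(2)[OF w(1)] low w(2) by (simp_all add: hrr)
    have "w + r + - s = w + s" unfolding hms hrr ..
    then have "wlen S (w + r + - s) = Suc p" using ws(2) by (simp only:)
    then have "u \<noteq> s" "u \<noteq> - s" using u(2) ws(1) by auto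
    then have uT: "u \<in> T" using u(1) by (simp add: T_def)
    have "min (f (w + r + u)) (f (w + r + u + r) + 2) = Suc (Suc p)"
      using wlen_index_two(1)[OF T_add[OF wr(1) uT]] u(2) by simp
    then have fu: "f (w + r + u) = Suc (Suc p)"
      using f_step(3)[OF w(1) uT] low w(2) by (auto simp: min_def split: if_splits)
    define y where "y = w + u"
    have y: "y \<in> gen T" "f (y + r) = Suc (Suc p)" using T_add[OF w(1) uT] fu by (simp_all add: y_def htr)
    have "f y = Suc p" using adj(1)[OF y(1)] y(2) f_step(1)[OF w(1) uT] w(2) by (simp add: y_def)
    then have "c (Suc (Suc p)) = Suc (c (Suc p))" using near_c_Suc[OF y(1)] y(2) by simp
    then show False using tie_c_ge[OF h tie] p by simp
  qed
qed

text \<open>For a predecessor of \<open>h\<close> the length of the \<open>r\<close>-translate drops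
  by at most one, so the predecessor again has its translate one level above. Both recursions can
  thus be followed down to 0.\<close>

lemma low_arrays:
  assumes rT: "r \<in> T" and h: "h \<in> gen T" and low: "f (h + r) = Suc (f h)"
  shows "c (f h) = f h \<and> a (f h) = 2 * f h"
  using h low
proof (induction "f h" arbitrary: h)
  case 0
  then show ?case using c_a_0 by simp
next
  case (Suc n)
  obtain t where t: "t \<in> T" "f (h + t) = n" using T.wlen_pred[OF Suc.prems(1) Suc.hyps(2)[symmetric]] .
  have w: "h + t \<in> gen T" using T_add[OF Suc.prems(1) t(1)] .
  have "f (h + t + r) \<le> Suc (f (h + t))" using T.wlen_step(1)[OF w rT] .
  moreover have "Suc n \<le> f (h + t + r)" using f_step(4)[OF Suc.prems(1) t(1)] Suc.prems(2) Suc.hyps(2) by (simp add: htr)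
  ultimately have low: "f (h + t + r) = Suc (f (h + t))" using t(2) by simp
  have "c n = n" "a n = 2 * n" using Suc.hyps(1)[OF _ w low] t(2) by simp_all
  moreover have "c (Suc n) = Suc (c n)" using near_c_Suc[OF w] low t(2) by simp
  moreover have "a (Suc n) = a n + 2" using low_a_Suc[OF rT w low] t(2) by simp
  ultimately show ?case using Suc.hyps(2) by simp
qed

text \<open>\<open>h\<close> and \<open>h + r\<close> are adjacent and never tied, so one of them is
  the lower one; all lengths over \<open>S\<close> in question are its length or the
  successor.\<close>

theorem linear_cay_4:
  assumes rT: "r \<in> T"
  shows "linear_cay 4 S"
proof -
  have adj: "f (x + r) \<le> Suc (f x)" "f x \<le> Suc (f (x + r))" if "x \<in> gen T" for x
    using T.wlen_step[OF that rT] by simp_all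
  have next_level: "c (Suc (f h)) = Suc (f h)" "a (Suc (f h)) = 2 * Suc (f h)" if h: "h \<in> gen T" and low: "f (h + r) = Suc (f h)" for h
    using low_arrays[OF rT h low] near_c_Suc[OF h] low_a_Suc[OF rT h low] low by simp_all
  have half: "\<exists>w\<in>gen T. f (w + r) = Suc (f w) \<and> (w = h \<or> w = h + r)" if h: "h \<in> gen T" for h
  proof -
    have "f (h + r) = Suc (f h) \<or> f h = Suc (f (h + r))" using no_tie[OF rT h] adj[OF h] by linarith
    then show ?thesis
    proof
      assume "f h = Suc (f (h + r))"
      then show ?thesis using hr_in[OF h] by (intro bexI[of _ "h + r"]) (simp_all add: hrr)
    qed (use h in blast)
  qed
  have "c (wlen S x) = wlen S x \<and> a (wlen S x) = 2 * wlen S x" if x: "x \<in> gen S" for x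
  proof -
    obtain h where h: "h \<in> gen T" "x = h \<or> x = h + s" using gen_S_cases[OF x] .
    obtain w where w: "w \<in> gen T" "f (w + r) = Suc (f w)" "w = h \<or> w = h + r" using half[OF h(1)] by blast
    have "wlen S (h + s) = Suc (f w)" using wlen_index_two(2)[OF h(1)] w(2,3) by (auto simp: hrr)
    moreover have "wlen S h = f w \<or> wlen S h = Suc (f w)" using wlen_index_two(1)[OF h(1)] w(2,3) by (auto simp: hrr)
    ultimately show ?thesis using h(2) next_level[OF w(1,2)] low_arrays[OF rT w(1,2)] by auto
  qed
  then show ?thesis unfolding linear_cay_def using dn_c lv_a by simp
qed

text \<open>With a gap of two, letters of \<open>T\<close> bring no element of the
  \<open>r\<close>-translate near enough to matter, and neither \<open>h\<close> nor
  \<open>h + r\<close> has the length of \<open>h + s\<close>.\<close>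

lemma near_a_Suc:
  assumes h: "h \<in> gen T" and less: "f h + 2 \<le> f (h + r)"
  shows "a (Suc (f h)) = a (f h)"
proof -
  have w: "wlen S (h + s) = Suc (f h)" using wlen_index_two(2)[OF h] less by simp
  have w': "wlen S h = f h" "f h + 2 \<le> wlen S (h + r)"
    using near_arrays(1)[OF h] wlen_index_two(1)[OF hr_in[OF h]] less by (simp_all add: hrr)
  have far: "f h < f (h + r + t)" if "t \<in> T" for t using f_step(4)[OF h that] less by linarith
  have "{t \<in> T. Suc (min (f (h + t)) (f (h + r + t))) = Suc (f h)} = {t \<in> T. f (h + t) = f h}"
    using far by (auto simp: min_eq_iffs)
  then have "lv S (h + s) = lv T h"
    unfolding lv_def w using count_s[OF h, of "\<lambda>d. d = Suc (f h)"] w' by simp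
  moreover have "h + s \<in> gen S" using gen_add_base[OF gen_T_S[OF h] s_in] .
  ultimately show ?thesis using lv_a[of "h + s"] w near_arrays(3)[OF h] less by simp
qed

end

text \<open>The assumptions say that \<open>r\<close> is neither in \<open>T\<close> nor a sum of
  two elements of \<open>T\<close>; since \<open>r\<close> is nonzero, its length over
  \<open>T\<close> is at least 3.\<close>

locale folded = index_two_involution S s T c a r for S :: "'g::ab_group_add set" and s T c a r +
  assumes r_notin: "r \<notin> T" and no_pair: "t \<in> T \<Longrightarrow> t + r \<notin> T"
begin

abbreviation e where "e \<equiv> f r"

lemma e_ge_3: "3 \<le> e"
proof -
  have "e \<noteq> 0" "e \<noteq> 1" using wlen_eq_0_iff[OF r_in] T.wlen_eq_1_iff[OF r_in] r_neq_0 r_notin by auto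
  moreover have "e \<noteq> 2"
  proof
    assume "e = 2"
    then obtain t where t: "t \<in> T" "f (r + t) = 1" using T.wlen_pred[OF r_in, of 1] by auto
    then show False using no_pair[OF t(1)] T.wlen_eq_1_iff[OF T_add[OF r_in t(1)]] by (simp add: add.commute)
  qed
  ultimately show ?thesis by linarith
qed

lemma sum_ge: "h \<in> gen T \<Longrightarrow> e \<le> f h + f (h + r)"
  using wlen_add[OF hr_in T.gen_minus, of h h] T.wlen_minus[of h] by simp

lemma geodesic:
  assumes "j \<le> e" obtains h where "h \<in> gen T" "f h = j" "f (h + r) = e - j"
proof -
  obtain h where h: "h \<in> gen T" "f h = j" "f (r - h) = e - j" using T.wlen_geodesic[OF r_in assms] .
  have "- (r - h) = h + - r" by simp
  then have eq: "- (r - h) = h + r" by (simp only: mr)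
  have "f (h + r) = e - j" unfolding eq[symmetric] using T.wlen_minus[OF T.gen_diff[OF r_in h(1)]] h(3) by simp
  then show ?thesis using that h by blast
qed

text \<open>On a geodesic from 0 to \<open>r\<close> the translate of a vertex of level
  \<open>i\<close> has length \<open>e - i\<close>, which exceeds \<open>i\<close> while
  \<open>2 * i < e\<close>. The recursion therefore runs up to half of \<open>e\<close>, rounded
  up.\<close>

lemma c_initial: "2 * i \<le> e + 1 \<Longrightarrow> c i = i"
proof (induction i)
  case 0
  then show ?case using c_a_0 by simp
next
  case (Suc i)
  then have "i \<le> e" by simp
  then obtain h where h: "h \<in> gen T" "f h = i" "f (h + r) = e - i" using geodesic by blast
  then show ?case using near_c_Suc[OF h(1)] Suc by simp
qed

text \<open>The recursion for \<open>a\<close> needs a gap of two, so it stops at half of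
  \<open>e\<close>, rounded down.\<close>

lemma a_initial: "2 * i \<le> e \<Longrightarrow> a i = 0"
proof (induction i)
  case 0
  then show ?case using c_a_0 by simp
next
  case (Suc i)
  then have "i \<le> e" by simp
  then obtain h where h: "h \<in> gen T" "f h = i" "f (h + r) = e - i" using geodesic by blast
  then show ?case using near_a_Suc[OF h(1)] Suc by simp
qed

lemma initial_arrays:
  assumes h: "h \<in> gen T" and i: "2 * f h \<le> e"
  shows "dn T h = f h" "lv T h = 0"
proof -
  have "f h \<le> f (h + r)" using sum_ge[OF h] i by linarith
  then show "dn T h = f h" "lv T h = 0" using near_arrays[OF h] c_initial[of "f h"] a_initial[OF i] i by simp_all
qed

lemma card_S_T: "card S = card T + 2"
  using card_S_split[of "\<lambda>_. True"] s_neq_ms by simp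

text \<open>Once the array is known up to the middle level \<open>L\<close>, the map \<open>h \<mapsto> h + r\<close> is an antipodal map of \<open>cay T\<close>.\<close>

lemma linear_cay_T:
  assumes L: "2 * L \<le> e" "e \<le> 2 * L + 1" and cT: "card T = e"
    and mid: "\<And>h. h \<in> gen T \<Longrightarrow> f h = L \<Longrightarrow> f (h + r) = e - L"
    and top: "card S \<le> c (Suc L) + a (Suc L)"
  shows "linear_cay 2 T"
proof -
  have up: "f h + up T h = e" if "h \<in> gen T" "2 * f h \<le> e" for h
    using T.up_eq[OF that(1)] initial_arrays[OF that] cT by simp
  \<comment> \<open>Induction from the middle level towards 0: an ascent leads to a level where the
    claim is known, and the step back costs at most one.\<close>
  have anti: "f (h + r) = e - f h" if "h \<in> gen T" "f h \<le> L" for h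
    using that
  proof (induction "L - f h" arbitrary: h)
    case 0
    then show ?case using mid by simp
  next
    case (Suc n)
    have "up T h \<noteq> 0" using up[OF Suc.prems(1)] Suc.hyps(2) Suc.prems(2) L by linarith
    then have "{t \<in> T. f (h + t) = Suc (f h)} \<noteq> {}" unfolding up_def by (metis card.empty)
    then obtain t where t: "t \<in> T" "f (h + t) = Suc (f h)" by blast
    have "f (h + t + r) = e - f (h + t)" using Suc.hyps(1)[of "h + t"] T_add[OF Suc.prems(1) t(1)] t(2) Suc.hyps(2) by simp
    then have "f (h + r) \<le> e - f h" using f_step(4)[OF Suc.prems(1) t(1)] t(2) Suc.hyps(2) L by (simp add: htr)
    then show ?case using sum_ge[OF Suc.prems(1)] by linarith
  qed
  \<comment> \<open>By \<open>top\<close>, descents and level steps use up all generators at level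
    \<open>Suc L\<close>, so no vertex lies beyond it.\<close>
  have le: "wlen S x \<le> Suc L" if x: "x \<in> gen S" for x
  proof (rule ccontr)
    assume "\<not> wlen S x \<le> Suc L"
    then have "Suc (Suc L) \<le> wlen S x" by simp
    then obtain y where y: "y \<in> gen S" "wlen S y = Suc (Suc L)" using wlen_geodesic[OF x] by metis
    obtain t where t: "t \<in> S" "wlen S (y + t) = Suc L" using wlen_pred[OF y] .
    have yt: "y + t \<in> gen S" using gen_add_base[OF y(1) t(1)] .
    have "- t \<in> {u \<in> S. wlen S (y + t + u) = Suc (wlen S (y + t))}" using minus_in[OF t(1)] t(2) y(2) by simp
    then have "up S (y + t) \<noteq> 0" unfolding up_def using finite_S by auto
    then show False using up_eq[OF yt] dn_c[OF yt] lv_a[OF yt] t(2) top by simp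
  qed
  have small: "f h \<le> L \<or> f (h + r) \<le> L" if "h \<in> gen T" for h
    using le[OF gen_add_base[OF gen_T_S[OF that] s_in]] wlen_index_two(2)[OF that] by (simp add: min_def split: if_splits)
  have anti': "f h + f (h + r) = e" if h: "h \<in> gen T" for h
    using small[OF h] anti[OF h] anti[OF hr_in[OF h]] L by (auto simp: hrr)
  show ?thesis unfolding linear_cay_def
  proof
    fix h assume h: "h \<in> gen T"
    show "dn T h = f h \<and> lv T h = (2 - 2) * f h"
    proof (cases "2 * f h \<le> e")
      case True
      then show ?thesis using initial_arrays[OF h] by simp
    next
      case False
      note hr = hr_in[OF h]
      have i: "2 * f (h + r) \<le> e" using False anti'[OF h] by linarith
      \<comment> \<open>Passing to the \<open>r\<close>-translate exchanges descents and ascents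
        over \<open>T\<close>, which reduces the outer half to the inner half.\<close>
      have t: "f (h + t) + f (h + r + t) = e" if "t \<in> T" for t using anti'[OF T_add[OF h that]] by (simp add: htr)
      have "Suc (f (h + t)) = f h \<longleftrightarrow> f (h + r + t) = Suc (f (h + r))" "f (h + t) = f h \<longleftrightarrow> f (h + r + t) = f (h + r)"
        if "t \<in> T" for t using t[OF that] anti'[OF h] by linarith+
      then have "dn T h = up T (h + r)" "lv T h = lv T (h + r)"
        unfolding dn_def up_def lv_def by (metis (mono_tags, lifting) Collect_cong)+
      then show ?thesis using up[OF hr i] initial_arrays[OF hr i] anti'[OF h] by simp
    qed
  qed
qed

text \<open>A geodesic has a tie at the middle level, and disjoint descents give c (l + 1) = 2 l + 2
  there. A vertex of level l without a tie would give l + 1, so all of them are tied. From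
  \<open>h + r\<close> with \<open>h\<close> of level l - 1 every generator descends; thus c (l + 1)
  is the degree, and \<open>card T = e\<close>.\<close>

lemma linear_cay_T_even:
  assumes e: "e = 2 * l"
  shows "linear_cay 2 T \<and> card T = e"
proof -
  obtain p where l: "l = Suc p" using e e_ge_3 by (cases l) auto
  obtain h1 where h1: "h1 \<in> gen T" "f h1 = l" "f (h1 + r) = l" using geodesic[of l] e by auto
  have cl: "c l = l" using c_initial e by simp
  have c_top: "c (Suc l) = 2 * l + 2"
  proof -
    have "Suc (f (h1 + r + t)) \<noteq> f h1" if "t \<in> T" "Suc (f (h1 + t)) = f h1" for t
      using sum_ge[OF T_add[OF h1(1) that(1)]] that(2) h1(2) e by (simp add: htr)
    from tie_c_eq[OF h1(1) _ this] show ?thesis using h1 cl by simp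
  qed
  have mid: "f (h + r) = e - l" if "h \<in> gen T" "f h = l" for h
  proof (rule ccontr)
    assume "f (h + r) \<noteq> e - l"
    then have "f h < f (h + r)" using sum_ge[OF that(1)] that(2) e by linarith
    then show False using near_c_Suc[OF that(1)] that(2) cl c_top by simp
  qed
  obtain h where h: "h \<in> gen T" "f h = p" "f (h + r) = Suc (Suc p)" using geodesic[of p] e l by auto
  note hr = hr_in[OF h(1)]
  have w: "wlen S (h + r) = Suc l" using wlen_index_two(1)[OF hr] h l by (simp add: hrr)
  have "min (f (h + r + t)) (f (h + t) + 2) = l" if t: "t \<in> T" for t
  proof -
    have "lv T h = 0" using initial_arrays[OF h(1)] h(2) e l by simp
    then have "f (h + t) \<noteq> p" using T.lv_eq_0D[OF _ t] h(2) by metis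
    then consider "f (h + t) = l" | "Suc (f (h + t)) = p" using f_step(1,2)[OF h(1) t] h(2) l by linarith
    then show ?thesis
    proof cases
      case 1
      then show ?thesis using mid[OF T_add[OF h(1) t]] e by (simp add: htr)
    next
      case 2
      then show ?thesis using sum_ge[OF T_add[OF h(1) t]] e l by (simp add: htr min_def)
    qed
  qed
  then have "{t \<in> T. Suc (min (f (h + r + t)) (f (h + t) + 2)) = Suc l} = T" by auto
  then have "dn S (h + r) = card T + 2"
    unfolding dn_def w using count_H[OF hr, of "\<lambda>d. Suc d = Suc l"] h l by (simp add: hrr)
  then have top: "c (Suc l) = card S" using dn_c[OF gen_T_S[OF hr]] w card_S_T by simp
  then have cT: "card T = e" using c_top card_S_T e by simp
  then show ?thesis using linear_cay_T[of l] e mid top by simp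
qed

text \<open>For \<open>h\<close> of level p on a geodesic, the level steps at \<open>h + s\<close>
  use the letters of the descents of \<open>h + r\<close>, and \<open>s\<close> in addition; so a (p
  + 1) = c (p + 1) + 1 = p + 2. A larger gap at level p would give a (p + 1) = a p = 0. Counting
  level steps at \<open>h + r\<close> with \<open>h\<close> of level p - 1 then shows that
  \<open>h\<close> has p + 2 ascents over \<open>T\<close>, whence
  \<open>card T = e\<close>.\<close>

lemma linear_cay_T_odd:
  assumes e: "e = 2 * p + 1"
  shows "linear_cay 2 T \<and> card T = e"
proof -
  obtain m where p: "p = Suc m" using e e_ge_3 by (cases p) auto
  have cp: "c (Suc p) = Suc p" using c_initial e by simp
  have ap: "a p = 0" using a_initial e by simp
  have a_top: "a (Suc p) = p + 2"
  proof -
    obtain h where h: "h \<in> gen T" "f h = p" "f (h + r) = Suc p" using geodesic[of p] e by auto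
    note hr = hr_in[OF h(1)]
    have w: "wlen S (h + s) = Suc p" "wlen S h = p" "wlen S (h + r) = Suc p"
      using wlen_index_two[OF h(1)] wlen_index_two(1)[OF hr] h by (simp_all add: hrr)
    have lv0: "lv T h = 0" using initial_arrays[OF h(1)] h(2) e by simp
    have "Suc (min (f (h + t)) (f (h + r + t))) = Suc p \<longleftrightarrow> Suc (min (f (h + r + t)) (f (h + t) + 2)) = Suc p" if t: "t \<in> T" for t
    proof -
      have "f (h + t) \<noteq> p" using T.lv_eq_0D[OF lv0 t] h(2) by simp
      then show ?thesis using sum_ge[OF T_add[OF h(1) t]] f_step(2)[OF h(1) t] h(2) e
        by (auto simp: htr min_def)
    qed
    then have eq: "{t \<in> T. Suc (min (f (h + t)) (f (h + r + t))) = Suc p}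
      = {t \<in> T. Suc (min (f (h + r + t)) (f (h + t) + 2)) = Suc p}" by blast
    have "card {t \<in> T. Suc (min (f (h + r + t)) (f (h + t) + 2)) = Suc p} = dn S (h + r)"
      unfolding dn_def w using count_H[OF hr, of "\<lambda>d. Suc d = Suc p"] h by (simp add: hrr)
    also have "\<dots> = Suc p" using dn_c[OF gen_T_S[OF hr]] w cp by simp
    finally have "lv S (h + s) = p + 2"
      unfolding lv_def w using count_s[OF h(1), of "\<lambda>d. d = Suc p"] w eq by simp
    then show ?thesis using lv_a[OF gen_add_base[OF gen_T_S[OF h(1)] s_in]] w by simp
  qed
  have mid: "f (h + r) = e - p" if "h \<in> gen T" "f h = p" for h
  proof (rule ccontr)
    assume "f (h + r) \<noteq> e - p"
    then have "f h + 2 \<le> f (h + r)" using sum_ge[OF that(1)] that(2) e by linarith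
    then show False using near_a_Suc[OF that(1)] that(2) ap a_top by simp
  qed
  obtain h where h: "h \<in> gen T" "f h = m" "f (h + r) = m + 3" using geodesic[of m] e p by auto
  note hr = hr_in[OF h(1)]
  have w: "wlen S (h + r) = Suc p" using wlen_index_two(1)[OF hr] h p by (simp add: hrr)
  have i: "2 * f h \<le> e" using h(2) e p by simp
  have "min (f (h + r + t)) (f (h + t) + 2) = Suc p \<longleftrightarrow> f (h + t) = Suc (f h)" if t: "t \<in> T" for t
  proof -
    have "f (h + t) \<noteq> m" using T.lv_eq_0D[OF initial_arrays(2)[OF h(1) i] t] h(2) by simp
    then consider "f (h + t) = p" | "Suc (f (h + t)) = m" using f_step(1,2)[OF h(1) t] h(2) p by linarith
    then show ?thesis
    proof cases
      case 1
      then show ?thesis using mid[OF T_add[OF h(1) t]] e p h(2) by (simp add: htr)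
    next
      case 2
      then show ?thesis using sum_ge[OF T_add[OF h(1) t]] e p h(2) by (auto simp: htr min_def)
    qed
  qed
  then have eq: "{t \<in> T. min (f (h + r + t)) (f (h + t) + 2) = Suc p} = {t \<in> T. f (h + t) = Suc (f h)}" by blast
  have "lv S (h + r) = up T h"
    unfolding lv_def up_def w using count_H[OF hr, of "\<lambda>d. d = Suc p"] h p eq by (simp add: hrr)
  then have "up T h = p + 2" using lv_a[OF gen_T_S[OF hr]] w a_top by simp
  then have cT: "card T = e" using T.up_eq[OF h(1)] initial_arrays[OF h(1) i] h(2) e p by simp
  then show ?thesis using linear_cay_T[of p] e mid card_S_T cp a_top by simp
qed

theorem linear_cay_T_folded: "linear_cay 2 T \<and> card T = e"
proof (cases "even e")
  case True
  then show ?thesis using linear_cay_T_even by (auto elim: evenE)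
next
  case False
  then show ?thesis using linear_cay_T_odd by (auto elim: oddE)
qed

end

section \<open>The folded cube as a Cayley graph\<close>

lemma hdist_Cons: "hdist (x # xs) (y # ys) = (if x = y then 0 else 1) + hdist xs ys"
  by (simp add: hdist_def)

lemma cube_Cons: "i # x \<in> pverts (hamming_graph (Suc d) 2) \<longleftrightarrow> i \<in> {0, 1} \<and> x \<in> pverts (hamming_graph d 2)"
  by (auto simp: pverts_cube)

lemma antipode_Cons: "antipode (i # x) = (1 - i) # antipode x"
  by (simp add: antipode_def)

context index_two_involution
begin

text \<open>As the length of \<open>r\<close> is the full dimension, the isomorphism turns
  \<open>h \<mapsto> h + r\<close> into \<open>antipode\<close>. Two coordinates are added for
  \<open>s\<close> and \<open>- s\<close>: flipping the first joins \<open>h\<close> and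
  \<open>h + s\<close>, while flipping the second and passing to the antipode joins \<open>h\<close>
  and \<open>h + r + s = h - s\<close>.\<close>

lemma cay_folded_cube:
  assumes iso: "is_isomorphic (cay T) (hamming_graph (f r) 2)"
  shows "is_isomorphic (cay S) (antipodal_quotient_hypercube (f r + 2))"
proof -
  let ?e = "f r"
  let ?Q = "pverts (hamming_graph ?e 2)" and ?C = "pverts (hamming_graph (?e + 2) 2)"
  obtain \<phi> where \<phi>: "bij_betw \<phi> (pverts (cay T)) ?Q"
    "\<forall>x\<in>pverts (cay T). \<forall>y\<in>pverts (cay T). (x, y) \<in> parcs (cay T) \<longleftrightarrow> (\<phi> x, \<phi> y) \<in> parcs (hamming_graph ?e 2)"
    using iso unfolding is_isomorphic_def by blast
  interpret CT: pair_graph "cay T" by (rule T.pair_graph_cay)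
  note V = cay_def[of T]
  have bij: "bij_betw \<phi> (gen T) ?Q" using \<phi>(1) by (simp add: V)
  have Q: "\<phi> x \<in> ?Q" if "x \<in> gen T" for x using bij that by (auto simp: bij_betw_def)
  have hd: "hdist (\<phi> x) (\<phi> y) = f (y - x)" if "x \<in> gen T" "y \<in> gen T" for x y
    using CT.gdist_eqI[OF is_distance_pullback[OF \<phi> T.pair_graph_cay pair_graph_cube is_distance_cube], of x y]
      CT.gdist_eqI[OF T.is_distance_cay, of x y] that by (simp add: V)
  have anti: "antipode (\<phi> x) = \<phi> (x + r)" if "x \<in> gen T" for x
    using hdist_eq_dim_iff[OF Q[OF that] Q[OF hr_in[OF that]]] hd[OF that hr_in[OF that]] by simp
  have eq_iff: "\<phi> x = \<phi> y \<longleftrightarrow> x = y" if "x \<in> gen T" "y \<in> gen T" for x y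
    using bij that by (auto simp: bij_betw_def inj_on_eq_iff)
  have full: "f x = ?e \<longleftrightarrow> x = r" if x: "x \<in> gen T" for x
    using hdist_eq_dim_iff[OF Q[OF gen_0] Q[OF x]] hd[OF gen_0 x] anti[OF gen_0] eq_iff[OF x r_in] by simp
  have le: "f x \<le> ?e" if x: "x \<in> gen T" for x
    using hdist_antipode[OF Q[OF gen_0] Q[OF x]] hd[OF gen_0 x] by simp
  \<comment> \<open>The first coordinate names the coset; the second is fixed as 0 to select one
    representative of each antipodal class.\<close>
  define v :: "nat \<Rightarrow> 'g \<Rightarrow> nat list" where "v i h = i # 0 # \<phi> h" for i h
  have vC: "v i h \<in> ?C" if "i \<in> {0, 1}" "h \<in> gen T" for i h
    using that Q by (simp add: v_def cube_Cons)
  define F where "F x = antipodal_class (if x \<in> gen T then v 0 x else v 1 (x - s))" for x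
  have F: "F h = antipodal_class (v 0 h)" "F (h + s) = antipodal_class (v 1 h)" if "h \<in> gen T" for h
    using that add_s_notin by (simp_all add: F_def)
  have hdv: "hdist (v i h) (v j k) = of_bool (i \<noteq> j) + f (k - h)"
    if "h \<in> gen T" "k \<in> gen T" for i j h k
    using hd[OF that] by (simp add: v_def hdist_Cons)
  have class_eq: "antipodal_class (v i h) = antipodal_class (v j k) \<longleftrightarrow> i = j \<and> h = k"
    if "i \<in> {0, 1}" "j \<in> {0, 1}" "h \<in> gen T" "k \<in> gen T" for i j h k
    using antipodal_class_eq_iff[OF vC[OF that(1,3)] vC[OF that(2,4)]] eq_iff[OF that(3,4)]
    by (auto simp: v_def antipode_Cons)
  have arc: "(antipodal_class (v i h), antipodal_class (v j k)) \<in> parcs (antipodal_quotient_hypercube (?e + 2)) \<longleftrightarrow>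
      (if i = j then k - h \<in> T else k = h \<or> k - h = r)"
    if ij: "i \<in> {0, 1}" "j \<in> {0, 1}" and hk: "h \<in> gen T" "k \<in> gen T" for i j h k
  proof -
    note kh = T.gen_diff[OF hk(2,1)]
    have "hdist (v i h) (antipode (v j k)) = ?e + 2 - hdist (v i h) (v j k)"
      using hdist_antipode[OF vC[OF ij(1) hk(1)] vC[OF ij(2) hk(2)]] by simp
    then have "(antipodal_class (v i h), antipodal_class (v j k)) \<in> parcs (antipodal_quotient_hypercube (?e + 2)) \<longleftrightarrow>
      \<not> (i = j \<and> h = k) \<and> (of_bool (i \<noteq> j) + f (k - h) = 1 \<or> of_bool (i \<noteq> j) + f (k - h) = ?e + 1)"
      using antipodal_quotient_arc_iff[OF vC[OF ij(1) hk(1)] vC[OF ij(2) hk(2)]] class_eq[OF ij hk] hdv[OF hk] le[OF kh]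
      by auto
    then show ?thesis
      using T.wlen_eq_1_iff[OF kh] wlen_eq_0_iff[OF kh] full[OF kh] le[OF kh] T.zero_notin by auto
  qed
  have S1: "k + s - h \<in> S \<longleftrightarrow> k = h \<or> k - h = r" "k - (h + s) \<in> S \<longleftrightarrow> k = h \<or> k - h = r"
    if "h \<in> gen T" "k \<in> gen T" for h k
  proof -
    have e: "k + s - h = (k - h) + s" by simp
    show 1: "k + s - h \<in> S \<longleftrightarrow> k = h \<or> k - h = r"
      unfolding e using add_s_in_S_iff[OF T.gen_diff[OF that(2,1)]] mr by simp
    have e: "k - (h + s) = - ((h - k) + s)" by simp
    have "h - k = r \<longleftrightarrow> k - h = r" by (metis minus_diff_eq mr)
    then show "k - (h + s) \<in> S \<longleftrightarrow> k = h \<or> k - h = r"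
      unfolding e minus_in_iff using add_s_in_S_iff[OF T.gen_diff[OF that]] mr by auto
  qed
  have S0: "k - h \<in> S \<longleftrightarrow> k - h \<in> T" if "h \<in> gen T" "k \<in> gen T" for h k
    using mem_S_iff_T[OF T.gen_diff[OF that(2,1)]] .
  have S0': "k + s - (h + s) = k - h" for h k by simp
  show ?thesis
  proof (rule is_isomorphicI[of F])
    have inj: "inj_on F (gen S)"
    proof (rule inj_onI)
      fix x y assume xy: "x \<in> gen S" "y \<in> gen S" "F x = F y"
      obtain h where h: "h \<in> gen T" "x = h \<or> x = h + s" using gen_S_cases[OF xy(1)] .
      obtain k where k: "k \<in> gen T" "y = k \<or> y = k + s" using gen_S_cases[OF xy(2)] .
      show "x = y" using h(2) k(2) xy(3) F[OF h(1)] F[OF k(1)] class_eq[OF _ _ h(1) k(1)] by auto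
    qed
    have "F ` gen S = antipodal_class ` ?C"
    proof (intro equalityI subsetI)
      fix P assume "P \<in> F ` gen S"
      then obtain x where x: "x \<in> gen S" "P = F x" by blast
      obtain h where h: "h \<in> gen T" "x = h \<or> x = h + s" using gen_S_cases[OF x(1)] .
      have "P = antipodal_class (v 0 h) \<or> P = antipodal_class (v 1 h)" using h(2) F[OF h(1)] x(2) by auto
      then show "P \<in> antipodal_class ` ?C" using vC[OF _ h(1)] by blast
    next
      fix P assume "P \<in> antipodal_class ` ?C"
      then obtain z where z: "z \<in> ?C" "P = antipodal_class z" by blast
      then obtain i j y where "z = i # j # y" by (auto simp: pverts_cube length_Suc_conv)
      then have ijy: "z = i # j # y" "i \<in> {0, 1}" "j \<in> {0, 1}" "y \<in> ?Q" using z(1) by (simp_all add: cube_Cons)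
      obtain h where h: "h \<in> gen T" "y = \<phi> h" using bij ijy(4) by (auto simp: bij_betw_def)
      \<comment> \<open>A vertex with second coordinate 1 is exchanged for its antipode, at the
        price of replacing \<open>h\<close> by \<open>h + r\<close>.\<close>
      have "\<exists>i\<in>{0, 1}. \<exists>h\<in>gen T. z = v i h \<or> z = antipode (v i h)"
      proof (cases "j = 0")
        case True
        then show ?thesis using ijy h unfolding v_def by blast
      next
        case False
        have "\<phi> (h + r + r) = \<phi> h" by (simp add: hrr)
        then have "z = antipode (v (1 - i) (h + r))"
          using False ijy h anti[OF hr_in[OF h(1)]] by (auto simp: v_def antipode_Cons)
        then show ?thesis using ijy(2) hr_in[OF h(1)] by (intro bexI[of _ "1 - i"] bexI[of _ "h + r"]) auto
      qed
      then obtain i h where ih: "i \<in> {0, 1}" "h \<in> gen T" "z = v i h \<or> z = antipode (v i h)" by blast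
      then have "P = antipodal_class (v i h)"
        using z antipode_antipode[OF vC[OF ih(1,2)]] by (auto simp: antipodal_class_def)
      then have "P = F h \<or> P = F (h + s)" using F[OF ih(2)] ih(1) by auto
      then show "P \<in> F ` gen S" using gen_T_S[OF ih(2)] gen_add_base[OF gen_T_S[OF ih(2)] s_in] by blast
    qed
    then show "bij_betw F (pverts (cay S)) (pverts (antipodal_quotient_hypercube (?e + 2)))"
      using inj by (simp add: bij_betw_def cay_def antipodal_quotient_eq(1))
    fix x y assume "x \<in> pverts (cay S)" "y \<in> pverts (cay S)"
    then have xy: "x \<in> gen S" "y \<in> gen S" by (simp_all add: cay_def)
    obtain h where h: "h \<in> gen T" "x = h \<or> x = h + s" using gen_S_cases[OF xy(1)] .
    obtain k where k: "k \<in> gen T" "y = k \<or> y = k + s" using gen_S_cases[OF xy(2)] .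
    have "(x, y) \<in> parcs (cay S) \<longleftrightarrow> y - x \<in> S" using xy by (simp add: cay_def)
    also have "\<dots> \<longleftrightarrow> (F x, F y) \<in> parcs (antipodal_quotient_hypercube (?e + 2))"
      using h(2) k(2) S1[OF h(1) k(1)] S0[OF h(1) k(1)] arc[OF _ _ h(1) k(1)] F[OF h(1)] F[OF k(1)]
      by (elim disjE) (simp_all only: S0', simp_all)
    finally show "(x, y) \<in> parcs (cay S) \<longleftrightarrow> (F x, F y) \<in> parcs (antipodal_quotient_hypercube (?e + 2))" .
  qed
qed

end

section \<open>Small graphs\<close>

primrec multiple :: "'g::ab_group_add \<Rightarrow> nat \<Rightarrow> 'g" where
  "multiple s 0 = 0"
| "multiple s (Suc k) = multiple s k + s"

lemma multiple_add: "multiple s (j + k) = multiple s j + multiple s k"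
  by (induction k) (simp_all add: add.assoc)

text \<open>\<open>l + (n - k)\<close> is the difference \<open>l - k\<close> modulo
  \<open>n\<close>, without negative numbers. In this concrete model small graphs can be compared by
  cases.\<close>

definition circulant :: "nat \<Rightarrow> nat set \<Rightarrow> nat pair_pre_digraph" where
  "circulant n J = \<lparr>pverts = {..<n}, parcs = {(k, l). k < n \<and> l < n \<and> (l + (n - k)) mod n \<in> J}\<rparr>"

text \<open>\<open>s\<close> has order \<open>n\<close> and is itself a generator, so
  \<open>gen S\<close> consists of the multiples of \<open>s\<close>, indexed by residues.\<close>

lemma cay_circulant:
  assumes n: "n > 0" "multiple s n = 0" and nz: "\<And>k. 0 < k \<Longrightarrow> k < n \<Longrightarrow> multiple s k \<noteq> 0"
    and J: "J \<subseteq> {..<n}" and S: "S = multiple s ` J" "s \<in> S"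
  shows "is_isomorphic (cay S) (circulant n J)"
proof (rule is_isomorphic_sym, rule is_isomorphicI[of "multiple s"])
  have mod: "multiple s (k mod n) = multiple s k" for k
  proof -
    have "multiple s (n * q) = 0" for q by (induction q) (simp_all add: multiple_add n)
    then have "multiple s (n * (k div n) + k mod n) = multiple s (k mod n)" by (simp only: multiple_add) simp
    then show ?thesis by simp
  qed
  have diff: "multiple s l - multiple s k = multiple s (l + (n - k))" if "k \<le> n" for k l
  proof -
    have "multiple s (n - k) + multiple s k = 0" using multiple_add[of s "n - k" k] that n by simp
    then have "multiple s (n - k) = - multiple s k" by (simp add: eq_neg_iff_add_eq_0)
    then show ?thesis by (simp add: multiple_add)
  qed
  have inj: "inj_on (multiple s) {..<n}"
  proof (rule linorder_inj_onI)
    fix k l :: nat assume kl: "k < l" "k \<in> {..<n}" "l \<in> {..<n}"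
    have "multiple s l = multiple s (l - k) + multiple s k" using multiple_add[of s "l - k" k] kl by simp
    then show "multiple s k \<noteq> multiple s l" using nz[of "l - k"] kl by simp
  qed auto
  have in_gen: "multiple s k \<in> gen S" for k by (induction k) (simp_all add: gen_0 gen_add_base[OF _ S(2)])
  have "gen S \<subseteq> multiple s ` {..<n}"
  proof (rule gen_minimal)
    show "0 \<in> multiple s ` {..<n}" using n by (intro image_eqI[of _ _ 0]) auto
    fix x t assume "x \<in> multiple s ` {..<n}" "t \<in> S"
    then obtain k j where "x = multiple s k" "t = multiple s j" using S by blast
    then have "t + x = multiple s ((j + k) mod n)" by (simp only: mod multiple_add)
    then show "t + x \<in> multiple s ` {..<n}" using n by simp
  qed
  then have g: "multiple s ` {..<n} = gen S" using in_gen by blast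
  show "bij_betw (multiple s) (pverts (circulant n J)) (pverts (cay S))"
    using inj g by (simp add: bij_betw_def circulant_def cay_def)
  fix k l assume kl: "k \<in> pverts (circulant n J)" "l \<in> pverts (circulant n J)"
  have "(multiple s k, multiple s l) \<in> parcs (cay S) \<longleftrightarrow> multiple s ((l + (n - k)) mod n) \<in> multiple s ` J"
    using kl S in_gen diff[of k l] by (simp add: cay_def circulant_def mod)
  also have "\<dots> \<longleftrightarrow> (l + (n - k)) mod n \<in> J"
    by (rule inj_on_image_mem_iff[OF inj _ J]) (use n in simp)
  finally show "(k, l) \<in> parcs (circulant n J) \<longleftrightarrow> (multiple s k, multiple s l) \<in> parcs (cay S)"
    using kl by (simp add: circulant_def)
qed

lemma circulant_cycle: 
  assumes "3 \<le> n"
  shows "circulant n {1, n - 1} = cycle_graph n"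
proof -
  have "(l + (n - k)) mod n \<in> {1, n - 1} \<longleftrightarrow> l = (k + 1) mod n \<or> k = (l + 1) mod n"
    if "k < n" "l < n" for k l
  proof -
    have m: "(l + (n - k)) mod n = (if k \<le> l then l - k else l + (n - k))"
    proof (cases "k \<le> l")
      case True
      then have "l + (n - k) = (l - k) + n" using that by simp
      then show ?thesis using that True by (simp only: mod_add_self2) simp
    qed (use that in simp)
    have s: "(k + 1) mod n = (if k + 1 = n then 0 else k + 1)" if "k < n" for k using that by auto
    show ?thesis unfolding m s[OF that(1)] s[OF that(2)] using that assms by auto
  qed
  then have "{(k, l). k < n \<and> l < n \<and> (l + (n - k)) mod n \<in> {1, n - 1}}
    = {(k, l). k < n \<and> l < n \<and> (l = (k + 1) mod n \<or> k = (l + 1) mod n)}" by blast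
  then show ?thesis by (simp only: circulant_def cycle_graph_def)
qed

lemma lessThan_6: "{..<6::nat} = {0, 1, 2, 3, 4, 5}"
  by (simp add: lessThan_Suc numeral_eq_Suc insert_commute)

text \<open>All odd differences are edges, so the parts are the residue classes modulo 2.\<close>

lemma circulant_K33: "is_isomorphic (circulant 6 {1, 3, 5}) (complete_multipartite [3, 3])"
proof (rule is_isomorphicI[of "\<lambda>k. (k mod 2, k div 2)"])
  have V: "pverts (complete_multipartite [3, 3]) = (\<lambda>k. (k mod 2, k div 2)) ` {..<6}"
    unfolding complete_multipartite_eq(1) lessThan_6 by (simp add: part_vertices_def upt_rec) (auto simp: numeral_2_eq_2)
  have "inj_on (\<lambda>k. (k mod 2, k div 2)) {..<6::nat}" unfolding inj_on_def lessThan_6 by simp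
  then show "bij_betw (\<lambda>k. (k mod 2, k div 2)) (pverts (circulant 6 {1, 3, 5})) (pverts (complete_multipartite [3, 3]))"
    unfolding V by (simp add: bij_betw_def circulant_def)
  fix k l assume "k \<in> pverts (circulant 6 {1, 3, 5})" "l \<in> pverts (circulant 6 {1, 3, 5})"
  then have kl: "k \<in> {..<6}" "l \<in> {..<6}" by (simp_all add: circulant_def)
  have "(k, l) \<in> parcs (circulant 6 {1, 3, 5}) \<longleftrightarrow> k mod 2 \<noteq> l mod 2"
    using kl unfolding lessThan_6 by (elim insertE emptyE) (simp_all add: circulant_def)
  also have "\<dots> \<longleftrightarrow> ((k mod 2, k div 2), (l mod 2, l div 2)) \<in> parcs (complete_multipartite [3, 3])"
    using imageI[OF kl(1), of "\<lambda>k. (k mod 2, k div 2)"] imageI[OF kl(2), of "\<lambda>k. (k mod 2, k div 2)"]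
    unfolding V[symmetric] by (simp add: complete_multipartite_def Let_def)
  finally show "(k, l) \<in> parcs (circulant 6 {1, 3, 5}) \<longleftrightarrow>
      ((k mod 2, k div 2), (l mod 2, l div 2)) \<in> parcs (complete_multipartite [3, 3])" .
qed

text \<open>All differences prime to 3 are edges, so the parts are the residue classes modulo
  3.\<close>

lemma circulant_K222: "is_isomorphic (circulant 6 {1, 2, 4, 5}) (complete_multipartite [2, 2, 2])"
proof (rule is_isomorphicI[of "\<lambda>k. (k mod 3, k div 3)"])
  have V: "pverts (complete_multipartite [2, 2, 2]) = (\<lambda>k. (k mod 3, k div 3)) ` {..<6}"
    unfolding complete_multipartite_eq(1) lessThan_6 by (simp add: part_vertices_def upt_rec) (auto simp: numeral_2_eq_2)
  have "inj_on (\<lambda>k. (k mod 3, k div 3)) {..<6::nat}" unfolding inj_on_def lessThan_6 by simp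
  then show "bij_betw (\<lambda>k. (k mod 3, k div 3)) (pverts (circulant 6 {1, 2, 4, 5})) (pverts (complete_multipartite [2, 2, 2]))"
    unfolding V by (simp add: bij_betw_def circulant_def)
  fix k l assume "k \<in> pverts (circulant 6 {1, 2, 4, 5})" "l \<in> pverts (circulant 6 {1, 2, 4, 5})"
  then have kl: "k \<in> {..<6}" "l \<in> {..<6}" by (simp_all add: circulant_def)
  have "(k, l) \<in> parcs (circulant 6 {1, 2, 4, 5}) \<longleftrightarrow> k mod 3 \<noteq> l mod 3"
    using kl unfolding lessThan_6 by (elim insertE emptyE) (simp_all add: circulant_def)
  also have "\<dots> \<longleftrightarrow> ((k mod 3, k div 3), (l mod 3, l div 3)) \<in> parcs (complete_multipartite [2, 2, 2])"
    using imageI[OF kl(1), of "\<lambda>k. (k mod 3, k div 3)"] imageI[OF kl(2), of "\<lambda>k. (k mod 3, k div 3)"]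
    unfolding V[symmetric] by (simp add: complete_multipartite_def Let_def)
  finally show "(k, l) \<in> parcs (circulant 6 {1, 2, 4, 5}) \<longleftrightarrow>
      ((k mod 3, k div 3), (l mod 3, l div 3)) \<in> parcs (complete_multipartite [2, 2, 2])" .
qed

text \<open>The sides are the subgroup \<open>E\<close> and its coset by the involution
  \<open>e\<close>. As \<open>e\<close> is the only element of that coset missing from
  \<open>S\<close>, the removed matching joins \<open>x\<close> and \<open>x + e\<close>.\<close>

lemma cay_complete_bipartite_minus_matching:
  fixes E :: "'g::ab_group_add set"
  assumes E: "finite E" "0 \<in> E" "\<And>x y. x \<in> E \<Longrightarrow> y \<in> E \<Longrightarrow> x - y \<in> E"
    and e: "e + e = 0" "e \<notin> E" and S: "S = (\<lambda>x. x + e) ` (E - {0})" and g: "gen S = E \<union> (\<lambda>x. x + e) ` E"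
  shows "is_isomorphic (cay S) (complete_bipartite_minus_matching (card E))"
proof -
  obtain b where b: "bij_betw b E {0..<card E}" using ex_bij_betw_finite_nat[OF E(1)] by blast
  have bi: "b x = b y \<longleftrightarrow> x = y" if "x \<in> E" "y \<in> E" for x y using b that by (auto simp: bij_betw_def inj_on_eq_iff)
  have bl: "b x < card E" if "x \<in> E" for x using b that by (auto simp: bij_betw_def)
  have me: "- e = e" using e(1) by (simp add: neg_eq_iff_add_eq_0)
  have xee: "x + e + e = x" for x using e(1) by (simp add: add.assoc)
  have xe: "x + e \<notin> E" if "x \<in> E" for x
  proof
    assume "x + e \<in> E"
    then have "x + e - x \<in> E" using E(3) that by blast
    then show False using e(2) by simp
  qed
  define F where "F x = (if x \<in> E then (0 :: nat, b x) else (1, b (x + e)))" for x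
  have F: "F x = (0, b x)" "F (x + e) = (1, b x)" if "x \<in> E" for x
    using that xe[OF that] by (simp_all add: F_def xee)
  let ?K = "complete_bipartite_minus_matching (card E)"
  have V: "pverts ?K = {(i, j). i < 2 \<and> j < card E}"
    by (auto simp: complete_bipartite_minus_matching_def complete_multipartite_def less_Suc_eq numeral_2_eq_2)
  have A: "(u, v) \<in> parcs ?K \<longleftrightarrow> u \<in> pverts ?K \<and> v \<in> pverts ?K \<and> fst u \<noteq> fst v \<and> snd u \<noteq> snd v" for u v
    by (auto simp: complete_bipartite_minus_matching_def complete_multipartite_def Let_def)
  have cases: "\<exists>h\<in>E. x = h \<or> x = h + e" if "x \<in> gen S" for x using that g by auto
  have SE: "x \<notin> S" if "x \<in> E" for x using that xe S by auto
  have SE': "x + e \<in> S \<longleftrightarrow> x \<noteq> 0" if "x \<in> E" for x using that S by auto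
  show ?thesis
  proof (rule is_isomorphicI[of F])
    have inj: "inj_on F (gen S)"
    proof (rule inj_onI)
      fix x y assume xy: "x \<in> gen S" "y \<in> gen S" "F x = F y"
      obtain h k where h: "h \<in> E" "x = h \<or> x = h + e" and k: "k \<in> E" "y = k \<or> y = k + e"
        using cases[OF xy(1)] cases[OF xy(2)] by blast
      then show "x = y" using xy(3) F[OF h(1)] F[OF k(1)] bi[OF h(1) k(1)] by auto
    qed
    have "F ` gen S = F ` E \<union> (\<lambda>x. F (x + e)) ` E" unfolding g by (simp add: image_Un image_image)
    also have "\<dots> = Pair 0 ` b ` E \<union> Pair 1 ` b ` E" using F by (simp add: image_image)
    also have "b ` E = {0..<card E}" using b by (simp add: bij_betw_def)
    finally have "F ` gen S = pverts ?K" unfolding V by (auto simp: less_2_cases_iff)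
    then show "bij_betw F (pverts (cay S)) (pverts ?K)" using inj by (simp add: bij_betw_def cay_def)
    fix x y assume "x \<in> pverts (cay S)" "y \<in> pverts (cay S)"
    then have xy: "x \<in> gen S" "y \<in> gen S" by (simp_all add: cay_def)
    obtain h where h: "h \<in> E" "x = h \<or> x = h + e" using cases[OF xy(1)] by blast
    obtain k where k: "k \<in> E" "y = k \<or> y = k + e" using cases[OF xy(2)] by blast
    note kh = E(3)[OF k(1) h(1)]
    have "x - e = x + e" for x using me by (metis diff_conv_add_uminus)
    then have d: "k + e - h = (k - h) + e" "k + e - (h + e) = k - h" "k - (h + e) = (k - h) + e"
      by (simp_all add: diff_diff_eq[symmetric])
    have Sd: "k - h \<notin> S" "(k - h) + e \<in> S \<longleftrightarrow> k \<noteq> h" using SE[OF kh] SE'[OF kh] by simp_all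
    have "(x, y) \<in> parcs (cay S) \<longleftrightarrow> y - x \<in> S" using xy by (simp add: cay_def)
    also have "\<dots> \<longleftrightarrow> (F x, F y) \<in> parcs ?K"
      unfolding A V using h(2) k(2) F[OF h(1)] F[OF k(1)] bi[OF h(1) k(1)] bl[OF h(1)] bl[OF k(1)] Sd
      by (elim disjE) (simp_all only: d, auto)
    finally show "(x, y) \<in> parcs (cay S) \<longleftrightarrow> (F x, F y) \<in> parcs ?K" .
  qed
qed

section \<open>The classification\<close>

definition listed :: "'a pair_pre_digraph \<Rightarrow> bool" where
  "listed \<Gamma> \<longleftrightarrow>
      is_isomorphic \<Gamma> (complete_multipartite [3, 3])
    \<or> is_isomorphic \<Gamma> (complete_multipartite [2, 2, 2])
    \<or> is_isomorphic \<Gamma> (complete_bipartite_minus_matching 6)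
    \<or> (\<exists>n\<ge>3. is_isomorphic \<Gamma> (cycle_graph n))
    \<or> (\<exists>d\<ge>1. \<exists>n\<in>{2, 3, 4}. is_isomorphic \<Gamma> (hamming_graph d n))
    \<or> (\<exists>n\<ge>1. \<exists>m\<ge>1. is_isomorphic \<Gamma> (doob_graph n m))
    \<or> (\<exists>d\<ge>2. is_isomorphic \<Gamma> (antipodal_quotient_hypercube d))"

lemma listedI:
  "is_isomorphic \<Gamma> (complete_multipartite [3, 3]) \<Longrightarrow> listed \<Gamma>"
  "is_isomorphic \<Gamma> (complete_multipartite [2, 2, 2]) \<Longrightarrow> listed \<Gamma>"
  "is_isomorphic \<Gamma> (complete_bipartite_minus_matching 6) \<Longrightarrow> listed \<Gamma>"
  "n \<ge> 3 \<Longrightarrow> is_isomorphic \<Gamma> (cycle_graph n) \<Longrightarrow> listed \<Gamma>"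
  "i \<ge> 1 \<Longrightarrow> q = 2 \<or> q = 3 \<or> q = 4 \<Longrightarrow> is_isomorphic \<Gamma> (hamming_graph i q) \<Longrightarrow> listed \<Gamma>"
  "i \<ge> 1 \<Longrightarrow> j \<ge> 1 \<Longrightarrow> is_isomorphic \<Gamma> (doob_graph i j) \<Longrightarrow> listed \<Gamma>"
  "d \<ge> 2 \<Longrightarrow> is_isomorphic \<Gamma> (antipodal_quotient_hypercube d) \<Longrightarrow> listed \<Gamma>"
  unfolding listed_def by blast+

lemma listed_isomorphic:
  assumes "is_isomorphic \<Gamma> \<Delta>" "listed \<Delta>"
  shows "listed \<Gamma>"
  using assms(2) is_isomorphic_trans[OF assms(1)] unfolding listed_def by metis

text \<open>\<open>0 < i\<close> excludes the powers of the Shrikhande graph, which the family of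
  Doob graphs with \<open>n \<ge> 1\<close> leaves out.\<close>

lemma listed_hamming_shrikhande:
  assumes iso: "is_isomorphic \<Gamma> (hamming_shrikhande q i j)"
    and q: "q = 2 \<or> q = 3 \<or> q = 4" "q = 4 \<or> j = 0" and i: "0 < i"
  shows "listed \<Gamma>"
proof (cases "j = 0")
  case True
  have "is_isomorphic \<Gamma> (hamming_graph i q)"
    using is_isomorphic_trans[OF iso[unfolded True] is_isomorphic_sym[OF hamming_shrikhande_0]] .
  from listedI(5)[OF _ q(1) this] i show ?thesis by simp
next
  case False
  then show ?thesis using listedI(6)[of i j] iso q i by (simp add: doob_graph_def)
qed

lemma (in cayley) listed_linear:
  assumes lin: "linear_cay q S" and q: "q = 2 \<or> q = 3" and "S \<noteq> {}"
  shows "listed (cay S)"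
proof (rule linear_cay_classification[OF lin, where P = "{}"])
  fix i j assume ij: "q = 4 \<or> j = 0" "card S = (q - 1) * (i + 2 * j)" "is_isomorphic (cay S) (hamming_shrikhande q i j)"
  have "j = 0" "card S \<noteq> 0" using ij(1) q assms(3) finite_S by auto
  then have "0 < i" using ij(2) by (cases i) auto
  from listed_hamming_shrikhande[OF ij(3) _ ij(1) this] q show "listed (cay S)" by blast
qed (use q in auto)

lemma multiple_simps:
  "multiple s (Suc 0) = s" "multiple s 2 = s + s" "multiple s 3 = s + s + s" "multiple s 4 = s + s + s + s"
  "multiple s 5 = s + s + s + s + s" "multiple s 6 = s + s + s + s + s + s"
  by (simp_all add: numeral_eq_Suc)

lemma less_6_cases: "k < (6::nat) \<Longrightarrow> 0 < k \<Longrightarrow> k = 1 \<or> k = 2 \<or> k = 3 \<or> k = 4 \<or> k = 5"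
  by linarith

section \<open>The cyclic case, and \<open>s + s\<close> outside \<open>gen T\<close>\<close>

context split_cayley
begin

lemma listed_cyclic:
  assumes "T = {}" and ss: "s + s \<noteq> 0"
  shows "listed (cay S)"
proof -
  have S: "S = {s, - s}" using S_eq assms(1) by simp
  have g: "multiple s k \<in> gen S" for k by (induction k) (simp_all add: gen_0 gen_add_base[OF _ s_in])
  have "\<exists>n>0. multiple s n = 0"
  proof -
    have "\<not> inj (multiple s)" using g finite_gen by (metis finite_imageD finite_subset image_subsetI infinite_UNIV_nat)
    then obtain k l where kl: "k < l" "multiple s k = multiple s l" unfolding inj_def by (metis nat_neq_iff)
    have "multiple s l = multiple s (l - k) + multiple s k" using multiple_add[of s "l - k" k] kl(1) by simp
    then show ?thesis using kl by (intro exI[of _ "l - k"]) simp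
  qed
  then obtain n where n: "n > 0" "multiple s n = 0" and min: "\<And>k. 0 < k \<Longrightarrow> k < n \<Longrightarrow> multiple s k \<noteq> 0"
    using exists_least_iff[of "\<lambda>n. n > 0 \<and> multiple s n = 0"] by blast
  have "n \<noteq> 1" "n \<noteq> 2" using n s_neq_0 ss by (auto simp: multiple_simps)
  then have n3: "3 \<le> n" using n(1) by linarith
  have "multiple s (n - 1) + s = 0" using n by (metis Suc_diff_1 multiple.simps(2))
  then have "multiple s (n - 1) = - s" by (simp add: eq_neg_iff_add_eq_0)
  then have "S = multiple s ` {1, n - 1}" by (simp add: S multiple_simps)
  from cay_circulant[OF n min _ this s_in] show ?thesis
    using n3 listedI(4)[OF n3] circulant_cycle[OF n3] by simp
qed

text \<open>Besides \<open>s\<close> and \<open>t\<close> in both orders, \<open>s + t\<close> can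
  only be \<open>(- s) + (- s)\<close>, which means that \<open>t\<close> is -3 times
  \<open>s\<close>.\<close>

lemma sols_s_T:
  assumes ss: "s + s \<notin> gen T" and t: "t \<in> T"
  shows "c 2 = 2 + of_bool (t = - (s + s + s))"
proof -
  have tH: "t \<in> gen T" by (rule gen_base[OF t])
  have s2: "s \<noteq> - s" using ss gen_0[of T] by (metis add.right_inverse)
  have shift: "s + h \<in> S \<longleftrightarrow> h = 0" if h: "h \<in> gen T" for h
  proof -
    have "s + h \<notin> gen T" using T.gen_add_iff[OF h] s_notin by blast
    then have "s + h \<notin> T" using gen_base by blast
    moreover have "s + h \<noteq> - s"
    proof
      assume "s + h = - s"
      then have "s + s = - h" by (simp add: eq_neg_iff_add_eq_0 add_ac)
      then show False using ss T.gen_minus[OF h] by simp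
    qed
    ultimately show ?thesis using S_eq by auto
  qed
  have "s + t - u \<in> S \<longleftrightarrow> u = t" if "u \<in> T" for u
    using shift[OF T.gen_diff[OF tH gen_base[OF that]]] unfolding add_diff_eq by auto
  then have "{u \<in> T. s + t - u \<in> S} = {t}" using t by auto
  moreover have "s + t - s \<in> S" using T_S[OF t] by simp
  moreover have "s + t - - s \<in> S \<longleftrightarrow> t = - (s + s + s)"
  proof -
    have e: "s + t - - s = s + s + t" by (simp add: add_ac)
    have "s + s + t \<notin> gen T" using T.gen_add_iff[OF tH] ss by blast
    then have "s + s + t \<in> S \<longleftrightarrow> s + s + t = s \<or> s + s + t = - s" using S_eq gen_base[of _ T] by blast
    moreover have "s + s + t \<noteq> s"
    proof
      assume "s + s + t = s"
      then have "s = - t" by (simp add: eq_neg_iff_add_eq_0 add.assoc)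
      then show False using s_notin T.gen_minus[OF tH] by simp
    qed
    moreover have "s + s + t = - s \<longleftrightarrow> t = - (s + s + s)" by (simp only: eq_neg_iff_add_eq_0 add_ac)
    ultimately show ?thesis unfolding e by blast
  qed
  ultimately have sols: "sols S (s + t) = 2 + of_bool (t = - (s + s + s))"
    unfolding sols_def card_S_split using s2 by simp
  have "t \<noteq> 0" using t T.zero_notin by auto
  then have n: "s + t \<notin> S" using shift[OF tH] by simp
  have "s + t \<noteq> 0" using T.gen_add_iff[OF tH, of s] s_notin gen_0[of T] by metis
  then have w: "wlen S (s + t) = 2" using wlen_eq_2I[of s "s + t"] s_in T_S[OF t] n by simp
  have "s + t \<in> gen S" using gen_add[OF gen_base[OF s_in] gen_T_S[OF tH]] .
  then show ?thesis using dn_c[of "s + t"] dn_2[of "s + t"] w sols by simp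
qed

text \<open>\<open>s + s\<close> may also be 3s and \<open>- s\<close> in both orders, or
  \<open>(- s) + (- s)\<close>. That 3s is nonzero keeps \<open>s + s\<close> out of
  \<open>S\<close>, so its length is 2.\<close>

lemma sols_double:
  assumes ss: "s + s \<notin> gen T" and s3: "s + s + s \<noteq> 0"
  shows "c 2 = 1 + 2 * of_bool (s + s + s \<in> T) + of_bool (s + s + s + s = 0)"
proof -
  have s2: "s \<noteq> - s" using ss gen_0[of T] by (metis add.right_inverse)
  have ssT: "s + s - u \<notin> T" if "u \<in> gen T" for u
    using T.gen_add_iff[OF T.gen_minus[OF that], of "s + s"] ss gen_base[of "s + s - u" T] by auto
  have ne: "s + s - u \<noteq> s" if "u \<in> gen T" for u
  proof
    assume "s + s - u = s"
    then have "s = u" by (simp add: algebra_simps)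
    then show False using s_notin that by simp
  qed
  have eq: "s + s - u = - s \<longleftrightarrow> u = s + s + s" for u
    by (auto simp: algebra_simps eq_neg_iff_add_eq_0)
  have "s + s - u \<in> S \<longleftrightarrow> u = s + s + s" if "u \<in> T" for u
    using S_eq ssT[OF gen_base[OF that]] ne[OF gen_base[OF that]] eq by blast
  then have "{u \<in> T. s + s - u \<in> S} = (if s + s + s \<in> T then {s + s + s} else {})" by auto
  then have "card {u \<in> T. s + s - u \<in> S} = of_bool (s + s + s \<in> T)" by simp
  moreover have "s + s - s \<in> S" using s_in by simp
  moreover have "s + s - - s \<in> S \<longleftrightarrow> s + s + s \<in> T \<or> s + s + s + s = 0"
  proof -
    have "s + s \<noteq> 0" using ss gen_0[of T] by metis
    then have "s + s + s \<noteq> s" by simp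
    moreover have "s + s + s = - s \<longleftrightarrow> s + s + s + s = 0" by (rule eq_neg_iff_add_eq_0)
    ultimately show ?thesis using S_eq by auto
  qed
  moreover have "\<not> (s + s + s \<in> T \<and> s + s + s + s = 0)"
    using ms_notin gen_base[of "s + s + s" T] eq_neg_iff_add_eq_0[of "s + s + s" s] by auto
  ultimately have sols: "sols S (s + s) = 1 + 2 * of_bool (s + s + s \<in> T) + of_bool (s + s + s + s = 0)"
    unfolding sols_def card_S_split using s2 by auto
  have n: "s + s \<notin> S" using ssT[OF gen_0] ne[OF gen_0] eq[of 0] s3 S_eq by auto
  have "s + s \<noteq> 0" using ss gen_0[of T] by metis
  then have w: "wlen S (s + s) = 2" using wlen_eq_2I[of s "s + s"] s_in n by simp
  have "s + s \<in> gen S" using gen_add gen_base[OF s_in] by blast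
  then show ?thesis using dn_c[of "s + s"] dn_2[of "s + s"] w sols by simp
qed

text \<open>If 3s is nonzero, two evaluations of \<open>c 2\<close> can be compared. For 3s outside
  \<open>T\<close> they force 4s = 0, a 4-cycle factor. For 3s in \<open>T\<close> every element of
  \<open>T\<close> must be -3s, so \<open>T\<close> is a single involution, \<open>s\<close> has
  order 6, and K_{3,3} appears.\<close>

lemma listed_product:
  assumes ss: "s + s \<notin> gen T" and T: "T \<noteq> {}"
  shows "listed (cay S)"
proof -
  have s2: "s \<noteq> - s" using ss gen_0[of T] by (metis add.right_inverse)
  have "S \<noteq> {}" using s_in by blast
  note lin = listed_linear[OF _ _ this]
  show ?thesis
  proof (cases "s + s + s = 0")
    case True
    then show ?thesis using lin linear_product_3 s2 by blast
  next
    case s3: False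
    have c2: "2 + of_bool (t = - (s + s + s)) = 1 + 2 * of_bool (s + s + s \<in> T) + (of_bool (s + s + s + s = 0) :: nat)"
      if "t \<in> T" for t using sols_s_T[OF ss that] sols_double[OF ss s3] by simp
    show ?thesis
    proof (cases "s + s + s \<in> T")
      case False
      then have "- (s + s + s) \<notin> T" using T.minus_in_iff by blast
      then have "s + s + s + s = 0" using False c2 T by (auto split: if_splits)
      then show ?thesis using lin linear_product_4 s2 ss by blast
    next
      case True
      have s4: "s + s + s + s \<noteq> 0"
        using ms_notin gen_base[OF True] eq_neg_iff_add_eq_0[of "s + s + s" s] by auto
      have all: "t = - (s + s + s)" if "t \<in> T" for t
        by (rule ccontr) (use c2[OF that] True s4 in simp)
      have w: "- (s + s + s) = s + s + s" by (rule sym, rule all, rule True)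
      have "t \<in> {s + s + s}" if "t \<in> T" for t using all[OF that] unfolding w by (simp only: singleton_iff)
      then have T3: "T = {s + s + s}" using True by blast
      have "s + s + s + (s + s + s) = 0" using w by (simp only: neg_eq_iff_add_eq_0)
      then have s6: "s + s + s + s + s + s = 0" by (simp only: add.assoc)
      then have s5: "s + s + s + s + s = - s" by (simp only: eq_neg_iff_add_eq_0)
      have "S = multiple s ` {1, 3, 5}" using S_eq T3 s5 by (auto simp: multiple_simps)
      moreover have "multiple s k \<noteq> 0" if "0 < k" "k < 6" for k
      proof -
        have "s + s \<noteq> 0" using ss gen_0[of T] by metis
        then show ?thesis using less_6_cases[OF that(2,1)] s_neq_0 s3 s4 s5 by (auto simp: multiple_simps)
      qed
      moreover have "multiple s 6 = 0" "{1, 3, 5} \<subseteq> {..<6::nat}" using s6 by (simp_all add: multiple_simps)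
      ultimately have "is_isomorphic (cay S) (circulant 6 {1, 3, 5})"
        using cay_circulant[of 6 s "{1, 3, 5}" S] s_in by simp
      then show ?thesis using listedI(1) is_isomorphic_trans[OF _ circulant_K33] by blast
    qed
  qed
qed

end

section \<open>The cases with \<open>s + s\<close> in \<open>gen T\<close>\<close>

context index_two
begin

text \<open>Now \<open>c 2 = 4\<close>, so every \<open>u\<close> in \<open>T\<close> other than
  \<open>- r\<close> has \<open>u + r\<close> in \<open>T\<close>. Against a_1 = 2 this leaves
  \<open>T\<close> as the pair \<open>r\<close>, \<open>- r\<close> with 3r = 0; \<open>s\<close>
  has order 6, and \<open>S\<close> contains its multiples by 1, 2, 4 and 5.\<close>

lemma listed_index_two_clique:
  assumes rT: "r \<in> T" and t: "t \<in> T" "t \<noteq> - r" "t + r \<in> T"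
  shows "listed (cay S)"
proof -
  have c2: "c 2 = 4" using c2_eq[OF t(1,2)] t(3) by simp
  have all: "u + r \<in> T" if "u \<in> T" "u \<noteq> - r" for u
    by (rule ccontr) (use c2_eq[OF that] c2 in simp)
  have "r - u \<in> T \<longleftrightarrow> u \<noteq> r" if u: "u \<in> T" for u
  proof
    assume "u \<noteq> r"
    then show "r - u \<in> T" using all[OF T.minus_in[OF u]] by simp
  qed (use T.zero_notin in auto)
  then have "{u \<in> T. r - u \<in> T} = T - {r}" by auto
  then have "card {u \<in> T. r - u \<in> T} = card T - 1" using rT T.finite_S by simp
  moreover have "card T \<noteq> 0" using rT T.finite_S by auto
  ultimately have cT: "card T + of_bool (r + r = 0) = 2" using sols_r sols_r_eq(1)[OF rT] by simp
  have mrT: "- r \<in> T" using T.minus_in[OF rT] .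
  have r2: "r \<noteq> - r"
  proof
    assume "r = - r"
    then have "card T = 1" using cT r_double_iff by simp
    then have "T = {r}" using rT by (metis card_1_singletonE singletonD)
    then show False using t(1,2) \<open>r = - r\<close> by auto
  qed
  have rr: "r + r \<noteq> 0" using r2 r_double_iff by blast
  have "{r, - r} \<subseteq> T" "card {r, - r} = card T" using rT mrT r2 cT rr by simp_all
  then have T: "T = {r, - r}" using card_subset_eq[OF T.finite_S] by metis
  then have "t = r" using t(1,2) by blast
  then have "r + r \<in> {r, - r}" using t(3) T by simp
  then have rrr: "r + r = - r" using r_neq_0 by auto
  have eqs: "s + s = r" "s + s + s + s = - r" "s + s + s + s + s = - s" "s + s + s + s + s + s = 0"
  proof -
    have "s + s + s + s = r + r" by (simp only: r add.assoc)
    then show "s + s + s + s = - r" using rrr by (rule trans)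
    have "s + s + s + s + s + s = r + r + r" by (simp only: r add.assoc)
    then show 6: "s + s + s + s + s + s = 0" using rrr by (simp only: left_minus)
    then show "s + s + s + s + s = - s" by (simp only: eq_neg_iff_add_eq_0)
    show "s + s = r" by (rule r[symmetric])
  qed
  have r3: "r + s \<noteq> 0" using T.gen_add_iff[OF r_in, of s] s_notin gen_0[of T] by (metis add.commute)
  have m: "multiple s 1 = s" "multiple s 2 = r" "multiple s 3 = r + s" "multiple s 4 = - r" "multiple s 5 = - s" "multiple s 6 = 0"
    using eqs by (simp_all only: multiple_simps One_nat_def)
  have "S = multiple s ` {1, 2, 4, 5}" using S_eq T by (simp only: image_insert image_empty m) blast
  moreover have "multiple s k \<noteq> 0" if "0 < k" "k < 6" for k
    using less_6_cases[OF that(2,1)] s_neq_0 r_neq_0 r3 by (elim disjE) (simp_all only: m neg_equal_0_iff_equal not_False_eq_True)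
  moreover have "{1, 2, 4, 5} \<subseteq> {..<6::nat}" by simp
  ultimately have "is_isomorphic (cay S) (circulant 6 {1, 2, 4, 5})"
    using cay_circulant[of 6 s "{1, 2, 4, 5}" S] s_in m(6) by simp
  then show ?thesis using listedI(2) is_isomorphic_trans[OF _ circulant_K222] by blast
qed

text \<open>\<open>T\<close> contributes no solution for \<open>r\<close>, so a_1 = 2 needs
  \<open>(- s) + (- s)\<close>, and \<open>r\<close> is an involution. The elements
  \<open>s\<close>, \<open>r\<close>, \<open>- s\<close> are the K_4 piece handed to the
  classification.\<close>

lemma listed_index_two_4:
  assumes rT: "r \<in> T" and no: "\<And>t. t \<in> T \<Longrightarrow> t \<noteq> - r \<Longrightarrow> t + r \<notin> T"
  shows "listed (cay S)"
proof -
  have "r - u \<notin> T" if u: "u \<in> T" for u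
  proof
    assume a: "r - u \<in> T"
    then have "u \<noteq> r" using T.zero_notin by auto
    then show False using no[OF T.minus_in[OF u]] a by simp
  qed
  then have "{u \<in> T. r - u \<in> T} = {}" by blast
  then have c0: "card {u \<in> T. r - u \<in> T} = 0" by (simp only: card.empty)
  have rr: "r + r = 0" by (rule ccontr) (use sols_r[unfolded c0] sols_r_eq(1)[OF rT] in simp)
  interpret index_two_involution S s T c a r by unfold_locales (rule rr)
  have ss: "s + s \<in> S" using T_S[OF rT] r by simp
  have s4: "s + s + s + s = 0" using rr r by (simp add: add.assoc)
  show ?thesis
  proof (rule linear_cay_classification[OF linear_cay_4[OF rT], where P = "{s, s + s, - s}"])
    fix i j assume ij: "{s, s + s, - s} \<noteq> {} \<Longrightarrow> 0 < i" "is_isomorphic (cay S) (hamming_shrikhande 4 i j)"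
    show "listed (cay S)" by (rule listed_hamming_shrikhande[OF ij(2)]) (use ij(1) in auto)
  qed (use s_in ss s4 in auto)
qed

text \<open>Here \<open>c 2 = 2\<close>, while \<open>T\<close> contributes nothing to
  \<open>r\<close>; again \<open>(- s) + (- s)\<close> is needed, so \<open>r\<close> is an
  involution.\<close>

lemma listed_index_two_folded:
  assumes rT: "r \<notin> T" and T: "T \<noteq> {}" and no: "\<And>t. t \<in> T \<Longrightarrow> t + r \<notin> T"
  shows "listed (cay S)"
proof -
  obtain t where t: "t \<in> T" using T by blast
  have "t \<noteq> - r" using rT t T.minus_in_iff[of r] by auto
  then have c2: "c 2 = 2" using c2_eq[OF t] no[OF t] by simp
  have "r - u \<notin> T" if u: "u \<in> T" for u
    using no[OF T.minus_in[OF u]] by simp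
  then have "{u \<in> T. r - u \<in> T} = {}" by blast
  then have c0: "card {u \<in> T. r - u \<in> T} = 0" by (simp only: card.empty)
  have rr: "r + r = 0" by (rule ccontr) (use sols_r[unfolded c0] sols_r_eq(2)[OF rT] c2 in simp)
  interpret folded S s T c a r by unfold_locales (use rr rT no in auto)
  have lin: "linear_cay 2 T" "card T = wlen T r" using linear_cay_T_folded by blast+
  show ?thesis
  proof (rule T.linear_cay_classification[OF lin(1), where P = "{}"])
    fix i j assume ij: "2 = (4::nat) \<or> j = 0" "card T = (2 - 1) * (i + 2 * j)" "is_isomorphic (cay T) (hamming_shrikhande 2 i j)"
    then have j: "j = 0" and i: "i = wlen T r" using lin(2) by auto
    have "is_isomorphic (cay T) (hamming_graph (wlen T r) 2)"
      using is_isomorphic_trans[OF ij(3)[unfolded j i] is_isomorphic_sym[OF hamming_shrikhande_0]] .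
    from cay_folded_cube[OF this] show "listed (cay S)" by (intro listedI(7)) simp_all
  qed auto
qed

text \<open>\<open>r\<close> has length 2 over \<open>T\<close>, below the range of
  \<open>folded\<close>. The group generated by \<open>T\<close> has order 4; Klein or cyclic, its
  graph is a 4-cycle with \<open>r\<close> opposite to 0, and \<open>S\<close> yields the folded
  4-cube.\<close>

lemma listed_index_two_square:
  assumes rT: "r \<notin> T" and rr: "r + r = 0" and cT: "card T = 2" and all: "\<And>t. t \<in> T \<Longrightarrow> t + r \<in> T"
  shows "listed (cay S)"
proof -
  interpret index_two_involution S s T c a r by unfold_locales (rule rr)
  obtain t where t: "t \<in> T" using cT by fastforce
  have tr: "t + r \<in> T" using all[OF t] .
  have ne: "t \<noteq> t + r" using r_neq_0 by simp
  have T: "T = {t, t + r}"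
    using card_subset_eq[OF T.finite_S, of "{t, t + r}"] t tr ne cT by simp
  have dec: "decomposes 2 2 0 T"
  proof (cases "t + t = 0")
    case True
    have d: "decomposes 2 1 0 {u}" if "u + u = 0" "u \<noteq> 0" for u :: 'g
      using decomposes_complete[of "{u}" 2] that by (simp add: neg_eq_iff_add_eq_0)
    have "t + r + (t + r) = (t + t) + (r + r)" by (simp add: add_ac)
    then have "t + r + (t + r) = 0" using True rr by simp
    moreover have "t \<noteq> 0" "t + r \<noteq> 0" using t tr T.zero_notin by metis+
    ultimately have "decomposes 2 (1 + 1) (0 + 0) ({t} \<union> {t + r})"
      using ne by (intro decomposes_Un d) (use True in auto)
    then show ?thesis unfolding T by (simp add: numeral_2_eq_2 insert_is_Un[of t "{t + r}"])
  next
    case False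
    then have "- t \<noteq> t" by (simp add: neg_eq_iff_add_eq_0)
    then have mt: "- t = t + r" using T.minus_in[OF t] T by auto
    have "t + r + (t + r) = (t + t) + (r + r)" by (simp add: add_ac)
    then have "- t + - t = t + t" unfolding mt using rr by simp
    then have "t + t + (t + t) = 0" by (simp add: eq_neg_iff_add_eq_0[symmetric])
    then have "t + t + t + t = 0" by (simp only: add.assoc)
    then show ?thesis using decomposes_4_cycle[OF False] unfolding T mt[symmetric] by simp
  qed
  have "{0, r, t, t + r} \<subseteq> gen T" using gen_0 r_in gen_base[OF t] gen_base[OF tr] by auto
  moreover have "card {0, r, t, t + r} = 4"
  proof -
    have "0 \<noteq> r" "0 \<noteq> t" "0 \<noteq> t + r" "r \<noteq> t" "r \<noteq> t + r" using r_neq_0 rT t tr T.zero_notin by metis+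
    then show ?thesis using ne by simp
  qed
  ultimately have "4 \<le> card (gen T)" using card_mono[OF T.finite_gen] by metis
  then have iso: "is_isomorphic (cay T) (hamming_shrikhande 2 2 0)" using dec by (simp add: decomposes_def)
  have "r - t = - (t + r)" using mr by (metis add_uminus_conv_diff minus_add_distrib add.commute)
  then have "r - t \<in> T" using T.minus_in[OF tr] by simp
  then have w: "wlen T r = 2" using T.wlen_eq_2I[OF t] r_neq_0 rT by blast
  have "is_isomorphic (cay T) (hamming_graph (wlen T r) 2)"
    unfolding w using is_isomorphic_trans[OF iso is_isomorphic_sym[OF hamming_shrikhande_0]] .
  from cay_folded_cube[OF this] show "listed (cay S)" by (intro listedI(7)) simp_all
qed

text \<open>\<open>T\<close> is a coset of the group of order 3 generated by \<open>r\<close> and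
  contains an involution \<open>t\<close>. With the further involution \<open>e = s + r\<close>, the
  set \<open>S\<close> is the translate by \<open>e\<close> of the nonzero elements of the subgroup
  \<open>E\<close> generated by \<open>r\<close> and \<open>w = t + e\<close>, of order 6.\<close>

lemma listed_index_two_K66:
  assumes rT: "r \<notin> T" and rr: "r + r \<noteq> 0" and cT: "card T = 3" and all: "\<And>t. t \<in> T \<Longrightarrow> t + r \<in> T"
  shows "listed (cay S)"
proof -
  have T3: "T = {t, t + r, t + r + r}" if t: "t \<in> T" for t
  proof -
    have "t + r \<in> T" "t + r + r \<in> T" using all t by blast+
    moreover have "t + r + r \<noteq> t" using rr by (simp add: add.assoc)
    ultimately show ?thesis
      using card_subset_eq[OF T.finite_S, of "{t, t + r, t + r + r}"] t cT r_neq_0 by auto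
  qed
  obtain u where u: "u \<in> T" using cT by fastforce
  have "u + r + r + r \<in> {u, u + r, u + r + r}" using all[OF all[OF all[OF u]]] T3[OF u] by blast
  moreover have "u + r + r + r = u + (r + r + r)" "u + r + r + r = u + r + (r + r)" by (simp_all add: add.assoc)
  \<comment> \<open>The alternatives would mean \<open>r + r = 0\<close> or
    \<open>r = 0\<close>.\<close>
  ultimately have rrr: "r + r + r = 0" using rr r_neq_0 by auto
  have mr: "- r = r + r" by (rule minus_unique) (use rrr in \<open>simp only: add.assoc\<close>)
  \<comment> \<open>Negation permutes the three elements of \<open>T\<close>, hence fixes one of
    them.\<close>
  have "\<exists>t\<in>T. t + t = 0"
  proof -
    have "- u \<in> {u, u + r, u + r + r}" using T3[OF u] T.minus_in[OF u] by blast
    then have "- u = u \<or> - u = u + r \<or> - u = u + r + r" by blast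
    then consider "u + u = 0" | "(u + r + r) + (u + r + r) = 0" | "(u + r) + (u + r) = 0"
    proof (elim disjE)
      assume "- u = u + r"
      then have "u + (u + r) = 0" by (metis add.right_inverse)
      moreover have "(u + r + r) + (u + r + r) = (u + (u + r)) + (r + r + r)" by (simp add: add_ac)
      ultimately show ?thesis using that(2) rrr by simp
    next
      assume "- u = u + r + r"
      then have "u + (u + r + r) = 0" by (metis add.right_inverse)
      moreover have "(u + r) + (u + r) = u + (u + r + r)" by (simp add: add_ac)
      ultimately show ?thesis using that(3) by simp
    qed (use that(1) in \<open>simp add: neg_eq_iff_add_eq_0\<close>)
    then show ?thesis using u all[OF u] all[OF all[OF u]] by cases blast+
  qed
  then obtain t where t: "t \<in> T" "t + t = 0" by blast
  have tH: "t \<in> gen T" by (rule gen_base[OF t(1)])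
  define e where "e = s + r"
  define w where "w = t + e"
  define E where "E = {0, r, r + r, w, w + r, w + r + r}"
  have ee: "e + e = 0"
  proof -
    have "e + e = r + r + r" unfolding e_def by (simp add: r add_ac)
    then show ?thesis using rrr by simp
  qed
  have "w + w = (t + t) + (e + e)" by (simp add: w_def add_ac)
  then have ww: "w + w = 0" using t(2) ee by simp
  have eH: "e \<notin> gen T" unfolding e_def using T.gen_add_iff[OF r_in] s_notin by blast
  have wh: "w + h \<notin> gen T" if "h \<in> gen T" for h
    unfolding w_def using T.gen_add_iff[OF that] T.gen_add_iff[OF tH, of e] eH by (metis add.commute)
  have rH: "0 \<in> gen T" "r \<in> gen T" "r + r \<in> gen T" using gen_0 r_in gen_add by auto
  have wr: "w \<notin> gen T" "w + r \<notin> gen T" "w + r + r \<notin> gen T"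
    using wh[OF rH(1)] wh[OF rH(2)] wh[OF rH(3)] by (simp_all add: add.assoc)
  have cE: "card E = 6"
  proof -
    have "card {0, r, r + r} = 3" using r_neq_0 rr by simp
    moreover have "E = {0, r, r + r} \<union> (\<lambda>x. w + x) ` {0, r, r + r}" unfolding E_def by (auto simp: add.assoc)
    moreover have "{0, r, r + r} \<inter> (\<lambda>x. w + x) ` {0, r, r + r} = {}"
    proof -
      have sub: "{0, r, r + r} \<subseteq> gen T" using rH by simp
      then have "x \<notin> gen T" if "x \<in> (\<lambda>x. w + x) ` {0, r, r + r}" for x using that wh by blast
      then show ?thesis using sub by blast
    qed
    ultimately show ?thesis by (simp only: card_Un_disjoint card_image[OF inj_on_add] finite.intros finite_imageI)
  qed
  have E_iff: "x \<in> E \<longleftrightarrow> (\<exists>i\<in>{0, r, r + r}. \<exists>j\<in>{0, w}. x = j + i)" for x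
    unfolding E_def by (auto simp: add.assoc)
  have R: "i + i' \<in> {0, r, r + r}" if "i \<in> {0, r, r + r}" "i' \<in> {0, r, r + r}" for i i'
  proof -
    have "r + (r + r) = 0" "r + r + (r + r) = r" using rrr by (simp_all add: add.assoc[symmetric])
    then show ?thesis using that rrr by auto
  qed
  have W: "j + j' \<in> {0, w}" if "j \<in> {0, w}" "j' \<in> {0, w}" for j j' using that ww by auto
  have E_add: "x + y \<in> E" if "x \<in> E" "y \<in> E" for x y
  proof -
    obtain i j i' j' where ij: "i \<in> {0, r, r + r}" "j \<in> {0, w}" "x = j + i" "i' \<in> {0, r, r + r}" "j' \<in> {0, w}" "y = j' + i'"
      using \<open>x \<in> E\<close> \<open>y \<in> E\<close> unfolding E_iff by blast
    then have "x + y = (j + j') + (i + i')" by (simp add: add_ac)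
    then show ?thesis unfolding E_iff using R[OF ij(1,4)] W[OF ij(2,5)] by blast
  qed
  have E_minus: "- x \<in> E" if "x \<in> E" for x
  proof -
    obtain i j where ij: "i \<in> {0, r, r + r}" "j \<in> {0, w}" "x = j + i" using \<open>x \<in> E\<close> unfolding E_iff by blast
    have "- w = w" "- (r + r) = r" using ww mr by (simp only: neg_eq_iff_add_eq_0, metis minus_minus)
    then have "- i \<in> {0, r, r + r}" "- j \<in> {0, w}" using ij(1,2) mr by auto
    moreover have "- x = - j + - i" using ij(3) by (simp add: minus_add_distrib)
    ultimately show ?thesis unfolding E_iff by blast
  qed
  have E_diff: "x - y \<in> E" if "x \<in> E" "y \<in> E" for x y
    using E_add[OF that(1) E_minus[OF that(2)]] by simp
  have xee: "x + e + e = x" for x using ee by (simp add: add.assoc)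
  have eE: "e \<notin> E"
  proof
    assume "e \<in> E"
    then have "e \<in> {w, w + r, w + r + r}" using eH rH unfolding E_def by blast
    then have "0 \<in> {t, t + r, t + r + r}" unfolding w_def by (auto simp: add_ac)
    then show False using T3[OF t(1)] T.zero_notin by simp
  qed
  have st: "s = r + r + e" "- s = r + e"
  proof -
    have "r + r + e = s + (r + r + r)" by (simp add: e_def add_ac)
    then show s: "s = r + r + e" using rrr by simp
    have "s + (r + e) = (r + r + r) + (e + e)" by (subst s) (simp add: add_ac)
    then show "- s = r + e" using rrr ee by (simp add: neg_eq_iff_add_eq_0)
  qed
  have wt: "w + e = t" "w + r + e = t + r" "w + r + r + e = t + r + r"
    using xee[of t] xee[of "t + r"] xee[of "t + r + r"] unfolding w_def by (simp_all add: add_ac)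
  have E0: "E - {0} = {r, r + r, w, w + r, w + r + r}"
    unfolding E_def using r_neq_0 rr wr rH(1) by auto
  have S: "S = (\<lambda>x. x + e) ` (E - {0})"
    unfolding E0 image_insert image_empty wt st[symmetric] using S_eq T3[OF t(1)] by blast
  have "gen S \<subseteq> E \<union> (\<lambda>x. x + e) ` E"
  proof (rule gen_minimal)
    show "0 \<in> E \<union> (\<lambda>x. x + e) ` E" by (simp add: E_def)
    fix x y assume x: "x \<in> E \<union> (\<lambda>x. x + e) ` E" and y: "y \<in> S"
    obtain k where k: "k \<in> E" "y = k + e" using y S by blast
    obtain h where h: "h \<in> E" "x = h \<or> x = h + e" using x by blast
    have "y + x = (k + h) + e \<or> y + x = (k + h) + (e + e)" using h(2) k(2) by (auto simp: add_ac)
    then have "y + x = (k + h) + e \<or> y + x = k + h" unfolding ee by simp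
    then show "y + x \<in> E \<union> (\<lambda>x. x + e) ` E"
      using E_add[OF k(1) h(1)] imageI[OF E_add[OF k(1) h(1)], of "\<lambda>x. x + e"] by (metis UnI1 UnI2)
  qed
  moreover have "E \<union> (\<lambda>x. x + e) ` E \<subseteq> gen S"
  proof -
    have 1: "e \<in> gen S" unfolding e_def using gen_add[OF gen_base[OF s_in] gen_T_S[OF r_in]] .
    then have w: "w \<in> gen S" unfolding w_def using gen_add[OF gen_T_S[OF tH]] by blast
    have r: "r \<in> gen S" using gen_T_S[OF r_in] .
    have "E \<subseteq> gen S" unfolding E_def using gen_0 w r gen_add[OF r r] gen_add[OF w r] gen_add[OF gen_add[OF w r] r] by simp
    then show ?thesis using gen_add[OF _ 1] by blast
  qed
  ultimately have g: "gen S = E \<union> (\<lambda>x. x + e) ` E" by (rule subset_antisym)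
  have "finite E" "0 \<in> E" by (simp_all add: E_def)
  from cay_complete_bipartite_minus_matching[OF this E_diff ee eE S g]
  show ?thesis unfolding cE by (rule listedI(3))
qed

text \<open>For \<open>r\<close> outside \<open>T\<close> and \<open>c 2 = 4\<close>, all of
  \<open>T\<close> solves the equation for \<open>r\<close>; comparing the counts leaves
  \<open>card T = 2\<close> for an involution \<open>r\<close> and \<open>card T = 3\<close>
  otherwise.\<close>

lemma listed_index_two:
  assumes T: "T \<noteq> {}"
  shows "listed (cay S)"
proof (cases "r \<in> T")
  case True
  then show ?thesis using listed_index_two_clique listed_index_two_4 by metis
next
  case rT: False
  have mr: "t \<noteq> - r" if "t \<in> T" for t using that rT T.minus_in_iff[of r] by auto
  show ?thesis
  proof (cases "\<exists>t\<in>T. t + r \<in> T")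
    case True
    then obtain t where t: "t \<in> T" "t + r \<in> T" by blast
    have c2: "c 2 = 4" using c2_eq[OF t(1) mr[OF t(1)]] t(2) by simp
    have all: "u + r \<in> T" if "u \<in> T" for u
      by (rule ccontr) (use c2_eq[OF that mr[OF that]] c2 in simp)
    have "r - u \<in> T" if "u \<in> T" for u using all[OF T.minus_in[OF that]] by simp
    then have "{u \<in> T. r - u \<in> T} = T" by blast
    then have cT: "card T + 1 + of_bool (r + r = 0) = 4" using sols_r sols_r_eq(2)[OF rT] c2 by simp
    show ?thesis
    proof (cases "r + r = 0")
      case True
      then show ?thesis using listed_index_two_square[OF rT True _ all] cT by simp
    next
      case False
      then show ?thesis using listed_index_two_K66[OF rT False _ all] cT by simp
    qed
  next
    case False
    then show ?thesis using listed_index_two_folded[OF rT T] by blast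
  qed
qed

end

lemma (in split_cayley) listed_cay: "listed (cay S)"
proof (cases "s + s = 0")
  case True
  then show ?thesis using listed_linear[OF linear_product_2] s_in by blast
next
  case ss: False
  show ?thesis
  proof (cases "T = {}")
    case True
    then show ?thesis using listed_cyclic ss by blast
  next
    case T: False
    show ?thesis
    proof (cases "s + s \<in> gen T")
      case True
      interpret index_two S s T c a "s + s" by unfold_locales (use True ss in simp_all)
      show ?thesis using listed_index_two[OF T] .
    next
      case False
      then show ?thesis using listed_product[OF _ T] by blast
    qed
  qed
qed

theorem (in cayley) distance_regular_cay_listed:
  assumes "distance_regular (cay S)" "s \<in> S" "gen (S - {s, - s}) \<noteq> gen S"
  shows "listed (cay S)"
proof (rule distance_regular_cay_imp[OF assms(1)])
  fix c a assume "\<And>x. x \<in> gen S \<Longrightarrow> dn S x = c (wlen S x) \<and> lv S x = a (wlen S x)"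
  then interpret split_cayley S s "S - {s, - s}" c a using assms(2,3) by unfold_locales simp_all
  show ?thesis by (rule listed_cay)
qed

section \<open>Transfer to the given group and to library isomorphism\<close>

lemma graph_iso_iff_is_isomorphic:
  assumes "pair_graph \<Gamma>" "distance_regular \<Delta>"
  shows "\<Gamma> \<cong>\<^sub>g \<Delta> \<longleftrightarrow> is_isomorphic \<Gamma> \<Delta>"
  unfolding is_isomorphic_def
  by (rule graph_iso_iff) (use assms in \<open>auto simp: distance_regular_def intro: pair_graph_imp_wf\<close>)

lemma distance_regular_listed:
  assumes "pair_graph \<Gamma>" "listed \<Gamma>"
  shows "distance_regular \<Gamma>"
proof -
  note dr = distance_regular_isomorphic[OF assms(1)]
  show ?thesis using assms(2) unfolding listed_def
  proof (elim disjE exE conjE bexE)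
    fix d n assume n: "n \<in> {2, 3, 4}" and iso: "is_isomorphic \<Gamma> (hamming_graph d n)"
    have "2 \<le> n" using n by auto
    then show ?thesis by (rule dr[OF iso distance_regular_hamming])
  qed (erule dr, (rule distance_regular_K33 distance_regular_K222 distance_regular_K66_minus
      distance_regular_cycle distance_regular_doob distance_regular_antipodal_quotient; assumption?))+
qed

text \<open>Library isomorphism needs well-formed graphs on both sides; for the listed graphs this
  is taken from their distance-regularity.\<close>

lemma listed_iff_graph_iso:
  assumes "pair_graph \<Gamma>"
  shows "listed \<Gamma> \<longleftrightarrow>
      \<Gamma> \<cong>\<^sub>g complete_multipartite [3, 3]
    \<or> \<Gamma> \<cong>\<^sub>g complete_multipartite [2, 2, 2]
    \<or> \<Gamma> \<cong>\<^sub>g complete_bipartite_minus_matching 6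
    \<or> (\<exists>n\<ge>3. \<Gamma> \<cong>\<^sub>g cycle_graph n)
    \<or> (\<exists>d\<ge>1. \<exists>n\<in>{2, 3, 4}. \<Gamma> \<cong>\<^sub>g hamming_graph d n)
    \<or> (\<exists>n\<ge>1. \<exists>m\<ge>1. \<Gamma> \<cong>\<^sub>g doob_graph n m)
    \<or> (\<exists>d\<ge>2. \<Gamma> \<cong>\<^sub>g antipodal_quotient_hypercube d)"
proof -
  note gi = graph_iso_iff_is_isomorphic[OF assms]
  have "\<Gamma> \<cong>\<^sub>g hamming_graph d n \<longleftrightarrow> is_isomorphic \<Gamma> (hamming_graph d n)" if "n \<in> {2, 3, 4}" for d n
    by (rule gi, rule distance_regular_hamming) (use that in auto)
  then show ?thesis unfolding listed_def gi[OF distance_regular_K33] gi[OF distance_regular_K222]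
      gi[OF distance_regular_K66_minus] gi[OF distance_regular_doob]
    using gi[OF distance_regular_cycle] gi[OF distance_regular_antipodal_quotient] by (simp cong: conj_cong)
qed

text \<open>For inverse-closed sets \<open>generate\<close> corresponds to sums of generators, so
  \<open>gen\<close> of the image is the image of the generated subgroup. This is applied both to
  \<open>S\<close> and to \<open>S\<close> without \<open>s\<close> and its inverse.\<close>

lemma (in comm_group) cayley_graph_embeds:
  assumes fin: "finite (carrier G)" and S: "S \<subseteq> carrier G - {\<one>}" and inv: "\<And>s. s \<in> S \<Longrightarrow> inv s \<in> S"
    and gen_S: "generate G S = carrier G" and s: "s \<in> S" "generate G (S - {s, inv s}) \<noteq> carrier G"
  obtains S' :: "torus set" and s' where "cayley S'" "is_isomorphic (cayley_graph G S) (cay S')"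
    "s' \<in> S'" "gen (S' - {s', - s'}) \<noteq> gen S'"
proof -
  obtain \<phi> :: "'a \<Rightarrow> torus" where inj: "inj_on \<phi> (carrier G)"
    and hom: "\<And>x y. x \<in> carrier G \<Longrightarrow> y \<in> carrier G \<Longrightarrow> \<phi> (x \<otimes> y) = \<phi> x + \<phi> y"
    using finite_embeds_torus[OF fin] by blast
  have SG: "S \<subseteq> carrier G" using S by blast
  have one: "\<phi> \<one> = 0" using hom[of \<one> \<one>] by simp
  have inv_\<phi>: "\<phi> (inv x) = - \<phi> x" if "x \<in> carrier G" for x
    using hom[of x "inv x"] that one by (simp add: eq_neg_iff_add_eq_0 add.commute)
  have gen_\<phi>: "gen (\<phi> ` A) = \<phi> ` generate G A" if A: "A \<subseteq> carrier G" "\<And>x. x \<in> A \<Longrightarrow> inv x \<in> A" for A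
  proof
    have gA: "generate G A \<subseteq> carrier G" by (rule generate_incl[OF A(1)])
    show "gen (\<phi> ` A) \<subseteq> \<phi> ` generate G A"
    proof (rule gen_minimal)
      show "0 \<in> \<phi> ` generate G A" using one generate.one[of G A] by (metis imageI)
      fix x t assume "x \<in> \<phi> ` generate G A" "t \<in> \<phi> ` A"
      then obtain y u where yu: "y \<in> generate G A" "x = \<phi> y" "u \<in> A" "t = \<phi> u" by blast
      then have "u \<otimes> y \<in> generate G A" using generate.eng[OF generate.incl] by metis
      moreover have "t + x = \<phi> (u \<otimes> y)" using hom[of u y] yu gA A(1) by (metis subsetD)
      ultimately show "t + x \<in> \<phi> ` generate G A" by blast
    qed
    show "\<phi> ` generate G A \<subseteq> gen (\<phi> ` A)"
    proof (rule image_subsetI)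
      fix x assume "x \<in> generate G A"
      then show "\<phi> x \<in> gen (\<phi> ` A)"
      proof induction
        case one
        then show ?case unfolding \<open>\<phi> \<one> = 0\<close> by (rule gen_0)
      next
        case (incl h)
        then show ?case by (intro gen_base imageI)
      next
        case (inv h)
        then show ?case by (intro gen_base imageI A(2))
      next
        case (eng h1 h2)
        then have "\<phi> (h1 \<otimes> h2) = \<phi> h1 + \<phi> h2" using hom gA by blast
        then show ?case using gen_add eng.IH by metis
      qed
    qed
  qed
  have gS: "gen (\<phi> ` S) = \<phi> ` carrier G" using gen_\<phi>[OF SG inv] gen_S by simp
  have "s \<in> carrier G" "inv s \<in> S" using s(1) SG inv by auto
  have S': "\<phi> ` (S - {s, inv s}) = \<phi> ` S - {\<phi> s, - \<phi> s}"
    using inj_on_image_set_diff[OF inj, of S "{s, inv s}"] SG s(1) inv[OF s(1)] inv_\<phi>[of s] by auto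
  show ?thesis
  proof (rule that[of "\<phi> ` S" "\<phi> s"])
    show "cayley (\<phi> ` S)"
    proof
      show "finite (gen (\<phi> ` S))" using fin gS by simp
      show "0 \<notin> \<phi> ` S"
      proof
        assume "0 \<in> \<phi> ` S"
        then obtain x where "x \<in> S" "\<phi> x = \<phi> \<one>" using one by auto
        then show False using inj_onD[OF inj, of x \<one>] S by auto
      qed
      show "- x \<in> \<phi> ` S" if x: "x \<in> \<phi> ` S" for x
      proof -
        obtain y where "y \<in> S" "x = \<phi> y" using x by blast
        then show ?thesis using inv_\<phi>[of y] inv[of y] SG by (metis imageI subsetD)
      qed
    qed
    show "is_isomorphic (cayley_graph G S) (cay (\<phi> ` S))"
    proof (rule is_isomorphicI[of \<phi>])
      show "bij_betw \<phi> (pverts (cayley_graph G S)) (pverts (cay (\<phi> ` S)))"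
        using inj gS by (simp add: bij_betw_def cayley_graph_def cay_def)
      fix x y assume "x \<in> pverts (cayley_graph G S)" "y \<in> pverts (cayley_graph G S)"
      then have xy: "x \<in> carrier G" "y \<in> carrier G" by (simp_all add: cayley_graph_def)
      have "y = x \<otimes> u \<longleftrightarrow> \<phi> y - \<phi> x = \<phi> u" if u: "u \<in> S" for u
      proof -
        have "y = x \<otimes> u \<longleftrightarrow> \<phi> y = \<phi> (x \<otimes> u)" using inj_on_eq_iff[OF inj] xy u SG by blast
        also have "\<phi> (x \<otimes> u) = \<phi> x + \<phi> u" using hom xy u SG by blast
        finally show ?thesis by (simp add: algebra_simps)
      qed
      then show "(x, y) \<in> parcs (cayley_graph G S) \<longleftrightarrow> (\<phi> x, \<phi> y) \<in> parcs (cay (\<phi> ` S))"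
        using xy gS by (auto simp: cayley_graph_def cay_def)
    qed
    have sub: "S - {s, inv s} \<subseteq> carrier G" using SG by blast
    have "inv x \<in> S - {s, inv s}" if "x \<in> S - {s, inv s}" for x
      using that inv[of x] inv_inv[of x] inv_inv[of s] SG s(1) by auto
    from gen_\<phi>[OF sub this] have "gen (\<phi> ` S - {\<phi> s, - \<phi> s}) = \<phi> ` generate G (S - {s, inv s})"
      unfolding S' .
    moreover have "generate G (S - {s, inv s}) \<subseteq> carrier G" by (rule generate_incl[OF sub])
    ultimately show "gen (\<phi> ` S - {\<phi> s, - \<phi> s}) \<noteq> gen (\<phi> ` S)"
      unfolding gS using s(2) inj_on_image_eq_iff[OF inj] by simp
  qed (use s(1) in simp)
qed

theorem theorem1p1:
  fixes G (structure) and S :: "'a set"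
  assumes "comm_group G" and "finite (carrier G)"
    and "S \<subseteq> carrier G - {\<one>}"
    and "\<forall>s\<in>S. inv s \<in> S"
    and "generate G S = carrier G"
    and "\<exists>s\<in>S. generate G (S - {s, inv s}) \<noteq> carrier G"
  shows "distance_regular (cayley_graph G S) \<longleftrightarrow>
      cayley_graph G S \<cong>\<^sub>g complete_multipartite [3, 3]
    \<or> cayley_graph G S \<cong>\<^sub>g complete_multipartite [2, 2, 2]
    \<or> cayley_graph G S \<cong>\<^sub>g complete_bipartite_minus_matching 6
    \<or> (\<exists>n\<ge>3. cayley_graph G S \<cong>\<^sub>g cycle_graph n)
    \<or> (\<exists>d\<ge>1. \<exists>n\<in>{2, 3, 4}. cayley_graph G S \<cong>\<^sub>g hamming_graph d n)
    \<or> (\<exists>n\<ge>1. \<exists>m\<ge>1. cayley_graph G S \<cong>\<^sub>g doob_graph n m)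
    \<or> (\<exists>d\<ge>2. cayley_graph G S \<cong>\<^sub>g antipodal_quotient_hypercube d)"
proof -
  interpret comm_group G by fact
  have pg: "pair_graph (cayley_graph G S)"
    using pair_graph_cayley_graph[OF is_group assms(2,3)] assms(4) by blast
  obtain s where s: "s \<in> S" "generate G (S - {s, inv s}) \<noteq> carrier G" using assms(6) by blast
  have "listed (cayley_graph G S)" if dr: "distance_regular (cayley_graph G S)"
  proof (rule cayley_graph_embeds[OF assms(2,3) assms(4)[rule_format] assms(5) s])
    fix S' :: "torus set" and s'
    assume S': "cayley S'" "is_isomorphic (cayley_graph G S) (cay S')" "s' \<in> S'" "gen (S' - {s', - s'}) \<noteq> gen S'"
    have "distance_regular (cay S')"
      using distance_regular_isomorphic[OF cayley.pair_graph_cay[OF S'(1)] is_isomorphic_sym[OF S'(2)] dr] .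
    then have "listed (cay S')" using cayley.distance_regular_cay_listed[OF S'(1) _ S'(3,4)] by blast
    then show ?thesis by (rule listed_isomorphic[OF S'(2)])
  qed
  then have "distance_regular (cayley_graph G S) \<longleftrightarrow> listed (cayley_graph G S)"
    using distance_regular_listed[OF pg] by blast
  then show ?thesis unfolding listed_iff_graph_iso[OF pg] .
qed

end
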